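(* Let $D$ be a distributive lattice with zero and let $\langle P,\varphi\rangle$ be a balanced $D$-measured partial lattice. Let $j_P\colon P\to F_{\mathbf L}(P)$ be the natural map from $P$ to the free lattice on the partial lattice $P$. Then there exists a $\{\vee,0\}$-homomorphism $\psi\colon\mathrm{Con}_c\,F_{\mathbf L}(P)\to D$ such that $$\psi\circ\mathrm{Con}_c\,j_P=\varphi .$$
   Context: **Partial lattices.** $[X]^{<\omega}_*$ is the set of nonempty finite subsets of $X$. For a preordering $\le$ on $P$, "$a=\sup X$" means that $x\le a$ for all $x\in X$ and that $a\le b$ whenever $x\le b$ for all $x\in X$; $\inf$ is dual. A *partial prelattice* is $\langle P,\le,\bigvee,\bigwedge\rangle$ with $P$ a nonempty set, $\le$ a preordering on $P$, and $\bigvee,\bigwedge$ partial functions from $[P]^{<\omega}_*$ to $P$ such that $a=\bigvee X$ implies $a=\sup X$ and $a=\bigwedge X$ implies $a=\inf X$. It is a *partial lattice* if $\le$ is antisymmetric. Lattices are identified with partial lattices in which $\bigvee,\bigwedge$ are defined on all of $[P]^{<\omega}_*$. A *homomorphism* of partial lattices is an order-preserving map $f$ such that $a=\bigvee X$ implies $f(a)=\bigvee f[X]$ and $a=\bigwedge X$ implies $f(a)=\bigwedge f[X]$; it is an *embedding* if moreover $f(a)\le f(b)$ implies $a\le b$. The *free lattice on $P$* is a lattice $F_{\mathbf L}(P)$ with a homomorphism of partial lattices $j_P\colon P\to F_{\mathbf L}(P)$ that is universal (initial) among homomorphisms of partial lattices from $P$ to lattices; $j_P$ is an embedding. **Congruences.**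 A *congruence* of a partial lattice $P$ is a preordering $\preceq$ of $P$ containing $\le$ such that $\langle P,\preceq,\bigvee,\bigwedge\rangle$ is a partial prelattice. Ordered by inclusion the congruences form an algebraic lattice; $\mathrm{Con}_c\,P$ is the $\{\vee,0\}$-semilattice of its compact elements, with zero $\mathbf 0_P$ (the ordering of $P$). $\Theta_P^+(a,b)$ is the least congruence containing $\langle a,b\rangle$. For a homomorphism $f\colon P\to Q$, $\mathrm{Con}_c f\colon\mathrm{Con}_c P\to\mathrm{Con}_c Q$ sends $\alpha$ to the congruence of $Q$ generated by all $\langle f(x),f(y)\rangle$ with $\langle x,y\rangle\in\alpha$. A $\{\vee,0\}$-homomorphism preserves binary joins and $0$. **Measured and comeasured partial lattices.** For a distributive lattice $D$ with zero, a *$D$-measured partial lattice* is a pair $\langle P,\varphi\rangle$ with $P$ a partial lattice and $\varphi\colon\mathrm{Con}_cP\to D$ a $\{\vee,0\}$-homomorphism. Let $E=D^{\mathrm d}$ be the dual lattice of $D$ (a distributive lattice with unit $1_E=0_D$), and put $\|x\le y\|=\varphi(\Theta_P^+(x,y))\in E$. All lattice operations on values $\|\cdot\|$ below are computed in $E$. This makes $P$ an *$E$-comeasured partial lattice*: $\|x\le y\|=1$ if $x\le y$; $\|x\le y\|\wedge\|y\le z\|\le\|x\le z\|$; $a=\bigvee X$ implies $\|a\le b\|=\bigwedge_{x\in X}\|x\le b\|$; and $a=\bigwedge X$ implies $\|b\le a\|=\bigwedge_{x\in X}\|b\le x\|$. **Balanced.** Let $P$ be an $E$-comeasured partial lattice.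 Put $\|a=b\|=\|a\le b\|\wedge\|b\le a\|$; for $X,Y\in[P]^{<\omega}_*$ put $\|X\subseteq Y\|=\bigwedge_{x\in X}\bigvee_{y\in Y}\|x=y\|$ and $\|X=Y\|=\|X\subseteq Y\|\wedge\|Y\subseteq X\|$. For $\mathcal D\subseteq[P]^{<\omega}_*$, a *$\mathcal D$-cover* of $X\in[P]^{<\omega}_*$ is a nonempty finite $\mathcal D'\subseteq\mathcal D$ such that $\|X=Y\|\le\bigvee_{Z\in\mathcal D'}\|X=Z\|$ for all $Y\in\mathcal D$. $P$ is *finitely covering* if every $X\in[P]^{<\omega}_*$ has a $\mathrm{dom}\bigvee$-cover and a $\mathrm{dom}\bigwedge$-cover. In that case put $\|a=\bigvee X\|=\bigvee_{i<n}\|a=a_i\|\wedge\|X=X_i\|$, where $\{X_i\mid i<n\}$ is any $\mathrm{dom}\bigvee$-cover of $X$ and $a_i=\bigvee X_i$ (the value does not depend on the cover); define $\|a=\bigwedge X\|$ dually using $\mathrm{dom}\bigwedge$-covers. A *join-sample* of $X$ is a nonempty finite $U\subseteq P$ with $\|x=\bigvee X\|\le\bigvee_{u\in U}\|u=\bigvee X\|$ for all $x\in P$; meet-samples are defined dually (these exist when $P$ is finitely covering). Put $\|a\le\bigvee X\|=\bigvee_{u\in U}\|a\le u\|\wedge\|u=\bigvee X\|$ for any join-sample $U$ of $X$, and $\|\bigwedge X\le a\|=\bigvee_{u\in U}\|u\le a\|\wedge\|u=\bigwedge X\|$ for any meet-sample $U$ of $X$ (independent of $U$). For $X,U\in[P]^{<\omega}_*$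 put $\|a\in\mathrm{Id}_0(X,U)\|=\bigvee_{x\in X}\|a\le x\|$ and $$\|a\in\mathrm{Id}_{n+1}(X,U)\|=\|a\in\mathrm{Id}_n(X,U)\|\vee\bigvee_{\varnothing\ne Z\subseteq U}\Bigl(\|a\le\textstyle\bigvee Z\|\wedge\bigwedge_{z\in Z}\|z\in\mathrm{Id}_n(X,U)\|\Bigr);$$ $\|a\in\mathrm{Fil}_n(X,U)\|$ is defined dually, starting with $\bigvee_{x\in X}\|x\le a\|$ and using $\|\bigwedge Z\le a\|$. A finitely covering $P$ has: - $(\mathrm{Id}\cap)$ if for all $a,b\in P$ there is $U\in[P]^{<\omega}_*$ with $\|x\le a\|\wedge\|x\le b\|=\bigvee_{u\in U}\|x\le u\|\wedge\|u\le a\|\wedge\|u\le b\|$ for all $x\in P$; - $(\mathrm{Fil}\cap)$ if the dual holds: for all $a,b$ there is $U$ with $\|a\le x\|\wedge\|b\le x\|=\bigvee_{u\in U}\|u\le x\|\wedge\|a\le u\|\wedge\|b\le u\|$ for all $x$; - $(\mathrm{Id}\vee)$ if for every $X\in[P]^{<\omega}_*$ there are $U\in[P]^{<\omega}_*$ and $n<\omega$ with $\|a\in\mathrm{Id}_n(X,U)\|=\|a\in\mathrm{Id}_{n+1}(X,Y)\|$ for all $a\in P$ and all finite $Y\supseteq U$; - $(\mathrm{Fil}\vee)$ if the same holds with $\mathrm{Fil}$ in place of $\mathrm{Id}$. $P$ is *balanced* if it is finitely covering and has $(\mathrm{Id}\cap)$, $(\mathrm{Id}\vee)$, $(\mathrm{Fil}\cap)$,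 $(\mathrm{Fil}\vee)$. A $D$-measured partial lattice is *balanced* if the associated $D^{\mathrm d}$-comeasured partial lattice is balanced. *)

theory Defs
  imports Main "HOL-Library.Dual_Ordered_Lattice"
begin

section \<open>Partial lattices\<close>

definition nefs :: "'a set \<Rightarrow> 'a set set" where
  "nefs A = {X. X \<subseteq> A \<and> finite X \<and> X \<noteq> {}}"

record 'a partial_lat =
  carr :: "'a set"
  le :: "('a \<times> 'a) set"
  Join :: "'a set \<Rightarrow> 'a option"
  Meet :: "'a set \<Rightarrow> 'a option"

definition is_sup :: "'a set \<Rightarrow> ('a \<times> 'a) set \<Rightarrow> 'a set \<Rightarrow> 'a \<Rightarrow> bool" where
  "is_sup A r X a \<longleftrightarrow> a \<in> A \<and> (\<forall>x\<in>X. (x, a) \<in> r) \<and>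
     (\<forall>b\<in>A. (\<forall>x\<in>X. (x, b) \<in> r) \<longrightarrow> (a, b) \<in> r)"

definition is_inf :: "'a set \<Rightarrow> ('a \<times> 'a) set \<Rightarrow> 'a set \<Rightarrow> 'a \<Rightarrow> bool" where
  "is_inf A r X a \<longleftrightarrow> a \<in> A \<and> (\<forall>x\<in>X. (a, x) \<in> r) \<and>
     (\<forall>b\<in>A. (\<forall>x\<in>X. (b, x) \<in> r) \<longrightarrow> (b, a) \<in> r)"

definition partial_prelattice :: "'a partial_lat \<Rightarrow> bool" where
  "partial_prelattice P \<longleftrightarrow> carr P \<noteq> {} \<and> preorder_on (carr P) (le P) \<and>
     dom (Join P) \<subseteq> nefs (carr P) \<and> dom (Meet P) \<subseteq> nefs (carr P) \<and>
     (\<forall>X a. Join P X = Some a \<longrightarrow> is_sup (carr P) (le P) X a) \<and>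
     (\<forall>X a. Meet P X = Some a \<longrightarrow> is_inf (carr P) (le P) X a)"

definition partial_lattice :: "'a partial_lat \<Rightarrow> bool" where
  "partial_lattice P \<longleftrightarrow> partial_prelattice P \<and> antisym (le P)"

definition is_lattice :: "'a partial_lat \<Rightarrow> bool" where
  "is_lattice L \<longleftrightarrow> partial_lattice L \<and>
     dom (Join L) = nefs (carr L) \<and> dom (Meet L) = nefs (carr L)"

definition pl_hom :: "'a partial_lat \<Rightarrow> 'b partial_lat \<Rightarrow> ('a \<Rightarrow> 'b) \<Rightarrow> bool" where
  "pl_hom P Q f \<longleftrightarrow> f ` carr P \<subseteq> carr Q \<and>
     (\<forall>x y. (x, y) \<in> le P \<longrightarrow> (f x, f y) \<in> le Q) \<and>
     (\<forall>X a. Join P X = Some a \<longrightarrow> Join Q (f ` X) = Some (f a)) \<and>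
     (\<forall>X a. Meet P X = Some a \<longrightarrow> Meet Q (f ` X) = Some (f a))"


section \<open>Congruences\<close>

definition congruence :: "'a partial_lat \<Rightarrow> ('a \<times> 'a) set \<Rightarrow> bool" where
  "congruence P r \<longleftrightarrow> le P \<subseteq> r \<and> partial_prelattice (P\<lparr>le := r\<rparr>)"

text \<open>The least congruence containing \<open>R\<close>, for \<open>R \<subseteq> carr P \<times> carr P\<close>.\<close>

definition cong_gen :: "'a partial_lat \<Rightarrow> ('a \<times> 'a) set \<Rightarrow> ('a \<times> 'a) set" where
  "cong_gen P R = \<Inter> {r. congruence P r \<and> R \<subseteq> r}"

definition Theta_plus :: "'a partial_lat \<Rightarrow> 'a \<Rightarrow> 'a \<Rightarrow> ('a \<times> 'a) set" where
  "Theta_plus P a b = cong_gen P {(a, b)}"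

text \<open>Compact elements of the lattice of all congruences; the supremum of a set \<open>S\<close> of
  congruences is \<open>cong_gen P (\<Union>S)\<close>.\<close>

definition Con_c :: "'a partial_lat \<Rightarrow> ('a \<times> 'a) set set" where
  "Con_c P = {\<alpha>. congruence P \<alpha> \<and>
     (\<forall>S. S \<subseteq> Collect (congruence P) \<and> \<alpha> \<subseteq> cong_gen P (\<Union>S) \<longrightarrow>
        (\<exists>T. T \<subseteq> S \<and> finite T \<and> \<alpha> \<subseteq> cong_gen P (\<Union>T)))}"

definition cong_join ::
  "'a partial_lat \<Rightarrow> ('a \<times> 'a) set \<Rightarrow> ('a \<times> 'a) set \<Rightarrow> ('a \<times> 'a) set" where
  "cong_join P \<alpha> \<beta> = cong_gen P (\<alpha> \<union> \<beta>)"

definition Con_c_map ::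
  "'a partial_lat \<Rightarrow> 'b partial_lat \<Rightarrow> ('a \<Rightarrow> 'b) \<Rightarrow> ('a \<times> 'a) set \<Rightarrow> ('b \<times> 'b) set" where
  "Con_c_map P Q f \<alpha> = cong_gen Q {(f x, f y) | x y. (x, y) \<in> \<alpha>}"

text \<open>\<open>{\<or>,0}\<close>-homomorphisms from \<open>Con_c P\<close> to \<open>D\<close>; only the values on \<open>Con_c P\<close> matter.\<close>

definition Con_c_hom ::
  "'a partial_lat \<Rightarrow> (('a \<times> 'a) set \<Rightarrow> 'd::{distrib_lattice, bounded_lattice_bot}) \<Rightarrow> bool" where
  "Con_c_hom P \<phi> \<longleftrightarrow> \<phi> (le P) = bot \<and>
     (\<forall>\<alpha>\<in>Con_c P. \<forall>\<beta>\<in>Con_c P. \<phi> (cong_join P \<alpha> \<beta>) = sup (\<phi> \<alpha>) (\<phi> \<beta>))"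

definition measured_partial_lattice ::
  "'a partial_lat \<Rightarrow> (('a \<times> 'a) set \<Rightarrow> 'd::{distrib_lattice, bounded_lattice_bot}) \<Rightarrow> bool" where
  "measured_partial_lattice P \<phi> \<longleftrightarrow> partial_lattice P \<and> Con_c_hom P \<phi>"

text \<open>The values \<open>\<parallel>x \<le> y\<parallel>\<close> live in the dual lattice of \<open>D\<close>.\<close>

definition comeasure ::
  "'a partial_lat \<Rightarrow> (('a \<times> 'a) set \<Rightarrow> 'd::{distrib_lattice, bounded_lattice_bot})
     \<Rightarrow> 'a \<Rightarrow> 'a \<Rightarrow> 'd dual" where
  "comeasure P \<phi> x y = dual (\<phi> (Theta_plus P x y))"


section \<open>Balanced comeasured partial lattices\<close>

text \<open>Here \<open>\<nu> x y\<close> is \<open>\<parallel>x \<le> y\<parallel>\<close>. All index sets of \<open>Sup_fin\<close> and \<open>Inf_fin\<close>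
  are finite and nonempty where the definitions are used.\<close>

definition val_eq :: "('a \<Rightarrow> 'a \<Rightarrow> 'e::distrib_lattice) \<Rightarrow> 'a \<Rightarrow> 'a \<Rightarrow> 'e" where
  "val_eq \<nu> a b = inf (\<nu> a b) (\<nu> b a)"

definition val_subset :: "('a \<Rightarrow> 'a \<Rightarrow> 'e::distrib_lattice) \<Rightarrow> 'a set \<Rightarrow> 'a set \<Rightarrow> 'e" where
  "val_subset \<nu> X Y = Inf_fin ((\<lambda>x. Sup_fin ((\<lambda>y. val_eq \<nu> x y) ` Y)) ` X)"

definition val_set_eq :: "('a \<Rightarrow> 'a \<Rightarrow> 'e::distrib_lattice) \<Rightarrow> 'a set \<Rightarrow> 'a set \<Rightarrow> 'e" where
  "val_set_eq \<nu> X Y = inf (val_subset \<nu> X Y) (val_subset \<nu> Y X)"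

definition is_cover ::
  "('a \<Rightarrow> 'a \<Rightarrow> 'e::distrib_lattice) \<Rightarrow> 'a set set \<Rightarrow> 'a set \<Rightarrow> 'a set set \<Rightarrow> bool" where
  "is_cover \<nu> \<D> X \<C> \<longleftrightarrow> \<C> \<subseteq> \<D> \<and> finite \<C> \<and> \<C> \<noteq> {} \<and>
     (\<forall>Y\<in>\<D>. val_set_eq \<nu> X Y \<le> Sup_fin ((\<lambda>Z. val_set_eq \<nu> X Z) ` \<C>))"

definition finitely_covering :: "'a partial_lat \<Rightarrow> ('a \<Rightarrow> 'a \<Rightarrow> 'e::distrib_lattice) \<Rightarrow> bool" where
  "finitely_covering P \<nu> \<longleftrightarrow> (\<forall>X\<in>nefs (carr P).
     (\<exists>\<C>. is_cover \<nu> (dom (Join P)) X \<C>) \<and> (\<exists>\<C>. is_cover \<nu> (dom (Meet P)) X \<C>))"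

text \<open>The following values do not depend on the choice of a cover, respectively of a sample,
  so an arbitrary one is picked.\<close>

definition val_eq_join ::
  "'a partial_lat \<Rightarrow> ('a \<Rightarrow> 'a \<Rightarrow> 'e::distrib_lattice) \<Rightarrow> 'a \<Rightarrow> 'a set \<Rightarrow> 'e" where
  "val_eq_join P \<nu> a X = (let \<C> = (SOME \<C>. is_cover \<nu> (dom (Join P)) X \<C>) in
     Sup_fin ((\<lambda>Z. inf (val_eq \<nu> a (the (Join P Z))) (val_set_eq \<nu> X Z)) ` \<C>))"

definition val_eq_meet ::
  "'a partial_lat \<Rightarrow> ('a \<Rightarrow> 'a \<Rightarrow> 'e::distrib_lattice) \<Rightarrow> 'a \<Rightarrow> 'a set \<Rightarrow> 'e" where
  "val_eq_meet P \<nu> a X = (let \<C> = (SOME \<C>. is_cover \<nu> (dom (Meet P)) X \<C>) in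
     Sup_fin ((\<lambda>Z. inf (val_eq \<nu> a (the (Meet P Z))) (val_set_eq \<nu> X Z)) ` \<C>))"

definition is_join_sample ::
  "'a partial_lat \<Rightarrow> ('a \<Rightarrow> 'a \<Rightarrow> 'e::distrib_lattice) \<Rightarrow> 'a set \<Rightarrow> 'a set \<Rightarrow> bool" where
  "is_join_sample P \<nu> X U \<longleftrightarrow> U \<in> nefs (carr P) \<and>
     (\<forall>x\<in>carr P. val_eq_join P \<nu> x X \<le> Sup_fin ((\<lambda>u. val_eq_join P \<nu> u X) ` U))"

definition is_meet_sample ::
  "'a partial_lat \<Rightarrow> ('a \<Rightarrow> 'a \<Rightarrow> 'e::distrib_lattice) \<Rightarrow> 'a set \<Rightarrow> 'a set \<Rightarrow> bool" where
  "is_meet_sample P \<nu> X U \<longleftrightarrow> U \<in> nefs (carr P) \<and>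
     (\<forall>x\<in>carr P. val_eq_meet P \<nu> x X \<le> Sup_fin ((\<lambda>u. val_eq_meet P \<nu> u X) ` U))"

definition val_le_join ::
  "'a partial_lat \<Rightarrow> ('a \<Rightarrow> 'a \<Rightarrow> 'e::distrib_lattice) \<Rightarrow> 'a \<Rightarrow> 'a set \<Rightarrow> 'e" where
  "val_le_join P \<nu> a X = (let U = (SOME U. is_join_sample P \<nu> X U) in
     Sup_fin ((\<lambda>u. inf (\<nu> a u) (val_eq_join P \<nu> u X)) ` U))"

definition val_meet_le ::
  "'a partial_lat \<Rightarrow> ('a \<Rightarrow> 'a \<Rightarrow> 'e::distrib_lattice) \<Rightarrow> 'a set \<Rightarrow> 'a \<Rightarrow> 'e" where
  "val_meet_le P \<nu> X a = (let U = (SOME U. is_meet_sample P \<nu> X U) in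
     Sup_fin ((\<lambda>u. inf (\<nu> u a) (val_eq_meet P \<nu> u X)) ` U))"

primrec val_Id ::
  "'a partial_lat \<Rightarrow> ('a \<Rightarrow> 'a \<Rightarrow> 'e::distrib_lattice) \<Rightarrow> nat \<Rightarrow> 'a set \<Rightarrow> 'a set \<Rightarrow> 'a \<Rightarrow> 'e" where
  "val_Id P \<nu> 0 X U a = Sup_fin ((\<lambda>x. \<nu> a x) ` X)"
| "val_Id P \<nu> (Suc n) X U a = sup (val_Id P \<nu> n X U a)
     (Sup_fin ((\<lambda>Z. inf (val_le_join P \<nu> a Z) (Inf_fin ((\<lambda>z. val_Id P \<nu> n X U z) ` Z)))
        ` {Z. Z \<noteq> {} \<and> Z \<subseteq> U}))"

primrec val_Fil ::
  "'a partial_lat \<Rightarrow> ('a \<Rightarrow> 'a \<Rightarrow> 'e::distrib_lattice) \<Rightarrow> nat \<Rightarrow> 'a set \<Rightarrow> 'a set \<Rightarrow> 'a \<Rightarrow> 'e" where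
  "val_Fil P \<nu> 0 X U a = Sup_fin ((\<lambda>x. \<nu> x a) ` X)"
| "val_Fil P \<nu> (Suc n) X U a = sup (val_Fil P \<nu> n X U a)
     (Sup_fin ((\<lambda>Z. inf (val_meet_le P \<nu> Z a) (Inf_fin ((\<lambda>z. val_Fil P \<nu> n X U z) ` Z)))
        ` {Z. Z \<noteq> {} \<and> Z \<subseteq> U}))"

definition Id_cap :: "'a partial_lat \<Rightarrow> ('a \<Rightarrow> 'a \<Rightarrow> 'e::distrib_lattice) \<Rightarrow> bool" where
  "Id_cap P \<nu> \<longleftrightarrow> (\<forall>a\<in>carr P. \<forall>b\<in>carr P. \<exists>U\<in>nefs (carr P). \<forall>x\<in>carr P.
     inf (\<nu> x a) (\<nu> x b) = Sup_fin ((\<lambda>u. inf (\<nu> x u) (inf (\<nu> u a) (\<nu> u b))) ` U))"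

definition Fil_cap :: "'a partial_lat \<Rightarrow> ('a \<Rightarrow> 'a \<Rightarrow> 'e::distrib_lattice) \<Rightarrow> bool" where
  "Fil_cap P \<nu> \<longleftrightarrow> (\<forall>a\<in>carr P. \<forall>b\<in>carr P. \<exists>U\<in>nefs (carr P). \<forall>x\<in>carr P.
     inf (\<nu> a x) (\<nu> b x) = Sup_fin ((\<lambda>u. inf (\<nu> u x) (inf (\<nu> a u) (\<nu> b u))) ` U))"

definition Id_vee :: "'a partial_lat \<Rightarrow> ('a \<Rightarrow> 'a \<Rightarrow> 'e::distrib_lattice) \<Rightarrow> bool" where
  "Id_vee P \<nu> \<longleftrightarrow> (\<forall>X\<in>nefs (carr P). \<exists>U\<in>nefs (carr P). \<exists>n. \<forall>a\<in>carr P.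
     \<forall>Y. finite Y \<and> U \<subseteq> Y \<and> Y \<subseteq> carr P \<longrightarrow> val_Id P \<nu> n X U a = val_Id P \<nu> (Suc n) X Y a)"

definition Fil_vee :: "'a partial_lat \<Rightarrow> ('a \<Rightarrow> 'a \<Rightarrow> 'e::distrib_lattice) \<Rightarrow> bool" where
  "Fil_vee P \<nu> \<longleftrightarrow> (\<forall>X\<in>nefs (carr P). \<exists>U\<in>nefs (carr P). \<exists>n. \<forall>a\<in>carr P.
     \<forall>Y. finite Y \<and> U \<subseteq> Y \<and> Y \<subseteq> carr P \<longrightarrow> val_Fil P \<nu> n X U a = val_Fil P \<nu> (Suc n) X Y a)"

definition balanced :: "'a partial_lat \<Rightarrow> ('a \<Rightarrow> 'a \<Rightarrow> 'e::distrib_lattice) \<Rightarrow> bool" where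
  "balanced P \<nu> \<longleftrightarrow> finitely_covering P \<nu> \<and>
     Id_cap P \<nu> \<and> Id_vee P \<nu> \<and> Fil_cap P \<nu> \<and> Fil_vee P \<nu>"

definition balanced_measured ::
  "'a partial_lat \<Rightarrow> (('a \<times> 'a) set \<Rightarrow> 'd::{distrib_lattice, bounded_lattice_bot}) \<Rightarrow> bool" where
  "balanced_measured P \<phi> \<longleftrightarrow> measured_partial_lattice P \<phi> \<and> balanced P (comeasure P \<phi>)"


section \<open>The free lattice on a partial lattice\<close>

text \<open>Lattice terms over \<open>P\<close>, preordered by all inequalities that follow from the ordering, the
  joins and the meets of \<open>P\<close> and the lattice axioms, modulo the associated equivalence. The
  universal property, with respect to lattices over an arbitrary type, is proved at the end of
  this section.\<close>

datatype 'a lterm = Gen 'a | TJoin "'a lterm" "'a lterm" | TMeet "'a lterm" "'a lterm"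

definition lterms :: "'a partial_lat \<Rightarrow> 'a lterm set" where
  "lterms P = {t. set_lterm t \<subseteq> carr P}"

inductive term_le :: "'a partial_lat \<Rightarrow> 'a lterm \<Rightarrow> 'a lterm \<Rightarrow> bool" for P where
  refl: "t \<in> lterms P \<Longrightarrow> term_le P t t"
| trans: "term_le P s t \<Longrightarrow> term_le P t u \<Longrightarrow> term_le P s u"
| gen: "(x, y) \<in> le P \<Longrightarrow> term_le P (Gen x) (Gen y)"
| gen_Join: "Join P X = Some a \<Longrightarrow> (\<And>x. x \<in> X \<Longrightarrow> term_le P (Gen x) t) \<Longrightarrow> term_le P (Gen a) t"
| gen_Meet: "Meet P X = Some a \<Longrightarrow> (\<And>x. x \<in> X \<Longrightarrow> term_le P t (Gen x)) \<Longrightarrow> term_le P t (Gen a)"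
| join1: "s \<in> lterms P \<Longrightarrow> t \<in> lterms P \<Longrightarrow> term_le P s (TJoin s t)"
| join2: "s \<in> lterms P \<Longrightarrow> t \<in> lterms P \<Longrightarrow> term_le P t (TJoin s t)"
| join_least: "term_le P s u \<Longrightarrow> term_le P t u \<Longrightarrow> term_le P (TJoin s t) u"
| meet1: "s \<in> lterms P \<Longrightarrow> t \<in> lterms P \<Longrightarrow> term_le P (TMeet s t) s"
| meet2: "s \<in> lterms P \<Longrightarrow> t \<in> lterms P \<Longrightarrow> term_le P (TMeet s t) t"
| meet_greatest: "term_le P u s \<Longrightarrow> term_le P u t \<Longrightarrow> term_le P u (TMeet s t)"

definition term_class :: "'a partial_lat \<Rightarrow> 'a lterm \<Rightarrow> 'a lterm set" where
  "term_class P s = {t. term_le P s t \<and> term_le P t s}"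

definition free_lat_carr :: "'a partial_lat \<Rightarrow> 'a lterm set set" where
  "free_lat_carr P = term_class P ` lterms P"

definition free_lat_le :: "'a partial_lat \<Rightarrow> ('a lterm set \<times> 'a lterm set) set" where
  "free_lat_le P = {(term_class P s, term_class P t) | s t. term_le P s t}"

definition free_lat :: "'a partial_lat \<Rightarrow> 'a lterm set partial_lat" where
  "free_lat P = \<lparr>carr = free_lat_carr P, le = free_lat_le P,
     Join = (\<lambda>X. if X \<in> nefs (free_lat_carr P)
       then Some (THE a. is_sup (free_lat_carr P) (free_lat_le P) X a) else None),
     Meet = (\<lambda>X. if X \<in> nefs (free_lat_carr P)
       then Some (THE a. is_inf (free_lat_carr P) (free_lat_le P) X a) else None)\<rparr>"

definition free_lat_map :: "'a partial_lat \<Rightarrow> 'a \<Rightarrow> 'a lterm set" where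
  "free_lat_map P x = term_class P (Gen x)"


lemma preorder_onD:
  assumes "preorder_on A r"
  shows "r \<subseteq> A \<times> A" "\<And>x. x \<in> A \<Longrightarrow> (x, x) \<in> r"
    "\<And>x y z. (x, y) \<in> r \<Longrightarrow> (y, z) \<in> r \<Longrightarrow> (x, z) \<in> r"
  using assms by (auto simp: preorder_on_def refl_on_def dest: transD)

lemma lterms_simps [simp]:
  "Gen x \<in> lterms P \<longleftrightarrow> x \<in> carr P"
  "TJoin s t \<in> lterms P \<longleftrightarrow> s \<in> lterms P \<and> t \<in> lterms P"
  "TMeet s t \<in> lterms P \<longleftrightarrow> s \<in> lterms P \<and> t \<in> lterms P"
  by (auto simp: lterms_def)

lemma term_le_lterms:
  assumes "partial_lattice P" "term_le P s t"
  shows "s \<in> lterms P \<and> t \<in> lterms P"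
proof -
  have P: "partial_prelattice P" using assms(1) by (simp add: partial_lattice_def)
  then have le: "le P \<subseteq> carr P \<times> carr P"
    by (simp add: partial_prelattice_def preorder_on_def)
  show ?thesis using assms(2)
  proof induction
    case (gen_Join X a t)
    then have "X \<in> nefs (carr P)" "a \<in> carr P"
      using P by (auto simp: partial_prelattice_def is_sup_def dest: domI)
    with gen_Join show ?case by (auto simp: nefs_def)
  next
    case (gen_Meet X a t)
    then have "X \<in> nefs (carr P)" "a \<in> carr P"
      using P by (auto simp: partial_prelattice_def is_inf_def dest: domI)
    with gen_Meet show ?case by (auto simp: nefs_def)
  qed (use le in auto)
qed

lemma is_sup_unique: "antisym r \<Longrightarrow> is_sup A r X a \<Longrightarrow> is_sup A r X b \<Longrightarrow> a = b"
  by (auto simp: is_sup_def dest: antisymD)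

lemma is_inf_unique: "antisym r \<Longrightarrow> is_inf A r X a \<Longrightarrow> is_inf A r X b \<Longrightarrow> a = b"
  by (auto simp: is_inf_def dest: antisymD)

fun big :: "('a lterm \<Rightarrow> 'a lterm \<Rightarrow> 'a lterm) \<Rightarrow> 'a lterm list \<Rightarrow> 'a lterm" where
  "big f [] = undefined"
| "big f [x] = x"
| "big f (x # y # xs) = f x (big f (y # xs))"

context
  fixes P :: "'a partial_lat"
  assumes P: "partial_lattice P"
begin

lemma term_class_eq_iff:
  assumes "s \<in> lterms P"
  shows "term_class P s = term_class P t \<longleftrightarrow> term_le P s t \<and> term_le P t s"
proof
  assume "term_class P s = term_class P t"
  moreover have "s \<in> term_class P s" using assms by (simp add: term_class_def term_le.refl)
  ultimately have "s \<in> term_class P t" by simp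
  then show "term_le P s t \<and> term_le P t s" by (simp add: term_class_def)
next
  assume "term_le P s t \<and> term_le P t s"
  then show "term_class P s = term_class P t"
    using term_le.trans[of P] unfolding term_class_def by blast
qed

lemma free_lat_le_iff:
  assumes "s \<in> lterms P" "t \<in> lterms P"
  shows "(term_class P s, term_class P t) \<in> free_lat_le P \<longleftrightarrow> term_le P s t"
proof
  assume "(term_class P s, term_class P t) \<in> free_lat_le P"
  then obtain s' t' where *: "term_class P s = term_class P s'" "term_class P t = term_class P t'"
    "term_le P s' t'" by (auto simp: free_lat_le_def)
  then have "term_le P s s'" "term_le P t' t"
    using assms by (simp_all add: term_class_eq_iff)
  with * show "term_le P s t" by (meson term_le.trans)
qed (auto simp: free_lat_le_def)

lemma partial_order_free_lat: "preorder_on (free_lat_carr P) (free_lat_le P)"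
  "antisym (free_lat_le P)"
proof -
  have sub: "free_lat_le P \<subseteq> free_lat_carr P \<times> free_lat_carr P"
    by (auto simp: free_lat_le_def free_lat_carr_def dest: term_le_lterms[OF P])
  have "trans (free_lat_le P)"
  proof (rule transI)
    fix A B C assume *: "(A, B) \<in> free_lat_le P" "(B, C) \<in> free_lat_le P"
    then obtain s t u where "A = term_class P s" "B = term_class P t" "C = term_class P u"
      "s \<in> lterms P" "t \<in> lterms P" "u \<in> lterms P"
      using sub unfolding free_lat_carr_def by blast
    with * show "(A, C) \<in> free_lat_le P" using term_le.trans[of P s t u]
      by (simp add: free_lat_le_iff)
  qed
  moreover have "refl_on (free_lat_carr P) (free_lat_le P)"
    by (auto simp: refl_on_def free_lat_carr_def free_lat_le_iff term_le.refl)
  ultimately show "preorder_on (free_lat_carr P) (free_lat_le P)"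
    using sub by (simp add: preorder_on_def)
  show "antisym (free_lat_le P)"
  proof (rule antisymI)
    fix A B assume *: "(A, B) \<in> free_lat_le P" "(B, A) \<in> free_lat_le P"
    then obtain s t where "A = term_class P s" "B = term_class P t"
      "s \<in> lterms P" "t \<in> lterms P"
      using sub unfolding free_lat_carr_def by blast
    with * show "A = B" by (auto simp: free_lat_le_iff term_class_eq_iff)
  qed
qed

lemma big_join:
  assumes "xs \<noteq> []" "set xs \<subseteq> lterms P"
  shows "big TJoin xs \<in> lterms P \<and> (\<forall>s\<in>set xs. term_le P s (big TJoin xs)) \<and>
    (\<forall>u. (\<forall>s\<in>set xs. term_le P s u) \<longrightarrow> term_le P (big TJoin xs) u)"
  using assms
proof (induction xs rule: list_nonempty_induct)
  case (cons x xs)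
  then obtain y ys where xs: "xs = y # ys" by (cases xs) auto
  let ?b = "big TJoin xs"
  have b: "?b \<in> lterms P" "\<forall>s\<in>set xs. term_le P s ?b"
    "\<forall>u. (\<forall>s\<in>set xs. term_le P s u) \<longrightarrow> term_le P ?b u" and x: "x \<in> lterms P"
    using cons by auto
  have eq: "big TJoin (x # xs) = TJoin x ?b" by (simp add: xs)
  have "term_le P s (TJoin x ?b)" if "s \<in> set xs" for s
    using b(2) that term_le.trans[OF _ term_le.join2[OF x b(1)]] by blast
  with b x show ?case unfolding eq by (simp add: term_le.join1 term_le.join_least)
qed (auto intro: term_le.refl)

lemma big_meet:
  assumes "xs \<noteq> []" "set xs \<subseteq> lterms P"
  shows "big TMeet xs \<in> lterms P \<and> (\<forall>s\<in>set xs. term_le P (big TMeet xs) s) \<and>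
    (\<forall>u. (\<forall>s\<in>set xs. term_le P u s) \<longrightarrow> term_le P u (big TMeet xs))"
  using assms
proof (induction xs rule: list_nonempty_induct)
  case (cons x xs)
  then obtain y ys where xs: "xs = y # ys" by (cases xs) auto
  let ?b = "big TMeet xs"
  have b: "?b \<in> lterms P" "\<forall>s\<in>set xs. term_le P ?b s"
    "\<forall>u. (\<forall>s\<in>set xs. term_le P u s) \<longrightarrow> term_le P u ?b" and x: "x \<in> lterms P"
    using cons by auto
  have eq: "big TMeet (x # xs) = TMeet x ?b" by (simp add: xs)
  have "term_le P (TMeet x ?b) s" if "s \<in> set xs" for s
    using b(2) that term_le.trans[OF term_le.meet2[OF x b(1)]] by blast
  with b x show ?case unfolding eq by (simp add: term_le.meet1 term_le.meet_greatest)
qed (auto intro: term_le.refl)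

lemma nefs_list:
  assumes "X \<in> nefs (free_lat_carr P)"
  obtains xs where "xs \<noteq> []" "set xs \<subseteq> lterms P" "X = term_class P ` set xs"
proof -
  obtain S where "S \<subseteq> lterms P" "finite S" "X = term_class P ` S"
    using assms finite_subset_image[of X "term_class P" "lterms P"]
    unfolding nefs_def free_lat_carr_def by blast
  moreover from this obtain xs where "set xs = S" using finite_list by blast
  ultimately show thesis using assms that[of xs] by (auto simp: nefs_def)
qed

lemma is_sup_big:
  assumes "xs \<noteq> []" "set xs \<subseteq> lterms P"
  shows "is_sup (free_lat_carr P) (free_lat_le P) (term_class P ` set xs)
    (term_class P (big TJoin xs))"
proof -
  let ?b = "big TJoin xs"
  note b = big_join[OF assms]
  have "(term_class P s, term_class P ?b) \<in> free_lat_le P" if "s \<in> set xs" for s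
    using that b assms(2) by (simp add: free_lat_le_iff subset_iff)
  moreover have "(term_class P ?b, term_class P u) \<in> free_lat_le P"
    if "u \<in> lterms P" "\<forall>s\<in>set xs. (term_class P s, term_class P u) \<in> free_lat_le P" for u
    using that b assms(2) by (simp add: free_lat_le_iff subset_iff)
  ultimately show ?thesis using b by (simp add: is_sup_def free_lat_carr_def)
qed

lemma is_inf_big:
  assumes "xs \<noteq> []" "set xs \<subseteq> lterms P"
  shows "is_inf (free_lat_carr P) (free_lat_le P) (term_class P ` set xs)
    (term_class P (big TMeet xs))"
proof -
  let ?b = "big TMeet xs"
  note b = big_meet[OF assms]
  have "(term_class P ?b, term_class P s) \<in> free_lat_le P" if "s \<in> set xs" for s
    using that b assms(2) by (simp add: free_lat_le_iff subset_iff)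
  moreover have "(term_class P u, term_class P ?b) \<in> free_lat_le P"
    if "u \<in> lterms P" "\<forall>s\<in>set xs. (term_class P u, term_class P s) \<in> free_lat_le P" for u
    using that b assms(2) by (simp add: free_lat_le_iff subset_iff)
  ultimately show ?thesis using b by (simp add: is_inf_def free_lat_carr_def)
qed

lemma free_lat_Join:
  assumes "X \<in> nefs (free_lat_carr P)"
  shows "Join (free_lat P) X = Some a \<longleftrightarrow> is_sup (free_lat_carr P) (free_lat_le P) X a"
proof -
  have "\<exists>!a. is_sup (free_lat_carr P) (free_lat_le P) X a"
  proof (rule ex_ex1I)
    obtain xs where "xs \<noteq> []" "set xs \<subseteq> lterms P" "X = term_class P ` set xs"
      using nefs_list[OF assms] .
    then show "\<exists>a. is_sup (free_lat_carr P) (free_lat_le P) X a" using is_sup_big by blast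
  qed (rule is_sup_unique[OF partial_order_free_lat(2)])
  note u = the1_equality[OF this] theI'[OF this]
  have "Some (THE a. is_sup (free_lat_carr P) (free_lat_le P) X a) = Some a \<longleftrightarrow>
      is_sup (free_lat_carr P) (free_lat_le P) X a" using u by blast
  then show ?thesis using assms by (simp add: free_lat_def)
qed

lemma free_lat_Meet:
  assumes "X \<in> nefs (free_lat_carr P)"
  shows "Meet (free_lat P) X = Some a \<longleftrightarrow> is_inf (free_lat_carr P) (free_lat_le P) X a"
proof -
  have "\<exists>!a. is_inf (free_lat_carr P) (free_lat_le P) X a"
  proof (rule ex_ex1I)
    obtain xs where "xs \<noteq> []" "set xs \<subseteq> lterms P" "X = term_class P ` set xs"
      using nefs_list[OF assms] .
    then show "\<exists>a. is_inf (free_lat_carr P) (free_lat_le P) X a" using is_inf_big by blast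
  qed (rule is_inf_unique[OF partial_order_free_lat(2)])
  note u = the1_equality[OF this] theI'[OF this]
  have "Some (THE a. is_inf (free_lat_carr P) (free_lat_le P) X a) = Some a \<longleftrightarrow>
      is_inf (free_lat_carr P) (free_lat_le P) X a" using u by blast
  then show ?thesis using assms by (simp add: free_lat_def)
qed

lemma free_lat_simps:
  "carr (free_lat P) = free_lat_carr P" "le (free_lat P) = free_lat_le P"
  "dom (Join (free_lat P)) = nefs (free_lat_carr P)"
  "dom (Meet (free_lat P)) = nefs (free_lat_carr P)"
  by (auto simp: free_lat_def split: if_splits)

lemma is_lattice_free_lat: "is_lattice (free_lat P)"
proof -
  have "free_lat_carr P \<noteq> {}"
    using P by (auto simp: free_lat_carr_def partial_lattice_def partial_prelattice_def
        simp flip: lterms_simps(1))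
  moreover have J: "is_sup (free_lat_carr P) (free_lat_le P) X a"
    if "Join (free_lat P) X = Some a" for X a
  proof -
    have "X \<in> dom (Join (free_lat P))" using that by (rule domI)
    then show ?thesis using that free_lat_Join by (simp add: free_lat_simps)
  qed
  moreover have M: "is_inf (free_lat_carr P) (free_lat_le P) X a"
    if "Meet (free_lat P) X = Some a" for X a
  proof -
    have "X \<in> dom (Meet (free_lat P))" using that by (rule domI)
    then show ?thesis using that free_lat_Meet by (simp add: free_lat_simps)
  qed
  ultimately show ?thesis
    using partial_order_free_lat J M
    unfolding is_lattice_def partial_lattice_def partial_prelattice_def free_lat_simps by simp
qed

lemma pl_hom_free_lat_map: "pl_hom P (free_lat P) (free_lat_map P)"
proof -
  have P': "partial_prelattice P" using P by (simp add: partial_lattice_def)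
  then have le: "le P \<subseteq> carr P \<times> carr P"
    by (simp add: partial_prelattice_def preorder_on_def)
  have "Join (free_lat P) (free_lat_map P ` X) = Some (free_lat_map P a)"
    if "Join P X = Some a" for X a
  proof -
    have *: "X \<in> nefs (carr P)" "is_sup (carr P) (le P) X a"
      using P' that by (auto simp: partial_prelattice_def)
    then have "free_lat_map P ` X \<in> nefs (free_lat_carr P)"
      by (auto simp: nefs_def free_lat_map_def free_lat_carr_def)
    moreover have "is_sup (free_lat_carr P) (free_lat_le P) (free_lat_map P ` X) (free_lat_map P a)"
      using * term_le.gen_Join[OF that]
      by (auto simp: is_sup_def nefs_def free_lat_map_def free_lat_carr_def free_lat_le_iff
          subset_iff intro: term_le.gen)
    ultimately show ?thesis by (simp add: free_lat_Join)
  qed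
  moreover have "Meet (free_lat P) (free_lat_map P ` X) = Some (free_lat_map P a)"
    if "Meet P X = Some a" for X a
  proof -
    have *: "X \<in> nefs (carr P)" "is_inf (carr P) (le P) X a"
      using P' that by (auto simp: partial_prelattice_def)
    then have "free_lat_map P ` X \<in> nefs (free_lat_carr P)"
      by (auto simp: nefs_def free_lat_map_def free_lat_carr_def)
    moreover have "is_inf (free_lat_carr P) (free_lat_le P) (free_lat_map P ` X) (free_lat_map P a)"
      using * term_le.gen_Meet[OF that]
      by (auto simp: is_inf_def nefs_def free_lat_map_def free_lat_carr_def free_lat_le_iff
          subset_iff intro: term_le.gen)
    ultimately show ?thesis by (simp add: free_lat_Meet)
  qed
  moreover have "(free_lat_map P x, free_lat_map P y) \<in> free_lat_le P" if "(x, y) \<in> le P" for x y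
    using term_le.gen[OF that] by (auto simp: free_lat_map_def free_lat_le_def)
  moreover have "free_lat_map P ` carr P \<subseteq> free_lat_carr P"
    by (auto simp: free_lat_map_def free_lat_carr_def)
  ultimately show ?thesis by (simp add: pl_hom_def free_lat_simps(1,2))
qed

end

primrec term_eval :: "'b partial_lat \<Rightarrow> ('a \<Rightarrow> 'b) \<Rightarrow> 'a lterm \<Rightarrow> 'b" where
  "term_eval L f (Gen x) = f x"
| "term_eval L f (TJoin s t) = the (Join L {term_eval L f s, term_eval L f t})"
| "term_eval L f (TMeet s t) = the (Meet L {term_eval L f s, term_eval L f t})"

context
  fixes P :: "'a partial_lat" and L :: "'b partial_lat" and f :: "'a \<Rightarrow> 'b"
  assumes P: "partial_lattice P" and L: "is_lattice L" and f: "pl_hom P L f"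
begin

lemma lattice_Join: "X \<in> nefs (carr L) \<Longrightarrow> is_sup (carr L) (le L) X (the (Join L X))"
  "X \<in> nefs (carr L) \<Longrightarrow> Join L X = Some (the (Join L X))"
proof -
  assume "X \<in> nefs (carr L)"
  with L have "X \<in> dom (Join L)" by (simp add: is_lattice_def)
  then show "Join L X = Some (the (Join L X))" by auto
  with L show "is_sup (carr L) (le L) X (the (Join L X))"
    unfolding is_lattice_def partial_lattice_def partial_prelattice_def by blast
qed

lemma lattice_Meet: "X \<in> nefs (carr L) \<Longrightarrow> is_inf (carr L) (le L) X (the (Meet L X))"
  "X \<in> nefs (carr L) \<Longrightarrow> Meet L X = Some (the (Meet L X))"
proof -
  assume "X \<in> nefs (carr L)"
  with L have "X \<in> dom (Meet L)" by (simp add: is_lattice_def)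
  then show "Meet L X = Some (the (Meet L X))" by auto
  with L show "is_inf (carr L) (le L) X (the (Meet L X))"
    unfolding is_lattice_def partial_lattice_def partial_prelattice_def by blast
qed

lemma nefs_pair: "a \<in> A \<Longrightarrow> b \<in> A \<Longrightarrow> {a, b} \<in> nefs A"
  by (simp add: nefs_def)

lemma lattice_le: "preorder_on (carr L) (le L)" "antisym (le L)"
  using L by (auto simp: is_lattice_def partial_lattice_def partial_prelattice_def)

lemma term_eval_carr: "s \<in> lterms P \<Longrightarrow> term_eval L f s \<in> carr L"
proof (induction s)
  case (Gen x) with f show ?case by (auto simp: pl_hom_def)
next
  case (TJoin s t) then show ?case using lattice_Join(1)[OF nefs_pair] by (auto simp: is_sup_def)
next
  case (TMeet s t) then show ?case using lattice_Meet(1)[OF nefs_pair] by (auto simp: is_inf_def)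
qed

lemma term_eval_mono: "term_le P s t \<Longrightarrow> (term_eval L f s, term_eval L f t) \<in> le L"
proof (induction rule: term_le.induct)
  case (refl t) then show ?case using preorder_onD(2)[OF lattice_le(1)] term_eval_carr by blast
next
  case (trans s t u) then show ?case using preorder_onD(3)[OF lattice_le(1)] by blast
next
  case (gen x y) then show ?case using f by (auto simp: pl_hom_def)
next
  case (gen_Join X a t)
  then have "Join L (f ` X) = Some (f a)" using f by (auto simp: pl_hom_def)
  then have "is_sup (carr L) (le L) (f ` X) (f a)"
    using L by (auto simp: is_lattice_def partial_lattice_def partial_prelattice_def)
  moreover have "term_eval L f t \<in> carr L"
    using term_le_lterms[OF P term_le.gen_Join[OF gen_Join(1,2)]] term_eval_carr by blast
  ultimately show ?case using gen_Join(3) by (auto simp: is_sup_def)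
next
  case (gen_Meet X a t)
  then have "Meet L (f ` X) = Some (f a)" using f by (auto simp: pl_hom_def)
  then have "is_inf (carr L) (le L) (f ` X) (f a)"
    using L by (auto simp: is_lattice_def partial_lattice_def partial_prelattice_def)
  moreover have "term_eval L f t \<in> carr L"
    using term_le_lterms[OF P term_le.gen_Meet[OF gen_Meet(1,2)]] term_eval_carr by blast
  ultimately show ?case using gen_Meet(3) by (auto simp: is_inf_def)
next
  case (join1 s t) then show ?case
    using lattice_Join(1)[OF nefs_pair] term_eval_carr by (auto simp: is_sup_def)
next
  case (join2 s t) then show ?case
    using lattice_Join(1)[OF nefs_pair] term_eval_carr by (auto simp: is_sup_def)
next
  case (join_least s u t) then show ?case
    using lattice_Join(1)[OF nefs_pair] preorder_onD(1)[OF lattice_le(1)]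
    by (auto simp: is_sup_def)
next
  case (meet1 s t) then show ?case
    using lattice_Meet(1)[OF nefs_pair] term_eval_carr by (auto simp: is_inf_def)
next
  case (meet2 s t) then show ?case
    using lattice_Meet(1)[OF nefs_pair] term_eval_carr by (auto simp: is_inf_def)
next
  case (meet_greatest u s t) then show ?case
    using lattice_Meet(1)[OF nefs_pair] preorder_onD(1)[OF lattice_le(1)]
    by (auto simp: is_inf_def)
qed

lemma term_eval_big_join:
  assumes "xs \<noteq> []" "set xs \<subseteq> lterms P" "\<forall>s\<in>set xs. (term_eval L f s, b) \<in> le L"
  shows "(term_eval L f (big TJoin xs), b) \<in> le L"
  using assms
proof (induction xs rule: list_nonempty_induct)
  case (cons x xs)
  then obtain y ys where xs: "xs = y # ys" by (cases xs) auto
  have "term_eval L f (big TJoin xs) \<in> carr L" "term_eval L f x \<in> carr L" "b \<in> carr L"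
    using cons big_join[OF P cons(1)] preorder_onD(1)[OF lattice_le(1)] by (auto intro: term_eval_carr)
  with lattice_Join(1)[OF nefs_pair] cons show ?case by (auto simp: xs is_sup_def)
qed auto

lemma term_eval_big_meet:
  assumes "xs \<noteq> []" "set xs \<subseteq> lterms P" "\<forall>s\<in>set xs. (b, term_eval L f s) \<in> le L"
  shows "(b, term_eval L f (big TMeet xs)) \<in> le L"
  using assms
proof (induction xs rule: list_nonempty_induct)
  case (cons x xs)
  then obtain y ys where xs: "xs = y # ys" by (cases xs) auto
  have "term_eval L f (big TMeet xs) \<in> carr L" "term_eval L f x \<in> carr L" "b \<in> carr L"
    using cons big_meet[OF P cons(1)] preorder_onD(1)[OF lattice_le(1)] by (auto intro: term_eval_carr)
  with lattice_Meet(1)[OF nefs_pair] cons show ?case by (auto simp: xs is_inf_def)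
qed auto

theorem free_lat_extension: "\<exists>h. pl_hom (free_lat P) L h \<and> (\<forall>x\<in>carr P. h (free_lat_map P x) = f x)"
proof -
  define h where "h C = term_eval L f (SOME s. s \<in> lterms P \<and> C = term_class P s)" for C
  have h: "h (term_class P s) = term_eval L f s" if "s \<in> lterms P" for s
  proof -
    define t where "t = (SOME t. t \<in> lterms P \<and> term_class P s = term_class P t)"
    have "t \<in> lterms P \<and> term_class P s = term_class P t"
      unfolding t_def by (rule someI_ex) (use that in auto)
    then have "term_le P s t" "term_le P t s" using that by (auto simp: term_class_eq_iff[OF P])
    then have "term_eval L f t = term_eval L f s"
      by (meson antisymD lattice_le(2) term_eval_mono)
    then show ?thesis by (simp add: h_def t_def)
  qed
  have carr: "h ` free_lat_carr P \<subseteq> carr L"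
    by (auto simp: free_lat_carr_def h term_eval_carr)
  have mono: "(h C, h D) \<in> le L" if "(C, D) \<in> free_lat_le P" for C D
    using that term_le_lterms[OF P] term_eval_mono by (auto simp: free_lat_le_def h)
  have "Join L (h ` X) = Some (h C)" if *: "Join (free_lat P) X = Some C" for X C
  proof -
    have X: "X \<in> nefs (free_lat_carr P)" using * free_lat_simps(3)[OF P] by blast
    then obtain xs where xs: "xs \<noteq> []" "set xs \<subseteq> lterms P" "X = term_class P ` set xs"
      by (rule nefs_list[OF P])
    have C: "is_sup (free_lat_carr P) (free_lat_le P) X C" using X * by (simp add: free_lat_Join[OF P])
    have "C = term_class P (big TJoin xs)"
      using is_sup_unique[OF partial_order_free_lat(2)[OF P] C] is_sup_big[OF P xs(1,2)] xs(3) by simp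
    then have hC: "h C = term_eval L f (big TJoin xs)" using big_join[OF P xs(1,2)] by (simp add: h)
    have hX: "h ` X \<in> nefs (carr L)" using X carr by (auto simp: nefs_def)
    have sup: "is_sup (carr L) (le L) (h ` X) (the (Join L (h ` X)))" by (rule lattice_Join(1)[OF hX])
    have "\<forall>s\<in>set xs. (term_eval L f s, the (Join L (h ` X))) \<in> le L"
      using sup xs(2) h unfolding xs(3) is_sup_def by (auto simp: subset_iff)
    then have "(h C, the (Join L (h ` X))) \<in> le L"
      using term_eval_big_join[OF xs(1,2)] hC by simp
    moreover have "(the (Join L (h ` X)), h C) \<in> le L"
      using sup C mono carr by (auto simp: is_sup_def)
    ultimately have "the (Join L (h ` X)) = h C" by (meson antisymD lattice_le(2))
    with lattice_Join(2)[OF hX] show ?thesis by simp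
  qed
  moreover have "Meet L (h ` X) = Some (h C)" if *: "Meet (free_lat P) X = Some C" for X C
  proof -
    have X: "X \<in> nefs (free_lat_carr P)" using * free_lat_simps(4)[OF P] by blast
    then obtain xs where xs: "xs \<noteq> []" "set xs \<subseteq> lterms P" "X = term_class P ` set xs"
      by (rule nefs_list[OF P])
    have C: "is_inf (free_lat_carr P) (free_lat_le P) X C" using X * by (simp add: free_lat_Meet[OF P])
    have "C = term_class P (big TMeet xs)"
      using is_inf_unique[OF partial_order_free_lat(2)[OF P] C] is_inf_big[OF P xs(1,2)] xs(3) by simp
    then have hC: "h C = term_eval L f (big TMeet xs)" using big_meet[OF P xs(1,2)] by (simp add: h)
    have hX: "h ` X \<in> nefs (carr L)" using X carr by (auto simp: nefs_def)
    have inf: "is_inf (carr L) (le L) (h ` X) (the (Meet L (h ` X)))" by (rule lattice_Meet(1)[OF hX])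
    have "\<forall>s\<in>set xs. (the (Meet L (h ` X)), term_eval L f s) \<in> le L"
      using inf xs(2) h unfolding xs(3) is_inf_def by (auto simp: subset_iff)
    then have "(the (Meet L (h ` X)), h C) \<in> le L"
      using term_eval_big_meet[OF xs(1,2)] hC by simp
    moreover have "(h C, the (Meet L (h ` X))) \<in> le L"
      using inf C mono carr by (auto simp: is_inf_def)
    ultimately have "the (Meet L (h ` X)) = h C" by (meson antisymD lattice_le(2))
    with lattice_Meet(2)[OF hX] show ?thesis by simp
  qed
  ultimately have "pl_hom (free_lat P) L h"
    using carr mono by (auto simp: pl_hom_def free_lat_simps[OF P])
  moreover have "\<forall>x\<in>carr P. h (free_lat_map P x) = f x" by (simp add: free_lat_map_def h)
  ultimately show ?thesis by blast
qed

theorem free_lat_extension_unique: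
  assumes g: "pl_hom (free_lat P) L g" "\<forall>x\<in>carr P. g (free_lat_map P x) = f x"
    and h: "pl_hom (free_lat P) L h" "\<forall>x\<in>carr P. h (free_lat_map P x) = f x"
    and C: "C \<in> carr (free_lat P)"
  shows "g C = h C"
proof -
  have "k (term_class P s) = term_eval L f s"
    if k: "pl_hom (free_lat P) L k" "\<forall>x\<in>carr P. k (free_lat_map P x) = f x"
      and "s \<in> lterms P" for k s
    using that(3)
  proof (induction s)
    case (Gen x) with k(2) show ?case by (simp add: free_lat_map_def)
  next
    case (TJoin s t)
    then have "set [s, t] \<subseteq> lterms P" by simp
    from is_sup_big[OF P _ this]
    have "Join (free_lat P) {term_class P s, term_class P t} = Some (term_class P (TJoin s t))"
      using TJoin.prems by (subst free_lat_Join[OF P]) (auto simp: nefs_def free_lat_carr_def)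
    then have "Join L (k ` {term_class P s, term_class P t}) = Some (k (term_class P (TJoin s t)))"
      using k(1) unfolding pl_hom_def by blast
    with TJoin show ?case by simp
  next
    case (TMeet s t)
    then have "set [s, t] \<subseteq> lterms P" by simp
    from is_inf_big[OF P _ this]
    have "Meet (free_lat P) {term_class P s, term_class P t} = Some (term_class P (TMeet s t))"
      using TMeet.prems by (subst free_lat_Meet[OF P]) (auto simp: nefs_def free_lat_carr_def)
    then have "Meet L (k ` {term_class P s, term_class P t}) = Some (k (term_class P (TMeet s t)))"
      using k(1) unfolding pl_hom_def by blast
    with TMeet show ?case by simp
  qed
  from this[OF g] this[OF h] C show ?thesis by (auto simp: free_lat_simps(1)[OF P] free_lat_carr_def)
qed

end

text \<open>The defining universal property of the free lattice on \<open>P\<close>: it is a lattice, the natural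
  map is a homomorphism, and every homomorphism to a lattice factors uniquely through it.\<close>

theorem free_lat_universal:
  fixes P :: "'a partial_lat" and L :: "'b partial_lat" and f :: "'a \<Rightarrow> 'b"
  assumes "partial_lattice P"
  shows "is_lattice (free_lat P)"
    and "pl_hom P (free_lat P) (free_lat_map P)"
    and "is_lattice L \<Longrightarrow> pl_hom P L f \<Longrightarrow>
      \<exists>h. pl_hom (free_lat P) L h \<and> (\<forall>x\<in>carr P. h (free_lat_map P x) = f x) \<and>
        (\<forall>g. pl_hom (free_lat P) L g \<and> (\<forall>x\<in>carr P. g (free_lat_map P x) = f x) \<longrightarrow>
          (\<forall>C\<in>carr (free_lat P). g C = h C))"
proof -
  show "is_lattice (free_lat P)" "pl_hom P (free_lat P) (free_lat_map P)"
    by (rule is_lattice_free_lat[OF assms], rule pl_hom_free_lat_map[OF assms])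
  assume L: "is_lattice L" "pl_hom P L f"
  obtain h where h: "pl_hom (free_lat P) L h" "\<forall>x\<in>carr P. h (free_lat_map P x) = f x"
    using free_lat_extension[OF assms L] by blast
  have "\<forall>C\<in>carr (free_lat P). g C = h C"
    if "pl_hom (free_lat P) L g" "\<forall>x\<in>carr P. g (free_lat_map P x) = f x" for g
    using free_lat_extension_unique[OF assms L that h] by blast
  with h show "\<exists>h. pl_hom (free_lat P) L h \<and> (\<forall>x\<in>carr P. h (free_lat_map P x) = f x) \<and>
        (\<forall>g. pl_hom (free_lat P) L g \<and> (\<forall>x\<in>carr P. g (free_lat_map P x) = f x) \<longrightarrow>
          (\<forall>C\<in>carr (free_lat P). g C = h C))"
    by blast
qed

end

theory Submission
  imports Defs
begin

text \<open>
  Let \<open>E\<close> be the dual of \<open>D\<close>. Every prime filter \<open>G\<close> of \<open>E\<close> turns the comeasure into a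
  congruence \<open>{(x, y). \<parallel>x \<le> y\<parallel> \<in> G}\<close> of \<open>P\<close>, hence into a partial prelattice \<open>P\<^sub>G\<close>. The word
  problem of the free lattice on \<open>P\<^sub>G\<close> is solved by a cut-free calculus in the style of Whitman and
  Dean, in which \<open>s \<le> t\<close> reduces to inequalities between subterms, to membership of
  generators in finitely generated ideals and filters of \<open>P\<^sub>G\<close>, and to the existence of an
  interpolating generator. Balancedness makes these reductions uniform in \<open>G\<close>: each ideal that
  occurs is a finite union of principal lower sets whose generators do not depend on \<open>G\<close>. By
  induction on terms, the set of all \<open>G\<close> for which \<open>s \<le> t\<close> holds over \<open>P\<^sub>G\<close> is therefore
  \<open>{G. e \<in> G}\<close> for some \<open>e \<in> E\<close>, which serves as \<open>\<parallel>s \<le> t\<parallel>\<close>. Since a lattice element is determined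
  by the prime filters containing it, the value of \<open>\<psi>\<close> at a compact congruence \<open>\<gamma>\<close> of the free
  lattice is the element whose prime filters are those with \<open>\<gamma>\<close> contained in the congruence
  of \<open>G\<close>, and all required equations can be checked on prime filters.
\<close>

section \<open>Prime filters\<close>

text \<open>The whole lattice is allowed as a prime filter: the dual \<open>E\<close> has a top,
  coming from the zero of \<open>D\<close>, but possibly no bottom.\<close>

definition prime_filter :: "'e::{distrib_lattice, bounded_lattice_top} set \<Rightarrow> bool" where
  "prime_filter G \<longleftrightarrow> top \<in> G \<and> (\<forall>a b. inf a b \<in> G \<longleftrightarrow> a \<in> G \<and> b \<in> G) \<and>
     (\<forall>a b. sup a b \<in> G \<longleftrightarrow> a \<in> G \<or> b \<in> G)"

lemma prime_filter_mem:
  assumes "prime_filter G"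
  shows "top \<in> G" "inf a b \<in> G \<longleftrightarrow> a \<in> G \<and> b \<in> G" "sup a b \<in> G \<longleftrightarrow> a \<in> G \<or> b \<in> G"
  using assms by (auto simp: prime_filter_def)

lemma prime_filter_mono: "prime_filter G \<Longrightarrow> a \<in> G \<Longrightarrow> a \<le> b \<Longrightarrow> b \<in> G"
  by (metis inf.absorb1 prime_filter_mem(2))

lemma prime_filter_Sup_fin:
  assumes "prime_filter G" "finite A" "A \<noteq> {}"
  shows "Sup_fin A \<in> G \<longleftrightarrow> (\<exists>a\<in>A. a \<in> G)"
  using assms(2,3)
  by (induction A rule: finite_ne_induct) (simp_all add: prime_filter_mem[OF assms(1)])

lemma prime_filter_Inf_fin:
  assumes "prime_filter G" "finite A" "A \<noteq> {}"
  shows "Inf_fin A \<in> G \<longleftrightarrow> (\<forall>a\<in>A. a \<in> G)"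
  using assms(2,3)
  by (induction A rule: finite_ne_induct) (simp_all add: prime_filter_mem[OF assms(1)])

definition proper_filter_avoiding :: "'e::{distrib_lattice, bounded_lattice_top} \<Rightarrow> 'e set \<Rightarrow> bool" where
  "proper_filter_avoiding b F \<longleftrightarrow> b \<notin> F \<and> (\<forall>x y. inf x y \<in> F \<longleftrightarrow> x \<in> F \<and> y \<in> F)"

text \<open>Prime filter theorem: Zorn's lemma gives a filter maximal among those that contain
  \<open>a\<close> and avoid \<open>b\<close>, and distributivity makes it prime.\<close>

lemma prime_filter_separation:
  fixes a b :: "'e::{distrib_lattice, bounded_lattice_top}"
  assumes "\<not> a \<le> b"
  obtains G where "prime_filter G" "a \<in> G" "b \<notin> G"
proof -
  define \<F> where "\<F> = {F. a \<in> F \<and> proper_filter_avoiding b F}"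
  have "{a..} \<in> \<F>" using assms by (auto simp: \<F>_def proper_filter_avoiding_def)
  then have "\<F> \<noteq> {}" by blast
  moreover have "\<Union>\<C> \<in> \<F>" if "\<C> \<noteq> {}" "subset.chain \<F> \<C>" for \<C>
  proof -
    have "inf x y \<in> \<Union>\<C>" if xy: "x \<in> A" "A \<in> \<C>" "y \<in> B" "B \<in> \<C>" for x y A B
    proof -
      have "A \<subseteq> B \<or> B \<subseteq> A" and AB: "A \<in> \<F>" "B \<in> \<F>"
        using xy \<open>subset.chain \<F> \<C>\<close> by (auto simp: subset_chain_def)
      then have "inf x y \<in> A \<or> inf x y \<in> B"
        using xy by (auto simp: \<F>_def proper_filter_avoiding_def)
      then show ?thesis using xy by blast
    qed
    then show ?thesis
      using that unfolding subset_chain_def \<F>_def proper_filter_avoiding_def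
      by (auto simp: subset_iff)
  qed
  ultimately obtain G where G: "G \<in> \<F>" and max: "\<And>F. F \<in> \<F> \<Longrightarrow> G \<subseteq> F \<Longrightarrow> F = G"
    using subset_Zorn_nonempty[of \<F>] by blast
  have inf: "inf x y \<in> G \<longleftrightarrow> x \<in> G \<and> y \<in> G" for x y
    using G by (simp add: \<F>_def proper_filter_avoiding_def)
  have up: "y \<in> G" if "x \<in> G" "x \<le> y" for x y
    using that inf by (metis inf.absorb1)
  have step: "\<exists>f\<in>G. inf f x \<le> b" if "x \<notin> G" for x
  proof (rule ccontr)
    assume *: "\<not> (\<exists>f\<in>G. inf f x \<le> b)"
    \<comment> \<open>The filter generated by \<open>G\<close> and \<open>x\<close>. As it avoids
      \<open>b\<close>, maximality of \<open>G\<close> would force \<open>x\<close> into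
      \<open>G\<close>.\<close>
    define F where "F = {y. \<exists>f\<in>G. inf f x \<le> y}"
    have "inf y z \<in> F" if "y \<in> F" "z \<in> F" for y z
    proof -
      obtain f g where "f \<in> G" "inf f x \<le> y" "g \<in> G" "inf g x \<le> z"
        using \<open>y \<in> F\<close> \<open>z \<in> F\<close> by (auto simp: F_def)
      moreover from this have "inf (inf f g) x \<le> inf y z"
        by (meson inf.boundedI inf_mono inf_le1 inf_le2 order.refl order.trans)
      ultimately show ?thesis using inf unfolding F_def by blast
    qed
    moreover have "y \<in> F" if "inf y z \<in> F" for y z
      using that by (auto simp: F_def)
    ultimately have "inf y z \<in> F \<longleftrightarrow> y \<in> F \<and> z \<in> F" for y z by (metis inf_commute)
    moreover have "G \<subseteq> F" by (auto simp: F_def intro: le_infI1)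
    moreover have "b \<notin> F" using * by (auto simp: F_def)
    ultimately have "F = G" using G by (intro max) (auto simp: \<F>_def proper_filter_avoiding_def)
    moreover have "x \<in> F" using G by (auto simp: F_def \<F>_def)
    ultimately show False using that by blast
  qed
  \<comment> \<open>Distributivity enters here: \<open>b\<close> bounds
    \<open>inf (inf f g) x\<close> and \<open>inf (inf f g) y\<close>, hence also
    \<open>inf (inf f g) (sup x y)\<close>, which lies in \<open>G\<close>.\<close>
  have "b \<in> G" if xy: "sup x y \<in> G" "x \<notin> G" "y \<notin> G" for x y
  proof -
    obtain f g where "f \<in> G" "inf f x \<le> b" "g \<in> G" "inf g y \<le> b" using step xy by meson
    moreover from this have "inf (inf f g) (sup x y) \<le> b"
      unfolding inf_sup_distrib1 by (meson inf_mono le_supI inf_le1 inf_le2 order.refl order.trans)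
    ultimately show ?thesis using inf up xy(1) by metis
  qed
  then have "sup x y \<in> G \<longleftrightarrow> x \<in> G \<or> y \<in> G" for x y
    using G up[OF _ sup_ge1] up[OF _ sup_ge2] unfolding \<F>_def proper_filter_avoiding_def by blast
  moreover have "top \<in> G" using G up[of a] by (auto simp: \<F>_def)
  ultimately have "prime_filter G" using inf by (simp add: prime_filter_def)
  with G show thesis using that by (auto simp: \<F>_def proper_filter_avoiding_def)
qed

lemma prime_filter_ext:
  fixes a b :: "'e::{distrib_lattice, bounded_lattice_top}"
  assumes "\<And>G. prime_filter G \<Longrightarrow> a \<in> G \<longleftrightarrow> b \<in> G"
  shows "a = b"
  by (metis assms order.antisym prime_filter_separation)


section \<open>Congruences generated by sets of pairs\<close>

text \<open>Reflexivity and the bounding halves of supremum and infimum are inherited from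
  \<open>le P\<close>. What remains are closure conditions, each with finitely many
  premises.\<close>

lemma congruence_iff:
  assumes "partial_prelattice P"
  shows "congruence P r \<longleftrightarrow> le P \<subseteq> r \<and> r \<subseteq> carr P \<times> carr P \<and> trans r \<and>
    (\<forall>X a b. Join P X = Some a \<longrightarrow> b \<in> carr P \<longrightarrow> (\<forall>x\<in>X. (x, b) \<in> r) \<longrightarrow> (a, b) \<in> r) \<and>
    (\<forall>X a b. Meet P X = Some a \<longrightarrow> b \<in> carr P \<longrightarrow> (\<forall>x\<in>X. (b, x) \<in> r) \<longrightarrow> (b, a) \<in> r)"
    (is "_ \<longleftrightarrow> ?R")
proof
  assume "congruence P r"
  then show ?R
    by (simp add: congruence_def partial_prelattice_def is_sup_def is_inf_def preorder_on_def)
next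
  assume R: ?R
  have "refl_on (carr P) r"
    using R assms by (auto simp: partial_prelattice_def preorder_on_def refl_on_def)
  moreover have "is_sup (carr P) r X a" if "Join P X = Some a" for X a
  proof -
    have "is_sup (carr P) (le P) X a" using assms that by (simp add: partial_prelattice_def)
    with that R show ?thesis unfolding is_sup_def by blast
  qed
  moreover have "is_inf (carr P) r X a" if "Meet P X = Some a" for X a
  proof -
    have "is_inf (carr P) (le P) X a" using assms that by (simp add: partial_prelattice_def)
    with that R show ?thesis unfolding is_inf_def by blast
  qed
  ultimately show "congruence P r"
    using R assms by (simp add: congruence_def partial_prelattice_def preorder_on_def)
qed

lemma congruenceD:
  assumes "partial_prelattice P" "congruence P r"
  shows "(x, y) \<in> le P \<Longrightarrow> (x, y) \<in> r" "(x, y) \<in> r \<Longrightarrow> x \<in> carr P \<and> y \<in> carr P"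
    "(x, y) \<in> r \<Longrightarrow> (y, z) \<in> r \<Longrightarrow> (x, z) \<in> r"
    "Join P X = Some a \<Longrightarrow> b \<in> carr P \<Longrightarrow> \<forall>x\<in>X. (x, b) \<in> r \<Longrightarrow> (a, b) \<in> r"
    "Meet P X = Some a \<Longrightarrow> b \<in> carr P \<Longrightarrow> \<forall>x\<in>X. (b, x) \<in> r \<Longrightarrow> (b, a) \<in> r"
  using assms(2) unfolding congruence_iff[OF assms(1)] trans_def by blast+

context
  fixes P :: "'a partial_lat"
  assumes P: "partial_prelattice P"
begin

text \<open>Keeps the intersection that defines \<open>cong_gen\<close> from ranging over an empty
  family.\<close>

lemma congruence_full: "congruence P (carr P \<times> carr P)"
  using P unfolding congruence_iff[OF P]
  by (auto simp: partial_prelattice_def preorder_on_def is_sup_def is_inf_def trans_def)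

lemma congruence_le: "congruence P (le P)"
  using P by (simp add: congruence_def)

lemma cong_gen_least: "congruence P r \<Longrightarrow> R \<subseteq> r \<Longrightarrow> cong_gen P R \<subseteq> r"
  by (auto simp: cong_gen_def)

lemma subset_cong_gen: "R \<subseteq> cong_gen P R"
  by (auto simp: cong_gen_def)

lemma cong_gen_mono: "R \<subseteq> S \<Longrightarrow> cong_gen P R \<subseteq> cong_gen P S"
  by (auto simp: cong_gen_def)

lemma congruence_Inter:
  assumes "\<R> \<noteq> {}" "\<And>r. r \<in> \<R> \<Longrightarrow> congruence P r"
  shows "congruence P (\<Inter>\<R>)"
proof -
  obtain s where "s \<in> \<R>" using assms(1) by blast
  then have "\<Inter>\<R> \<subseteq> carr P \<times> carr P"
    using congruenceD(2)[OF P assms(2)] by fast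
  moreover have "trans (\<Inter>\<R>)"
    using congruenceD(3)[OF P assms(2)] by (intro transI) blast
  moreover have "le P \<subseteq> \<Inter>\<R>"
    using congruenceD(1)[OF P assms(2)] by fast
  moreover have "(a, b) \<in> \<Inter>\<R>"
    if "Join P X = Some a" "b \<in> carr P" "\<forall>x\<in>X. (x, b) \<in> \<Inter>\<R>" for X a b
    using congruenceD(4)[OF P assms(2) that(1,2)] that(3) by blast
  moreover have "(b, a) \<in> \<Inter>\<R>"
    if "Meet P X = Some a" "b \<in> carr P" "\<forall>x\<in>X. (b, x) \<in> \<Inter>\<R>" for X a b
    using congruenceD(5)[OF P assms(2) that(1,2)] that(3) by blast
  ultimately show ?thesis unfolding congruence_iff[OF P] by blast
qed

lemma congruence_cong_gen: "R \<subseteq> carr P \<times> carr P \<Longrightarrow> congruence P (cong_gen P R)"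
  unfolding cong_gen_def using congruence_full by (intro congruence_Inter) auto

lemma cong_gen_subset_iff:
  "congruence P r \<Longrightarrow> cong_gen P R \<subseteq> r \<longleftrightarrow> R \<subseteq> r"
  using cong_gen_least subset_cong_gen by blast

lemma congruence_subset: "congruence P r \<Longrightarrow> r \<subseteq> carr P \<times> carr P"
  by (simp add: congruence_iff[OF P])

lemma cong_gen_congruence: "congruence P r \<Longrightarrow> cong_gen P r = r"
  using cong_gen_subset_iff subset_cong_gen by blast

section \<open>Compact congruences and finite generation\<close>

lemma cong_gen_finitary:
  assumes S: "S \<subseteq> Collect (congruence P)" and p: "p \<in> cong_gen P (\<Union>S)"
  shows "\<exists>T. T \<subseteq> S \<and> finite T \<and> p \<in> cong_gen P (\<Union>T)"
proof -
  \<comment> \<open>The pairs that need only finitely many members of \<open>S\<close>. Since joins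
    and meets have finite arguments, these pairs form a congruence, which then contains all that
    \<open>S\<close> generates.\<close>
  define r where "r = {p. \<exists>T. T \<subseteq> S \<and> finite T \<and> p \<in> cong_gen P (\<Union>T)}"
  have cong: "congruence P (cong_gen P (\<Union>T))" if "T \<subseteq> S" for T
    using that S congruence_subset by (intro congruence_cong_gen) blast
  \<comment> \<open>Directedness: finitely many pairs of \<open>r\<close> lie in a single
    \<open>cong_gen P (\<Union>T)\<close> with \<open>T\<close> finite, where the closure conditions
    of a congruence can be applied.\<close>
  have common: "\<exists>T. T \<subseteq> S \<and> finite T \<and> A \<subseteq> cong_gen P (\<Union>T)" if "finite A" "A \<subseteq> r" for A
    using that
  proof (induction A rule: finite_induct)
    case (insert p A)
    then obtain T U where "T \<subseteq> S" "finite T" "A \<subseteq> cong_gen P (\<Union>T)"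
      "U \<subseteq> S" "finite U" "p \<in> cong_gen P (\<Union>U)" by (auto simp: r_def)
    moreover have "cong_gen P (\<Union>T) \<subseteq> cong_gen P (\<Union>(T \<union> U))"
      "cong_gen P (\<Union>U) \<subseteq> cong_gen P (\<Union>(T \<union> U))" by (intro cong_gen_mono; blast)+
    ultimately show ?case by (intro exI[of _ "T \<union> U"]) auto
  qed auto
  have sub: "cong_gen P (\<Union>T) \<subseteq> r" if "T \<subseteq> S" "finite T" for T
    using that by (auto simp: r_def)
  have "congruence P r" unfolding congruence_iff[OF P]
  proof (intro conjI allI impI)
    show "le P \<subseteq> r" using sub[of "{}"] cong[of "{}"] by (auto simp: congruence_iff[OF P])
    show "r \<subseteq> carr P \<times> carr P"
    proof
      fix p assume "p \<in> r"
      then obtain T where "T \<subseteq> S" "p \<in> cong_gen P (\<Union>T)" by (auto simp: r_def)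
      then show "p \<in> carr P \<times> carr P" using congruence_subset[OF cong] by blast
    qed
    show "trans r"
    proof (rule transI)
      fix x y z assume "(x, y) \<in> r" "(y, z) \<in> r"
      then obtain T where "T \<subseteq> S" "finite T" "(x, y) \<in> cong_gen P (\<Union>T)" "(y, z) \<in> cong_gen P (\<Union>T)"
        using common[of "{(x, y), (y, z)}"] by auto
      then show "(x, z) \<in> r" 
        using sub cong[of T] transD[of "cong_gen P (\<Union>T)" x y z] unfolding congruence_iff[OF P] by blast
    qed
    show "(a, b) \<in> r" if X: "Join P X = Some a" "b \<in> carr P" "\<forall>x\<in>X. (x, b) \<in> r" for X a b
    proof -
      have "finite X" using P X(1) by (auto simp: partial_prelattice_def nefs_def)
      then obtain T where "T \<subseteq> S" "finite T" "\<forall>x\<in>X. (x, b) \<in> cong_gen P (\<Union>T)"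
        using common[of "(\<lambda>x. (x, b)) ` X"] X(3) by (auto simp: image_subset_iff)
      then show ?thesis using sub cong[of T] X(1,2) unfolding congruence_iff[OF P] by blast
    qed
    show "(b, a) \<in> r" if X: "Meet P X = Some a" "b \<in> carr P" "\<forall>x\<in>X. (b, x) \<in> r" for X a b
    proof -
      have "finite X" using P X(1) by (auto simp: partial_prelattice_def nefs_def)
      then obtain T where "T \<subseteq> S" "finite T" "\<forall>x\<in>X. (b, x) \<in> cong_gen P (\<Union>T)"
        using common[of "(\<lambda>x. (b, x)) ` X"] X(3) by (auto simp: image_subset_iff)
      then show ?thesis using sub cong[of T] X(1,2) unfolding congruence_iff[OF P] by blast
    qed
  qed
  moreover have "\<Union>S \<subseteq> r"
  proof
    fix p assume "p \<in> \<Union>S"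
    then obtain s where "s \<in> S" "p \<in> s" by blast
    then show "p \<in> r" using sub[of "{s}"] subset_cong_gen[of s] by auto
  qed
  ultimately have "cong_gen P (\<Union>S) \<subseteq> r" by (rule cong_gen_least)
  with p show ?thesis by (auto simp: r_def)
qed

text \<open>Each of the finitely many generators needs only finitely many members of
  \<open>S\<close>, and the union of these choices is still finite.\<close>

lemma cong_gen_in_Con_c:
  assumes "finite R" "R \<subseteq> carr P \<times> carr P"
  shows "cong_gen P R \<in> Con_c P"
proof -
  have "\<exists>T. T \<subseteq> S \<and> finite T \<and> cong_gen P R \<subseteq> cong_gen P (\<Union>T)"
    if S: "S \<subseteq> Collect (congruence P)" and R: "cong_gen P R \<subseteq> cong_gen P (\<Union>S)" for S
  proof -
    have "\<forall>p\<in>R. \<exists>T. T \<subseteq> S \<and> finite T \<and> p \<in> cong_gen P (\<Union>T)"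
      using cong_gen_finitary[OF S] R subset_cong_gen by blast
    then obtain T where T: "\<And>p. p \<in> R \<Longrightarrow> T p \<subseteq> S \<and> finite (T p) \<and> p \<in> cong_gen P (\<Union>(T p))"
      by metis
    have "R \<subseteq> cong_gen P (\<Union>(\<Union>(T ` R)))"
    proof
      fix p assume "p \<in> R"
      then show "p \<in> cong_gen P (\<Union>(\<Union>(T ` R)))"
        using T[of p] cong_gen_mono[of "\<Union>(T p)" "\<Union>(\<Union>(T ` R))"] by blast
    qed
    moreover have "congruence P (cong_gen P (\<Union>(\<Union>(T ` R))))"
      using T S congruence_subset by (intro congruence_cong_gen) blast
    ultimately have "cong_gen P R \<subseteq> cong_gen P (\<Union>(\<Union>(T ` R)))" using cong_gen_least by blast
    moreover have "\<Union>(T ` R) \<subseteq> S" "finite (\<Union>(T ` R))" using T assms(1) by blast+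
    ultimately show ?thesis by blast
  qed
  then show ?thesis using congruence_cong_gen[OF assms(2)] by (simp add: Con_c_def)
qed

text \<open>A congruence is covered by the principal congruences of its own pairs; compactness keeps
  finitely many of them.\<close>

lemma Con_c_finitely_generated:
  assumes "\<alpha> \<in> Con_c P"
  obtains R where "finite R" "R \<subseteq> \<alpha>" "\<alpha> = cong_gen P R"
proof -
  let ?S = "(\<lambda>p. cong_gen P {p}) ` \<alpha>"
  have \<alpha>: "congruence P \<alpha>" using assms by (simp add: Con_c_def)
  then have "?S \<subseteq> Collect (congruence P)"
    using congruence_subset by (auto intro!: congruence_cong_gen)
  moreover have "\<alpha> \<subseteq> \<Union>?S" using subset_cong_gen by blast
  then have "\<alpha> \<subseteq> cong_gen P (\<Union>?S)" using subset_cong_gen by blast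
  ultimately obtain T where T: "T \<subseteq> ?S" "finite T" "\<alpha> \<subseteq> cong_gen P (\<Union>T)"
    using assms unfolding Con_c_def by blast
  then obtain R where R: "R \<subseteq> \<alpha>" "finite R" "T = (\<lambda>p. cong_gen P {p}) ` R"
    by (meson finite_subset_image)
  have "\<Union>T \<subseteq> cong_gen P R" using R(3) cong_gen_mono[of "{_}" R] by blast
  moreover have "congruence P (cong_gen P R)"
    using R(1) congruence_subset[OF \<alpha>] by (intro congruence_cong_gen) blast
  ultimately have "\<alpha> \<subseteq> cong_gen P R" using T(3) cong_gen_least by blast
  moreover have "cong_gen P R \<subseteq> \<alpha>" using cong_gen_least[OF \<alpha> R(1)] .
  ultimately show thesis using that R by blast
qed

text \<open>Joins of congruences become unions of generating sets, so that a measure can be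
  evaluated one generator at a time.\<close>

lemma cong_gen_Un:
  assumes "R \<union> S \<subseteq> carr P \<times> carr P"
  shows "cong_gen P (R \<union> S) = cong_join P (cong_gen P R) (cong_gen P S)"
proof
  show "cong_gen P (R \<union> S) \<subseteq> cong_join P (cong_gen P R) (cong_gen P S)"
    unfolding cong_join_def using subset_cong_gen[of R] subset_cong_gen[of S]
    by (intro cong_gen_mono) blast
  show "cong_join P (cong_gen P R) (cong_gen P S) \<subseteq> cong_gen P (R \<union> S)"
    unfolding cong_join_def using congruence_cong_gen[OF assms] cong_gen_mono[of _ "R \<union> S"]
    by (intro cong_gen_least) auto
qed

lemma cong_join_in_Con_c:
  assumes "\<alpha> \<in> Con_c P" "\<beta> \<in> Con_c P"
  shows "cong_join P \<alpha> \<beta> \<in> Con_c P"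
proof -
  obtain R S where R: "finite R" "R \<subseteq> \<alpha>" "\<alpha> = cong_gen P R"
    and S: "finite S" "S \<subseteq> \<beta>" "\<beta> = cong_gen P S"
    using Con_c_finitely_generated[OF assms(1)] Con_c_finitely_generated[OF assms(2)] by metis
  have "\<alpha> \<subseteq> carr P \<times> carr P" "\<beta> \<subseteq> carr P \<times> carr P"
    using assms congruence_subset by (simp_all add: Con_c_def)
  with R(2) S(2) have sub: "R \<union> S \<subseteq> carr P \<times> carr P" by blast
  show ?thesis
    using cong_gen_in_Con_c[OF _ sub] R(1) S(1) unfolding cong_gen_Un[OF sub] R(3)[symmetric] S(3)[symmetric]
    by simp
qed

lemma cong_gen_empty: "cong_gen P {} = le P"
proof
  show "cong_gen P {} \<subseteq> le P" using congruence_le by (rule cong_gen_least) simp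
  show "le P \<subseteq> cong_gen P {}" using congruence_cong_gen[of "{}"] by (simp add: congruence_def)
qed

end

section \<open>The word problem for the free lattice on a partial prelattice\<close>

lemma partial_prelatticeD:
  assumes "partial_prelattice Q"
  shows "(x, y) \<in> le Q \<Longrightarrow> x \<in> carr Q \<and> y \<in> carr Q"
    "x \<in> carr Q \<Longrightarrow> (x, x) \<in> le Q"
    "(x, y) \<in> le Q \<Longrightarrow> (y, z) \<in> le Q \<Longrightarrow> (x, z) \<in> le Q"
proof -
  have "le Q \<subseteq> carr Q \<times> carr Q" "trans (le Q)" "refl_on (carr Q) (le Q)"
    using assms by (simp_all add: partial_prelattice_def preorder_on_def)
  then show "(x, y) \<in> le Q \<Longrightarrow> x \<in> carr Q \<and> y \<in> carr Q" "x \<in> carr Q \<Longrightarrow> (x, x) \<in> le Q"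
    "(x, y) \<in> le Q \<Longrightarrow> (y, z) \<in> le Q \<Longrightarrow> (x, z) \<in> le Q"
    by (blast dest: refl_onD transD)+
qed

lemma partial_prelattice_Join:
  assumes "partial_prelattice Q" "Join Q X = Some a"
  shows "X \<noteq> {}" "finite X" "X \<subseteq> carr Q" "a \<in> carr Q" "x \<in> X \<Longrightarrow> (x, a) \<in> le Q"
proof -
  have "X \<in> nefs (carr Q)" "is_sup (carr Q) (le Q) X a"
    using assms unfolding partial_prelattice_def by blast+
  then show "X \<noteq> {}" "finite X" "X \<subseteq> carr Q" "a \<in> carr Q" "x \<in> X \<Longrightarrow> (x, a) \<in> le Q"
    by (simp_all add: nefs_def is_sup_def)
qed

lemma partial_prelattice_Join_least:
  assumes "partial_prelattice Q" "Join Q X = Some a" "\<And>x. x \<in> X \<Longrightarrow> (x, b) \<in> le Q"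
  shows "(a, b) \<in> le Q"
proof -
  have "is_sup (carr Q) (le Q) X a"
    using assms unfolding partial_prelattice_def by blast
  moreover have "b \<in> carr Q"
    using partial_prelattice_Join(1)[OF assms(1,2)] partial_prelatticeD(1)[OF assms(1)] assms(3) by blast
  ultimately show ?thesis using assms(3) by (simp add: is_sup_def)
qed

text \<open>The order dual. Facts about filters and meets are derived from those about ideals and
  joins by passing to it.\<close>

definition flip_pl :: "'a partial_lat \<Rightarrow> 'a partial_lat" where
  "flip_pl Q = \<lparr>carr = carr Q, le = (le Q)\<inverse>, Join = Meet Q, Meet = Join Q\<rparr>"

lemma flip_pl_simps [simp]:
  "carr (flip_pl Q) = carr Q" "le (flip_pl Q) = (le Q)\<inverse>"
  "Join (flip_pl Q) = Meet Q" "Meet (flip_pl Q) = Join Q" "flip_pl (flip_pl Q) = Q"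
  by (simp_all add: flip_pl_def)

lemma is_sup_converse: "is_sup A (r\<inverse>) X a \<longleftrightarrow> is_inf A r X a"
  and is_inf_converse: "is_inf A (r\<inverse>) X a \<longleftrightarrow> is_sup A r X a"
  by (auto simp: is_sup_def is_inf_def)

lemma partial_prelattice_flip_pl [simp]:
  "partial_prelattice (flip_pl Q) \<longleftrightarrow> partial_prelattice Q"
proof -
  have "preorder_on A (r\<inverse>) \<longleftrightarrow> preorder_on A r" for A :: "'a set" and r
    by (auto simp: preorder_on_def refl_on_def)
  then show ?thesis by (auto simp: partial_prelattice_def is_sup_converse is_inf_converse)
qed

section \<open>Ideals, and the generators below or above a term\<close>

inductive_set ideal_gen :: "'a partial_lat \<Rightarrow> 'a set \<Rightarrow> 'a set" for Q X where
  base: "x \<in> X \<Longrightarrow> x \<in> ideal_gen Q X"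
| down: "y \<in> ideal_gen Q X \<Longrightarrow> (x, y) \<in> le Q \<Longrightarrow> x \<in> ideal_gen Q X"
| join: "Join Q Z = Some a \<Longrightarrow> (\<And>z. z \<in> Z \<Longrightarrow> z \<in> ideal_gen Q X) \<Longrightarrow> a \<in> ideal_gen Q X"

text \<open>Only joins that are defined in \<open>Q\<close> count. Over a prelattice their arguments
  are nonempty, so the empty set is an ideal. Filters are the ideals of
  \<open>flip_pl Q\<close>.\<close>

definition is_ideal :: "'a partial_lat \<Rightarrow> 'a set \<Rightarrow> bool" where
  "is_ideal Q A \<longleftrightarrow> A \<subseteq> carr Q \<and> (\<forall>x y. y \<in> A \<longrightarrow> (x, y) \<in> le Q \<longrightarrow> x \<in> A) \<and>
     (\<forall>Z a. Join Q Z = Some a \<longrightarrow> Z \<subseteq> A \<longrightarrow> a \<in> A)"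

lemma ideal_gen_least:
  assumes "is_ideal Q A" "X \<subseteq> A"
  shows "ideal_gen Q X \<subseteq> A"
proof
  fix a assume "a \<in> ideal_gen Q X"
  then show "a \<in> A"
  proof induction
    case (base x) with assms(2) show ?case by blast
  next
    case (down y x) with assms(1) show ?case unfolding is_ideal_def by blast
  next
    case (join Z a)
    then have "Z \<subseteq> A" by blast
    with join(1) assms(1) show ?case unfolding is_ideal_def by blast
  qed
qed

lemma subset_ideal_gen: "X \<subseteq> ideal_gen Q X"
  by (auto intro: ideal_gen.base)

lemma is_ideal_carr: "partial_prelattice Q \<Longrightarrow> is_ideal Q (carr Q)"
  using partial_prelatticeD(1)[of Q] partial_prelattice_Join(4)[of Q]
  unfolding is_ideal_def by blast

lemma is_ideal_ideal_gen:
  assumes "partial_prelattice Q" "X \<subseteq> carr Q"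
  shows "is_ideal Q (ideal_gen Q X)"
  unfolding is_ideal_def
proof (intro conjI allI impI)
  show "ideal_gen Q X \<subseteq> carr Q" by (rule ideal_gen_least[OF is_ideal_carr[OF assms(1)] assms(2)])
  show "x \<in> ideal_gen Q X" if "y \<in> ideal_gen Q X" "(x, y) \<in> le Q" for x y
    using that by (rule ideal_gen.down)
  show "a \<in> ideal_gen Q X" if "Join Q Z = Some a" "Z \<subseteq> ideal_gen Q X" for Z a
    using that(1) by (rule ideal_gen.join) (use that(2) in blast)
qed

lemma is_ideal_Int: "is_ideal Q A \<Longrightarrow> is_ideal Q B \<Longrightarrow> is_ideal Q (A \<inter> B)"
  by (simp add: is_ideal_def) blast

lemma is_ideal_down:
  assumes "partial_prelattice Q"
  shows "is_ideal Q {x. (x, y) \<in> le Q}"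
  using partial_prelatticeD[OF assms] partial_prelattice_Join_least[OF assms]
  unfolding is_ideal_def by blast

text \<open>\<open>term_ideal Q t\<close> consists of all generators below \<open>t\<close>, and \<open>term_filter Q t\<close> of all
  generators above \<open>t\<close>.\<close>

primrec term_ideal :: "'a partial_lat \<Rightarrow> 'a lterm \<Rightarrow> 'a set" where
  "term_ideal Q (Gen y) = {x. (x, y) \<in> le Q}"
| "term_ideal Q (TJoin s t) = ideal_gen Q (term_ideal Q s \<union> term_ideal Q t)"
| "term_ideal Q (TMeet s t) = term_ideal Q s \<inter> term_ideal Q t"

primrec term_filter :: "'a partial_lat \<Rightarrow> 'a lterm \<Rightarrow> 'a set" where
  "term_filter Q (Gen y) = {x. (y, x) \<in> le Q}"
| "term_filter Q (TJoin s t) = term_filter Q s \<inter> term_filter Q t"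
| "term_filter Q (TMeet s t) = ideal_gen (flip_pl Q) (term_filter Q s \<union> term_filter Q t)"

primrec flip_lterm :: "'a lterm \<Rightarrow> 'a lterm" where
  "flip_lterm (Gen x) = Gen x"
| "flip_lterm (TJoin s t) = TMeet (flip_lterm s) (flip_lterm t)"
| "flip_lterm (TMeet s t) = TJoin (flip_lterm s) (flip_lterm t)"

lemma flip_lterm_simps [simp]:
  "flip_lterm (flip_lterm t) = t" "set_lterm (flip_lterm t) = set_lterm t"
  by (induction t) auto

lemma term_ideal_flip: "term_ideal (flip_pl Q) (flip_lterm t) = term_filter Q t"
  by (induction t) auto

lemma term_filter_flip: "term_filter (flip_pl Q) (flip_lterm t) = term_ideal Q t"
  by (induction t) auto

text \<open>The first rule covers inequalities with a generator on either side as well as Dean's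
  condition for an inequality between a meet and a join.\<close>

inductive whitman_le :: "'a partial_lat \<Rightarrow> 'a lterm \<Rightarrow> 'a lterm \<Rightarrow> bool" for Q where
  interpolant: "z \<in> term_filter Q s \<Longrightarrow> z \<in> term_ideal Q t \<Longrightarrow> whitman_le Q s t"
| join_left: "whitman_le Q s u \<Longrightarrow> whitman_le Q t u \<Longrightarrow> whitman_le Q (TJoin s t) u"
| join_right1: "whitman_le Q u s \<Longrightarrow> whitman_le Q u (TJoin s t)"
| join_right2: "whitman_le Q u t \<Longrightarrow> whitman_le Q u (TJoin s t)"
| meet_right: "whitman_le Q u s \<Longrightarrow> whitman_le Q u t \<Longrightarrow> whitman_le Q u (TMeet s t)"
| meet_left1: "whitman_le Q s u \<Longrightarrow> whitman_le Q (TMeet s t) u"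
| meet_left2: "whitman_le Q t u \<Longrightarrow> whitman_le Q (TMeet s t) u"

text \<open>The calculus is self-dual: \<open>interpolant\<close> is symmetric, and the other rules
  come in pairs exchanging joins and meets.\<close>

lemma whitman_le_flip:
  "whitman_le Q s t \<Longrightarrow> whitman_le (flip_pl Q) (flip_lterm t) (flip_lterm s)"
  by (induction rule: whitman_le.induct)
    (auto intro: whitman_le.intros simp: term_ideal_flip term_filter_flip)

context
  fixes Q :: "'a partial_lat"
  assumes Q: "partial_prelattice Q"
begin

lemma is_ideal_term_ideal: "is_ideal Q (term_ideal Q t)"
proof (induction t)
  case (TJoin s t)
  then have "term_ideal Q s \<union> term_ideal Q t \<subseteq> carr Q" by (simp add: is_ideal_def)
  then show ?case using is_ideal_ideal_gen[OF Q] by simp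
qed (simp_all add: is_ideal_Int is_ideal_down[OF Q])

text \<open>A cut between two generators. The generators below \<open>y\<close> form an ideal, so at
  a join the bound passes from both sides to the ideal they generate; meets are dual.\<close>

lemma term_ideal_le_term_filter:
  "x \<in> term_ideal Q s \<Longrightarrow> y \<in> term_filter Q s \<Longrightarrow> (x, y) \<in> le Q"
proof (induction s arbitrary: x y)
  case (Gen z) then show ?case using partial_prelatticeD(3)[OF Q] by auto
next
  case (TJoin s t)
  then have "ideal_gen Q (term_ideal Q s \<union> term_ideal Q t) \<subseteq> {x. (x, y) \<in> le Q}"
    by (intro ideal_gen_least is_ideal_down[OF Q]) auto
  with TJoin show ?case by auto
next
  case (TMeet s t)
  then have "ideal_gen (flip_pl Q) (term_filter Q s \<union> term_filter Q t) \<subseteq> {y. (y, x) \<in> le (flip_pl Q)}"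
    by (intro ideal_gen_least is_ideal_down) (auto simp: Q)
  with TMeet show ?case by auto
qed

text \<open>A cut whose left end is a generator. For \<open>interpolant\<close>, a generator below
  \<open>s\<close> is below \<open>z\<close>, and the ideal of \<open>t\<close> is closed downwards;
  for \<open>join_left\<close>, the ideal of \<open>u\<close> contains the generated one.\<close>

lemma term_ideal_mono: "whitman_le Q s t \<Longrightarrow> term_ideal Q s \<subseteq> term_ideal Q t"
proof (induction rule: whitman_le.induct)
  case (interpolant z s t)
  then show ?case
    using term_ideal_le_term_filter[of _ s z] is_ideal_term_ideal[of t] by (auto simp: is_ideal_def)
next
  case (join_left s u t)
  then show ?case using is_ideal_term_ideal[of u] by (simp add: ideal_gen_least)
qed (use subset_ideal_gen in fastforce)+

end

lemma term_filter_antimono: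
  assumes "partial_prelattice Q" "whitman_le Q s t"
  shows "term_filter Q t \<subseteq> term_filter Q s"
  using term_ideal_mono[of "flip_pl Q", OF _ whitman_le_flip[OF assms(2)]] assms(1)
  by (simp add: term_ideal_flip)

section \<open>Cut elimination and inversion of the rules\<close>

context
  fixes Q :: "'a partial_lat"
  assumes Q: "partial_prelattice Q"
begin

lemma whitman_le_refl: "t \<in> lterms Q \<Longrightarrow> whitman_le Q t t"
proof (induction t)
  case (Gen x)
  then have "(x, x) \<in> le Q" using partial_prelatticeD(2)[OF Q] by simp
  then show ?case by (intro whitman_le.interpolant[of x]) auto
qed (auto intro: whitman_le.intros)

text \<open>Cut elimination: a cut on \<open>t\<close> is moved upwards in either derivation until \<open>t\<close> is
  principal in both.\<close>

lemma whitman_le_trans: "whitman_le Q s t \<Longrightarrow> whitman_le Q t u \<Longrightarrow> whitman_le Q s u"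
\<comment> \<open>Every recursive call below replaces exactly one of the three terms by a proper
  subterm.\<close>
proof (induction "size s + size t + size u" arbitrary: s t u rule: less_induct)
  case less
  note IH = less.hyps
  note st = less.prems(1) and tu = less.prems(2)
  from tu show ?case
  proof (cases rule: whitman_le.cases)
    \<comment> \<open>Here \<open>z\<close> lies above \<open>t\<close>, hence above
      \<open>s\<close>, so the same generator interpolates between \<open>s\<close> and
      \<open>u\<close>.\<close>
    case (interpolant z)
    then show ?thesis
      using term_filter_antimono[OF Q st] by (auto intro: whitman_le.interpolant)
  next
    case (meet_right v w)
    then show ?thesis using st by (auto intro!: whitman_le.meet_right IH[of s t])
  next
    case (join_right1 v w)
    then show ?thesis using st by (auto intro!: whitman_le.join_right1 IH[of s t])
  next
    case (join_right2 v w)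
    then show ?thesis using st by (auto intro!: whitman_le.join_right2 IH[of s t])
  next
    case tu': (join_left v w)
    from st show ?thesis
    proof (cases rule: whitman_le.cases)
      case (interpolant z)
      then show ?thesis
        using term_ideal_mono[OF Q tu] by (auto intro: whitman_le.interpolant)
    next
      case (join_left v w)
      then show ?thesis using tu by (auto intro!: whitman_le.join_left IH[of _ t])
    next
      case (meet_left1 v w)
      then show ?thesis using tu by (auto intro!: whitman_le.meet_left1 IH[of _ t])
    next
      case (meet_left2 v w)
      then show ?thesis using tu by (auto intro!: whitman_le.meet_left2 IH[of _ t])
    \<comment> \<open>The principal case: \<open>s\<close> lies below one side of the join
      \<open>t\<close>, and that side lies below \<open>u\<close>, so the cut moves to this smaller
      term.\<close>
    qed (use tu' in \<open>auto intro: IH[of s v] IH[of s w]\<close>)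
  next
    case tu': (meet_left1 v w)
    from st show ?thesis
    proof (cases rule: whitman_le.cases)
      case (interpolant z)
      then show ?thesis
        using term_ideal_mono[OF Q tu] by (auto intro: whitman_le.interpolant)
    next
      case (join_left v w)
      then show ?thesis using tu by (auto intro!: whitman_le.join_left IH[of _ t])
    next
      case (meet_left1 v w)
      then show ?thesis using tu by (auto intro!: whitman_le.meet_left1 IH[of _ t])
    next
      case (meet_left2 v w)
      then show ?thesis using tu by (auto intro!: whitman_le.meet_left2 IH[of _ t])
    qed (use tu' in \<open>auto intro: IH[of s v]\<close>)
  next
    case tu': (meet_left2 w v)
    from st show ?thesis
    proof (cases rule: whitman_le.cases)
      case (interpolant z)
      then show ?thesis
        using term_ideal_mono[OF Q tu] by (auto intro: whitman_le.interpolant)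
    next
      case (join_left v w)
      then show ?thesis using tu by (auto intro!: whitman_le.join_left IH[of _ t])
    next
      case (meet_left1 v w)
      then show ?thesis using tu by (auto intro!: whitman_le.meet_left1 IH[of _ t])
    next
      case (meet_left2 v w)
      then show ?thesis using tu by (auto intro!: whitman_le.meet_left2 IH[of _ t])
    qed (use tu' in \<open>auto intro: IH[of s w]\<close>)
  qed
qed

text \<open>As \<open>x\<close> is in its own term ideal, monotonicity carries it into that of
  \<open>t\<close>; conversely \<open>x\<close> itself is an interpolant.\<close>

lemma whitman_le_Gen_left: "x \<in> carr Q \<Longrightarrow> whitman_le Q (Gen x) t \<longleftrightarrow> x \<in> term_ideal Q t"
proof
  assume "x \<in> carr Q"
  then have "(x, x) \<in> le Q" using partial_prelatticeD(2)[OF Q] by simp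
  then show "x \<in> term_ideal Q t" if "whitman_le Q (Gen x) t"
    using term_ideal_mono[OF Q that] by auto
  show "whitman_le Q (Gen x) t" if "x \<in> term_ideal Q t"
    using that \<open>(x, x) \<in> le Q\<close> by (auto intro: whitman_le.interpolant)
qed

end

lemma whitman_le_Gen_right:
  assumes "partial_prelattice Q" "x \<in> carr Q"
  shows "whitman_le Q t (Gen x) \<longleftrightarrow> x \<in> term_filter Q t"
  using whitman_le_Gen_left[of "flip_pl Q" x "flip_lterm t"] assms
    whitman_le_flip[of Q t "Gen x"] whitman_le_flip[of "flip_pl Q" "Gen x" "flip_lterm t"]
  by (auto simp: term_ideal_flip)

text \<open>The rules \<open>join_left\<close> and \<open>meet_right\<close> cannot end a derivation
  of this shape; the five alternatives are the other five rules. This is Whitman's condition with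
  Dean's interpolant added.\<close>

lemma whitman_le_meet_join:
  "whitman_le Q (TMeet s1 s2) (TJoin t1 t2) \<longleftrightarrow>
    whitman_le Q s1 (TJoin t1 t2) \<or> whitman_le Q s2 (TJoin t1 t2) \<or>
    whitman_le Q (TMeet s1 s2) t1 \<or> whitman_le Q (TMeet s1 s2) t2 \<or>
    (\<exists>z. z \<in> term_filter Q (TMeet s1 s2) \<and> z \<in> term_ideal Q (TJoin t1 t2))"
    (is "?L \<longleftrightarrow> ?R")
proof
  assume ?L
  then show ?R by cases blast+
next
  assume ?R
  then show ?L by (elim disjE exE conjE) (rule whitman_le.intros, assumption+)+
qed

context
  fixes Q :: "'a partial_lat"
  assumes Q: "partial_prelattice Q"
begin

text \<open>The rule is invertible by cutting with \<open>s \<le> s \<or> t\<close> and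
  \<open>t \<le> s \<or> t\<close>; the hypotheses supply reflexivity at \<open>s\<close> and
  \<open>t\<close>.\<close>

lemma whitman_le_join_left:
  assumes "s \<in> lterms Q" "t \<in> lterms Q"
  shows "whitman_le Q (TJoin s t) u \<longleftrightarrow> whitman_le Q s u \<and> whitman_le Q t u"
  using whitman_le.join_left[of Q s u t]
    whitman_le_trans[OF Q whitman_le.join_right1[OF whitman_le_refl[OF Q assms(1)], of t], of u]
    whitman_le_trans[OF Q whitman_le.join_right2[OF whitman_le_refl[OF Q assms(2)], of s], of u]
  by blast

lemma whitman_le_meet_right:
  assumes "s \<in> lterms Q" "t \<in> lterms Q"
  shows "whitman_le Q u (TMeet s t) \<longleftrightarrow> whitman_le Q u s \<and> whitman_le Q u t"
  using whitman_le.meet_right[of Q u s t]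
    whitman_le_trans[OF Q _ whitman_le.meet_left1[OF whitman_le_refl[OF Q assms(1)], of t], of u]
    whitman_le_trans[OF Q _ whitman_le.meet_left2[OF whitman_le_refl[OF Q assms(2)], of s], of u]
  by blast

text \<open>Inequalities of the free lattice on \<open>P\<close> remain derivable over the coarser
  ordering of \<open>Q\<close>: transitivity is cut elimination, and the joins and meets of
  \<open>P\<close> are respected because term ideals are closed under the former and term filters
  under the latter.\<close>

lemma term_le_whitman_le:
  assumes P: "congruence P r" "Q = P\<lparr>le := r\<rparr>" and "term_le P s t"
  shows "whitman_le Q s t"
proof -
  have [simp]: "carr Q = carr P" "Join Q = Join P" "Meet Q = Meet P" "le Q = r" "lterms Q = lterms P"
    by (simp_all add: P(2) lterms_def)
  note [intro] = whitman_le.intros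
  from assms(3) show ?thesis
  proof induction
    case (refl t) then show ?case using whitman_le_refl[OF Q] by simp
  next
    case (trans s t u) then show ?case using whitman_le_trans[OF Q] by blast
  next
    case (gen x y)
    then have "(x, y) \<in> le Q" "x \<in> carr Q"
      using P(1) Q by (auto simp: congruence_def partial_prelattice_def preorder_on_def)
    then show ?case using whitman_le_Gen_left[OF Q] by simp
  next
    case (gen_Join X a t)
    then have "a \<in> carr Q" "X \<subseteq> carr Q"
      using partial_prelattice_Join[OF Q, of X a] by auto
    moreover from this have "X \<subseteq> term_ideal Q t"
      using gen_Join(3) whitman_le_Gen_left[OF Q] by blast
    ultimately show ?case
      using is_ideal_term_ideal[OF Q, of t] gen_Join(1) whitman_le_Gen_left[OF Q]
      by (simp add: is_ideal_def)
  next
    case (gen_Meet X a t)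
    then have "a \<in> carr Q" "X \<subseteq> carr Q"
      using partial_prelattice_Join[of "flip_pl Q" X a] Q by auto
    moreover from this have "X \<subseteq> term_filter Q t"
      using gen_Meet(3) whitman_le_Gen_right[OF Q] by blast
    ultimately show ?case
      using is_ideal_term_ideal[of "flip_pl Q" "flip_lterm t"] Q gen_Meet(1) whitman_le_Gen_right[OF Q]
      by (simp add: is_ideal_def term_ideal_flip)
  qed (use whitman_le_refl[OF Q] in auto)
qed

end

section \<open>Values in a distributive lattice\<close>

lemma le_by_prime_filters:
  fixes a b :: "'e::{distrib_lattice, bounded_lattice_top}"
  assumes "\<And>G. prime_filter G \<Longrightarrow> a \<in> G \<Longrightarrow> b \<in> G"
  shows "a \<le> b"
  using assms prime_filter_separation by blast

definition value_rel ::
  "'a partial_lat \<Rightarrow> ('a \<Rightarrow> 'a \<Rightarrow> 'e) \<Rightarrow> 'e set \<Rightarrow> ('a \<times> 'a) set" where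
  "value_rel P \<nu> G = {(x, y). x \<in> carr P \<and> y \<in> carr P \<and> \<nu> x y \<in> G}"

text \<open>The prelattice called \<open>P\<^sub>G\<close> above.\<close>

definition quot :: "'a partial_lat \<Rightarrow> ('a \<Rightarrow> 'a \<Rightarrow> 'e) \<Rightarrow> 'e set \<Rightarrow> 'a partial_lat" where
  "quot P \<nu> G = P\<lparr>le := value_rel P \<nu> G\<rparr>"

lemma quot_simps [simp]:
  "carr (quot P \<nu> G) = carr P" "le (quot P \<nu> G) = value_rel P \<nu> G"
  "Join (quot P \<nu> G) = Join P" "Meet (quot P \<nu> G) = Meet P"
  by (simp_all add: quot_def)

lemma lterms_quot [simp]: "lterms (quot P \<nu> G) = lterms P"
  by (simp add: lterms_def)

lemma quot_flip_pl: "quot (flip_pl P) (\<lambda>x y. \<nu> y x) G = flip_pl (quot P \<nu> G)"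
  by (auto simp: quot_def flip_pl_def value_rel_def)

section \<open>Order duality for comeasured partial lattices\<close>

context
  fixes P :: "'a partial_lat" and \<nu> :: "'a \<Rightarrow> 'a \<Rightarrow> 'e::distrib_lattice"
begin

lemma val_eq_flip: "val_eq (\<lambda>x y. \<nu> y x) = val_eq \<nu>"
  by (simp add: val_eq_def inf_commute fun_eq_iff)

lemma val_set_eq_flip: "val_set_eq (\<lambda>x y. \<nu> y x) = val_set_eq \<nu>"
  by (simp add: val_set_eq_def val_subset_def val_eq_flip fun_eq_iff)

lemma is_cover_flip: "is_cover (\<lambda>x y. \<nu> y x) = is_cover \<nu>"
  by (simp add: is_cover_def val_set_eq_flip fun_eq_iff)

lemma val_eq_join_flip: "val_eq_join (flip_pl P) (\<lambda>x y. \<nu> y x) = val_eq_meet P \<nu>"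
  by (simp add: val_eq_join_def val_eq_meet_def is_cover_flip val_set_eq_flip val_eq_flip fun_eq_iff)

lemma is_join_sample_flip: "is_join_sample (flip_pl P) (\<lambda>x y. \<nu> y x) = is_meet_sample P \<nu>"
  by (simp add: is_join_sample_def is_meet_sample_def val_eq_join_flip fun_eq_iff)

lemma val_le_join_flip: "val_le_join (flip_pl P) (\<lambda>x y. \<nu> y x) a X = val_meet_le P \<nu> X a"
  by (simp add: val_le_join_def val_meet_le_def is_join_sample_flip val_eq_join_flip)

lemma val_Id_flip: "val_Id (flip_pl P) (\<lambda>x y. \<nu> y x) n X U a = val_Fil P \<nu> n X U a"
  by (induction n arbitrary: a) (simp_all add: val_le_join_flip)

lemma val_eq_meet_flip: "val_eq_meet (flip_pl P) (\<lambda>x y. \<nu> y x) = val_eq_join P \<nu>"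
  by (simp add: val_eq_join_def val_eq_meet_def is_cover_flip val_set_eq_flip val_eq_flip fun_eq_iff)

lemma is_meet_sample_flip: "is_meet_sample (flip_pl P) (\<lambda>x y. \<nu> y x) = is_join_sample P \<nu>"
  by (simp add: is_join_sample_def is_meet_sample_def val_eq_meet_flip fun_eq_iff)

lemma val_meet_le_flip: "val_meet_le (flip_pl P) (\<lambda>x y. \<nu> y x) X a = val_le_join P \<nu> a X"
  by (simp add: val_le_join_def val_meet_le_def is_meet_sample_flip val_eq_meet_flip)

lemma val_Fil_flip: "val_Fil (flip_pl P) (\<lambda>x y. \<nu> y x) n X U a = val_Id P \<nu> n X U a"
  by (induction n arbitrary: a) (simp_all add: val_meet_le_flip)

text \<open>Reversing the order exchanges the two kinds of covers and the ideal conditions with the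
  filter conditions, so results on ideals alone yield those on filters.\<close>

lemma balanced_flip:
  assumes "balanced P \<nu>"
  shows "balanced (flip_pl P) (\<lambda>x y. \<nu> y x)"
proof -
  have "finitely_covering (flip_pl P) (\<lambda>x y. \<nu> y x) \<longleftrightarrow> finitely_covering P \<nu>"
    by (simp add: finitely_covering_def is_cover_flip conj_commute)
  moreover have "Id_cap (flip_pl P) (\<lambda>x y. \<nu> y x) \<longleftrightarrow> Fil_cap P \<nu>"
    "Fil_cap (flip_pl P) (\<lambda>x y. \<nu> y x) \<longleftrightarrow> Id_cap P \<nu>"
    by (simp_all add: Id_cap_def Fil_cap_def)
  moreover have "Id_vee (flip_pl P) (\<lambda>x y. \<nu> y x) \<longleftrightarrow> Fil_vee P \<nu>"
    "Fil_vee (flip_pl P) (\<lambda>x y. \<nu> y x) \<longleftrightarrow> Id_vee P \<nu>"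
    unfolding Id_vee_def Fil_vee_def val_Id_flip val_Fil_flip flip_pl_simps by simp_all
  ultimately show ?thesis using assms by (simp add: balanced_def)
qed

end

text \<open>The comeasure axioms enter in pointwise form: at each prime filter the inequalities
  whose value it contains form a congruence.\<close>

locale balanced_comeasured =
  fixes P :: "'a partial_lat" and \<nu> :: "'a \<Rightarrow> 'a \<Rightarrow> 'e::{distrib_lattice, bounded_lattice_top}"
  assumes prelattice: "partial_prelattice P"
    and congruence_value_rel: "prime_filter G \<Longrightarrow> congruence P (value_rel P \<nu> G)"
    and balanced: "balanced P \<nu>"
begin

lemma flip: "balanced_comeasured (flip_pl P) (\<lambda>x y. \<nu> y x)"
proof
  show "partial_prelattice (flip_pl P)" using prelattice by simp
  show "balanced (flip_pl P) (\<lambda>x y. \<nu> y x)" using balanced by (rule balanced_flip)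
  show "congruence (flip_pl P) (value_rel (flip_pl P) (\<lambda>x y. \<nu> y x) G)" if "prime_filter G" for G
  proof -
    have "value_rel (flip_pl P) (\<lambda>x y. \<nu> y x) G = (value_rel P \<nu> G)\<inverse>"
      by (auto simp: value_rel_def)
    moreover have "(flip_pl P)\<lparr>le := (value_rel P \<nu> G)\<inverse>\<rparr> = flip_pl (P\<lparr>le := value_rel P \<nu> G\<rparr>)"
      by (simp add: flip_pl_def)
    then have "partial_prelattice ((flip_pl P)\<lparr>le := (value_rel P \<nu> G)\<inverse>\<rparr>)"
      using congruence_value_rel[OF that] by (simp only: congruence_def partial_prelattice_flip_pl)
    ultimately show ?thesis
      using congruence_value_rel[OF that] by (auto simp: congruence_def)
  qed
qed

lemma prelattice_quot: "prime_filter G \<Longrightarrow> partial_prelattice (quot P \<nu> G)"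
  using congruence_value_rel by (simp add: congruence_def quot_def)

lemma dom_Join_nefs: "Z \<in> dom (Join P) \<Longrightarrow> Z \<in> nefs (carr P) \<and> the (Join P Z) \<in> carr P"
  using partial_prelattice_Join[OF prelattice, of Z] by (auto simp: nefs_def)

section \<open>Values read at a single prime filter\<close>

context
  fixes G :: "'e set"
  assumes G: "prime_filter G"
begin

lemma value_refl: "x \<in> carr P \<Longrightarrow> \<nu> x x \<in> G"
  using partial_prelatticeD(2)[OF prelattice_quot[OF G]] by (simp add: value_rel_def)

lemma value_trans:
  "x \<in> carr P \<Longrightarrow> y \<in> carr P \<Longrightarrow> z \<in> carr P \<Longrightarrow> \<nu> x y \<in> G \<Longrightarrow> \<nu> y z \<in> G \<Longrightarrow> \<nu> x z \<in> G"
  using partial_prelatticeD(3)[OF prelattice_quot[OF G], of x y z] by (simp add: value_rel_def)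

lemma val_eq_mem: "val_eq \<nu> x y \<in> G \<longleftrightarrow> \<nu> x y \<in> G \<and> \<nu> y x \<in> G"
  by (simp add: val_eq_def prime_filter_mem[OF G])

lemma val_eq_trans:
  "x \<in> carr P \<Longrightarrow> y \<in> carr P \<Longrightarrow> z \<in> carr P \<Longrightarrow> val_eq \<nu> x y \<in> G \<Longrightarrow> val_eq \<nu> y z \<in> G \<Longrightarrow>
    val_eq \<nu> x z \<in> G"
  using value_trans[of x y z] value_trans[of z y x] by (simp add: val_eq_mem)

lemma val_subset_mem:
  assumes "X \<in> nefs A" "Y \<in> nefs B"
  shows "val_subset \<nu> X Y \<in> G \<longleftrightarrow> (\<forall>x\<in>X. \<exists>y\<in>Y. val_eq \<nu> x y \<in> G)"
  using assms
  by (simp add: nefs_def val_subset_def prime_filter_Inf_fin[OF G] prime_filter_Sup_fin[OF G])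

lemma val_set_eq_mem:
  assumes "X \<in> nefs A" "Y \<in> nefs B"
  shows "val_set_eq \<nu> X Y \<in> G \<longleftrightarrow>
    (\<forall>x\<in>X. \<exists>y\<in>Y. val_eq \<nu> x y \<in> G) \<and> (\<forall>y\<in>Y. \<exists>x\<in>X. val_eq \<nu> y x \<in> G)"
  unfolding val_set_eq_def prime_filter_mem[OF G] val_subset_mem[OF assms]
    val_subset_mem[OF assms(2,1)] ..

lemma val_set_eq_refl:
  assumes "X \<in> nefs (carr P)"
  shows "val_set_eq \<nu> X X \<in> G"
proof -
  have "\<exists>y\<in>X. val_eq \<nu> x y \<in> G" if "x \<in> X" for x
    using that assms value_refl[of x] by (auto simp: val_eq_mem nefs_def)
  then show ?thesis by (simp add: val_set_eq_mem[OF assms assms])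
qed

lemma val_set_eq_sym: "val_set_eq \<nu> X Y \<in> G \<Longrightarrow> val_set_eq \<nu> Y X \<in> G"
  by (simp add: val_set_eq_def inf_commute)

lemma val_set_eq_trans:
  assumes nefs: "X \<in> nefs (carr P)" "Y \<in> nefs (carr P)" "Z \<in> nefs (carr P)"
    and eq: "val_set_eq \<nu> X Y \<in> G" "val_set_eq \<nu> Y Z \<in> G"
  shows "val_set_eq \<nu> X Z \<in> G"
proof -
  have *: "\<forall>x\<in>X. \<exists>z\<in>Z. val_eq \<nu> x z \<in> G"
    if XYZ: "X \<in> nefs (carr P)" "Y \<in> nefs (carr P)" "Z \<in> nefs (carr P)"
      and XY: "\<forall>x\<in>X. \<exists>y\<in>Y. val_eq \<nu> x y \<in> G" and YZ: "\<forall>y\<in>Y. \<exists>z\<in>Z. val_eq \<nu> y z \<in> G" for X Y Z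
  proof
    fix x assume "x \<in> X"
    moreover from this obtain y where y: "y \<in> Y" "val_eq \<nu> x y \<in> G" using XY by blast
    moreover from this obtain z where z: "z \<in> Z" "val_eq \<nu> y z \<in> G" using YZ by blast
    ultimately have "val_eq \<nu> x z \<in> G"
      using XYZ val_eq_trans[of x y z] by (auto simp: nefs_def)
    with z show "\<exists>z\<in>Z. val_eq \<nu> x z \<in> G" by blast
  qed
  show ?thesis
    using eq *[OF nefs] *[OF nefs(3,2,1)]
    by (simp add: val_set_eq_mem[OF nefs(1,2)] val_set_eq_mem[OF nefs(2,3)] val_set_eq_mem[OF nefs(1,3)])
qed

text \<open>Each member of \<open>Y\<close> is equivalent at \<open>G\<close> to a member of
  \<open>Z\<close>, hence lies below the join of \<open>Z\<close>; and the join of \<open>Y\<close>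
  remains a supremum in \<open>quot P \<nu> G\<close>.\<close>

lemma value_Join_mono:
  assumes "Y \<in> dom (Join P)" "Z \<in> dom (Join P)" "val_set_eq \<nu> Y Z \<in> G"
  shows "\<nu> (the (Join P Y)) (the (Join P Z)) \<in> G"
proof -
  note Q = prelattice_quot[OF G]
  obtain a b where ab: "Join P Y = Some a" "Join P Z = Some b" using assms by blast
  have "(y, b) \<in> le (quot P \<nu> G)" if "y \<in> Y" for y
  proof -
    have "Y \<in> nefs (carr P)" "Z \<in> nefs (carr P)" using assms(1,2) dom_Join_nefs by blast+
    then obtain z where "z \<in> Z" "val_eq \<nu> y z \<in> G" "z \<in> carr P" "y \<in> carr P"
      using assms(3) \<open>y \<in> Y\<close> val_set_eq_mem[of Y "carr P" Z "carr P"] unfolding nefs_def by blast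
    then have "(y, z) \<in> le (quot P \<nu> G)" "(z, b) \<in> le (quot P \<nu> G)"
      using partial_prelattice_Join(5)[OF Q, of Z b z] ab by (simp_all add: val_eq_mem value_rel_def)
    then show ?thesis by (rule partial_prelatticeD(3)[OF Q])
  qed
  then have "(a, b) \<in> le (quot P \<nu> G)"
    using partial_prelattice_Join_least[OF Q, of Y a b] ab by simp
  then show ?thesis by (simp add: ab value_rel_def)
qed

lemma val_eq_Join:
  "Y \<in> dom (Join P) \<Longrightarrow> Z \<in> dom (Join P) \<Longrightarrow> val_set_eq \<nu> Y Z \<in> G \<Longrightarrow>
    val_eq \<nu> (the (Join P Y)) (the (Join P Z)) \<in> G"
  by (simp add: val_eq_mem value_Join_mono val_set_eq_sym)

end

lemma join_cover: "X \<in> nefs (carr P) \<Longrightarrow>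
    is_cover \<nu> (dom (Join P)) X (SOME \<C>. is_cover \<nu> (dom (Join P)) X \<C>)"
  using balanced by (simp add: balanced_def finitely_covering_def someI_ex)

lemma cover_mem:
  assumes "prime_filter G" "is_cover \<nu> \<D> X \<C>" "Y \<in> \<D>" "val_set_eq \<nu> X Y \<in> G"
  obtains Z where "Z \<in> \<C>" "val_set_eq \<nu> X Z \<in> G"
proof -
  have "Sup_fin ((\<lambda>Z. val_set_eq \<nu> X Z) ` \<C>) \<in> G"
    using assms by (auto simp: is_cover_def intro: prime_filter_mono)
  then show thesis
    using assms(2) that by (auto simp: is_cover_def prime_filter_Sup_fin[OF assms(1)])
qed

text \<open>Sets that are equivalent at \<open>G\<close> have equivalent joins, so any
  \<open>Z\<close> in the domain can be exchanged for a member of the cover. The arbitrary choice of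
  the cover thereby disappears.\<close>

lemma val_eq_join_mem:
  assumes G: "prime_filter G" and a: "a \<in> carr P" and X: "X \<in> nefs (carr P)"
  shows "val_eq_join P \<nu> a X \<in> G \<longleftrightarrow>
    (\<exists>Z\<in>dom (Join P). val_eq \<nu> a (the (Join P Z)) \<in> G \<and> val_set_eq \<nu> X Z \<in> G)"
proof -
  define \<C> where "\<C> = (SOME \<C>. is_cover \<nu> (dom (Join P)) X \<C>)"
  have \<C>: "is_cover \<nu> (dom (Join P)) X \<C>" unfolding \<C>_def using X by (rule join_cover)
  then have "finite \<C>" "\<C> \<noteq> {}" by (simp_all add: is_cover_def)
  then have "val_eq_join P \<nu> a X \<in> G \<longleftrightarrow>
      (\<exists>Z\<in>\<C>. val_eq \<nu> a (the (Join P Z)) \<in> G \<and> val_set_eq \<nu> X Z \<in> G)"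
    by (simp add: val_eq_join_def \<C>_def[symmetric] prime_filter_Sup_fin[OF G]
        prime_filter_mem[OF G])
  also have "\<dots> \<longleftrightarrow>
      (\<exists>Z\<in>dom (Join P). val_eq \<nu> a (the (Join P Z)) \<in> G \<and> val_set_eq \<nu> X Z \<in> G)"
  proof
    assume "\<exists>Z\<in>dom (Join P). val_eq \<nu> a (the (Join P Z)) \<in> G \<and> val_set_eq \<nu> X Z \<in> G"
    then obtain Z where Z: "Z \<in> dom (Join P)" "val_eq \<nu> a (the (Join P Z)) \<in> G"
      "val_set_eq \<nu> X Z \<in> G" by blast
    then obtain Y where Y: "Y \<in> \<C>" "val_set_eq \<nu> X Y \<in> G" using cover_mem[OF G \<C>] by blast
    then have "Y \<in> dom (Join P)" using \<C> by (auto simp: is_cover_def)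
    moreover from this have "val_set_eq \<nu> Z Y \<in> G"
      using Y Z X dom_Join_nefs val_set_eq_sym[OF G] val_set_eq_trans[OF G, of Z X Y] by blast
    ultimately have "val_eq \<nu> (the (Join P Z)) (the (Join P Y)) \<in> G"
      using Z(1) val_eq_Join[OF G] by blast
    then have "val_eq \<nu> a (the (Join P Y)) \<in> G"
      using Z(1,2) a \<open>Y \<in> dom (Join P)\<close> dom_Join_nefs
        val_eq_trans[OF G, of a "the (Join P Z)" "the (Join P Y)"] by blast
    with Y show "\<exists>Z\<in>\<C>. val_eq \<nu> a (the (Join P Z)) \<in> G \<and> val_set_eq \<nu> X Z \<in> G" by blast
  qed (use \<C> in \<open>auto simp: is_cover_def\<close>)
  finally show ?thesis .
qed

text \<open>The joins of the members of a cover form a sample.\<close>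

lemma join_sample_exists:
  assumes X: "X \<in> nefs (carr P)"
  shows "\<exists>U. is_join_sample P \<nu> X U"
proof -
  obtain \<C> where \<C>: "is_cover \<nu> (dom (Join P)) X \<C>" using join_cover[OF X] by blast
  define U where "U = (\<lambda>Z. the (Join P Z)) ` \<C>"
  have "U \<subseteq> carr P"
  proof
    fix u assume "u \<in> U"
    then show "u \<in> carr P" using \<C> dom_Join_nefs unfolding U_def is_cover_def by blast
  qed
  then have U: "U \<in> nefs (carr P)" using \<C> by (simp add: nefs_def U_def is_cover_def)
  have "val_eq_join P \<nu> x X \<le> Sup_fin ((\<lambda>u. val_eq_join P \<nu> u X) ` U)" if x: "x \<in> carr P" for x
  proof (rule le_by_prime_filters)
    fix G :: "'e set" assume G: "prime_filter G" and "val_eq_join P \<nu> x X \<in> G"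
    then obtain Y where "Y \<in> dom (Join P)" "val_set_eq \<nu> X Y \<in> G"
      using val_eq_join_mem[OF G x X] by blast
    then obtain Z where Z: "Z \<in> \<C>" "val_set_eq \<nu> X Z \<in> G" using cover_mem[OF G \<C>] by blast
    then have "Z \<in> dom (Join P)" "the (Join P Z) \<in> carr P" "the (Join P Z) \<in> U"
      using \<C> \<open>U \<subseteq> carr P\<close> by (auto simp: is_cover_def U_def)
    moreover have "val_eq \<nu> (the (Join P Z)) (the (Join P Z)) \<in> G"
      using value_refl[OF G] \<open>the (Join P Z) \<in> carr P\<close> by (simp add: val_eq_mem[OF G])
    ultimately have "\<exists>u\<in>U. val_eq_join P \<nu> u X \<in> G"
      using val_eq_join_mem[OF G _ X] Z by blast
    then show "Sup_fin ((\<lambda>u. val_eq_join P \<nu> u X) ` U) \<in> G"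
      using U by (simp add: prime_filter_Sup_fin[OF G] nefs_def)
  qed
  with U show ?thesis unfolding is_join_sample_def by blast
qed

lemma val_le_join_sample:
  assumes "X \<in> nefs (carr P)"
  obtains U where "is_join_sample P \<nu> X U"
    "\<And>a. val_le_join P \<nu> a X = Sup_fin ((\<lambda>u. inf (\<nu> a u) (val_eq_join P \<nu> u X)) ` U)"
  using someI_ex[OF join_sample_exists[OF assms]] that by (simp add: val_le_join_def)

text \<open>Removes the arbitrary choice of the sample: at \<open>G\<close> the value says that
  \<open>a\<close> lies below the join of some set equivalent to \<open>X\<close>.\<close>

lemma val_le_join_mem:
  assumes G: "prime_filter G" and a: "a \<in> carr P" and X: "X \<in> nefs (carr P)"
  shows "val_le_join P \<nu> a X \<in> G \<longleftrightarrow>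
    (\<exists>Z\<in>dom (Join P). \<nu> a (the (Join P Z)) \<in> G \<and> val_set_eq \<nu> X Z \<in> G)"
proof -
  obtain U where U: "is_join_sample P \<nu> X U"
    "val_le_join P \<nu> a X = Sup_fin ((\<lambda>u. inf (\<nu> a u) (val_eq_join P \<nu> u X)) ` U)"
    using val_le_join_sample[OF X] by metis
  then have U': "finite U" "U \<noteq> {}" "U \<subseteq> carr P" by (auto simp: is_join_sample_def nefs_def)
  have "val_le_join P \<nu> a X \<in> G \<longleftrightarrow> (\<exists>u\<in>U. \<nu> a u \<in> G \<and> val_eq_join P \<nu> u X \<in> G)"
    using U' by (simp add: U(2) prime_filter_Sup_fin[OF G] prime_filter_mem[OF G])
  also have "\<dots> \<longleftrightarrow>
    (\<exists>Z\<in>dom (Join P). \<nu> a (the (Join P Z)) \<in> G \<and> val_set_eq \<nu> X Z \<in> G)" (is "?L \<longleftrightarrow> ?R")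
  proof
    assume ?L
    then obtain u where u: "u \<in> U" "\<nu> a u \<in> G" "val_eq_join P \<nu> u X \<in> G" by blast
    then obtain Z where Z: "Z \<in> dom (Join P)" "val_eq \<nu> u (the (Join P Z)) \<in> G" "val_set_eq \<nu> X Z \<in> G"
      using val_eq_join_mem[OF G _ X] U' by blast
    then have "\<nu> a (the (Join P Z)) \<in> G"
      using value_trans[OF G, of a u] u(1,2) U' a dom_Join_nefs[OF Z(1)] by (auto simp: val_eq_mem[OF G])
    with Z show ?R by blast
  next
    assume ?R
    then obtain Z where Z: "Z \<in> dom (Join P)" "\<nu> a (the (Join P Z)) \<in> G" "val_set_eq \<nu> X Z \<in> G"
      by blast
    let ?b = "the (Join P Z)"
    have b: "?b \<in> carr P" using dom_Join_nefs[OF Z(1)] by blast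
    then have "val_eq \<nu> ?b ?b \<in> G" using value_refl[OF G] by (simp add: val_eq_mem[OF G])
    then have bX: "val_eq_join P \<nu> ?b X \<in> G" using Z val_eq_join_mem[OF G b X] by blast
    \<comment> \<open>The sample property at \<open>?b\<close> yields \<open>u\<close> in
      \<open>U\<close> equivalent to the join of some \<open>Y\<close>, where \<open>Y\<close> is
      equivalent to \<open>X\<close> and so to \<open>Z\<close>. Thus \<open>a\<close> lies below
      \<open>?b\<close>, the join of \<open>Y\<close>, and \<open>u\<close> in turn.\<close>
    then have "Sup_fin ((\<lambda>u. val_eq_join P \<nu> u X) ` U) \<in> G"
      using U(1) b by (auto simp: is_join_sample_def intro: prime_filter_mono[OF G])
    then obtain u where u: "u \<in> U" "val_eq_join P \<nu> u X \<in> G"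
      using U' by (auto simp: prime_filter_Sup_fin[OF G])
    then obtain Y where Y: "Y \<in> dom (Join P)" "val_eq \<nu> u (the (Join P Y)) \<in> G" "val_set_eq \<nu> X Y \<in> G"
      using val_eq_join_mem[OF G _ X] U' by blast
    have c: "the (Join P Y) \<in> carr P" using dom_Join_nefs[OF Y(1)] by blast
    have "val_set_eq \<nu> Z Y \<in> G"
      using Y Z X dom_Join_nefs val_set_eq_sym[OF G] val_set_eq_trans[OF G, of Z X Y] by blast
    then have "\<nu> ?b (the (Join P Y)) \<in> G" using value_Join_mono[OF G Z(1) Y(1)] by blast
    then have "\<nu> a (the (Join P Y)) \<in> G" using value_trans[OF G a b c] Z by blast
    then have "\<nu> a u \<in> G"
      using value_trans[OF G a c, of u] Y(2) u(1) U'(3) by (auto simp: val_eq_mem[OF G])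
    with u show ?L by blast
  qed
  finally show ?thesis .
qed

end

section \<open>Generated ideals as finite iterations, uniformly in the prime filter\<close>

context balanced_comeasured
begin

lemma val_Id_Suc_mem:
  assumes G: "prime_filter G" and a: "a \<in> carr P" and U: "U \<in> nefs (carr P)"
  shows "val_Id P \<nu> (Suc n) X U a \<in> G \<longleftrightarrow> val_Id P \<nu> n X U a \<in> G \<or>
    (\<exists>Z. Z \<noteq> {} \<and> Z \<subseteq> U \<and> val_le_join P \<nu> a Z \<in> G \<and> (\<forall>z\<in>Z. val_Id P \<nu> n X U z \<in> G))"
proof -
  have fin: "finite {Z. Z \<noteq> {} \<and> Z \<subseteq> U}" and ne: "{Z. Z \<noteq> {} \<and> Z \<subseteq> U} \<noteq> {}"
    using U by (auto simp: nefs_def)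
  have "Inf_fin ((\<lambda>z. val_Id P \<nu> n X U z) ` Z) \<in> G \<longleftrightarrow> (\<forall>z\<in>Z. val_Id P \<nu> n X U z \<in> G)"
    if "Z \<noteq> {} \<and> Z \<subseteq> U" for Z
    using that U finite_subset[of Z U] by (simp add: prime_filter_Inf_fin[OF G] nefs_def)
  with fin ne show ?thesis
    by (auto simp: prime_filter_mem[OF G] prime_filter_Sup_fin[OF G])
qed

lemma val_Id_mono:
  assumes "prime_filter G" "U \<subseteq> Y" "U \<noteq> {}" "Y \<in> nefs (carr P)"
  shows "a \<in> carr P \<Longrightarrow> val_Id P \<nu> n X U a \<in> G \<Longrightarrow> val_Id P \<nu> n X Y a \<in> G"
proof (induction n arbitrary: a)
  case (Suc n)
  have U: "U \<in> nefs (carr P)" using assms finite_subset[of U Y] by (auto simp: nefs_def)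
  from Suc.prems consider "val_Id P \<nu> n X U a \<in> G"
    | Z where "Z \<noteq> {}" "Z \<subseteq> U" "val_le_join P \<nu> a Z \<in> G" "\<forall>z\<in>Z. val_Id P \<nu> n X U z \<in> G"
    unfolding val_Id_Suc_mem[OF assms(1) Suc.prems(1) U] by blast
  then show ?case
  proof cases
    case 1
    with Suc show ?thesis unfolding val_Id_Suc_mem[OF assms(1) Suc.prems(1) assms(4)] by blast
  next
    case 2
    moreover from this have "\<forall>z\<in>Z. val_Id P \<nu> n X Y z \<in> G"
      using Suc.IH assms(2,4) unfolding nefs_def by blast
    ultimately show ?thesis
      using assms(2) unfolding val_Id_Suc_mem[OF assms(1) Suc.prems(1) assms(4)]
      by (intro disjI2 exI[of _ Z]) simp
  qed
qed simp

lemma val_Id_sound: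
  assumes G: "prime_filter G" and X: "X \<in> nefs (carr P)" and U: "U \<in> nefs (carr P)"
  shows "a \<in> carr P \<Longrightarrow> val_Id P \<nu> n X U a \<in> G \<Longrightarrow> a \<in> ideal_gen (quot P \<nu> G) X"
proof (induction n arbitrary: a)
  case 0
  then obtain x where "x \<in> X" "\<nu> a x \<in> G"
    using X by (auto simp: prime_filter_Sup_fin[OF G] nefs_def)
  moreover from this have "(a, x) \<in> le (quot P \<nu> G)"
    using 0 X by (auto simp: value_rel_def nefs_def)
  ultimately show ?case using ideal_gen.down[OF ideal_gen.base[of x X "quot P \<nu> G"]] by simp
next
  case (Suc n)
  then consider "val_Id P \<nu> n X U a \<in> G"
    | Z where "Z \<noteq> {}" "Z \<subseteq> U" "val_le_join P \<nu> a Z \<in> G" "\<forall>z\<in>Z. val_Id P \<nu> n X U z \<in> G"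
    unfolding val_Id_Suc_mem[OF G Suc.prems(1) U] by blast
  then show ?case
  proof cases
    case 1 with Suc show ?thesis by blast
  next
    case 2
    then have Z: "Z \<in> nefs (carr P)" using U finite_subset[of Z U] by (auto simp: nefs_def)
    \<comment> \<open>The join of \<open>Z\<close> may be undefined in \<open>P\<close>. It is
      replaced by the join of an equivalent \<open>Y\<close> in the domain, whose members enter the
      ideal by downward closure.\<close>
    obtain Y where Y: "Y \<in> dom (Join P)" "\<nu> a (the (Join P Y)) \<in> G" "val_set_eq \<nu> Z Y \<in> G"
      using 2(3) val_le_join_mem[OF G Suc.prems(1) Z] by blast
    have Y': "Y \<in> nefs (carr P)" "the (Join P Y) \<in> carr P" using dom_Join_nefs[OF Y(1)] by auto
    have "y \<in> ideal_gen (quot P \<nu> G) X" if "y \<in> Y" for y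
    proof -
      obtain z where z: "z \<in> Z" "val_eq \<nu> y z \<in> G"
        using Y(3) \<open>y \<in> Y\<close> val_set_eq_mem[OF G Z Y'(1)] by blast
      then have "z \<in> ideal_gen (quot P \<nu> G) X"
        using Suc.IH[of z] 2 Z by (auto simp: nefs_def)
      moreover have "(y, z) \<in> le (quot P \<nu> G)"
        using z \<open>y \<in> Y\<close> Z Y'(1) by (auto simp: val_eq_mem[OF G] value_rel_def nefs_def)
      ultimately show ?thesis by (rule ideal_gen.down)
    qed
    moreover have "Join (quot P \<nu> G) Y = Some (the (Join P Y))" using Y(1) by auto
    ultimately have "the (Join P Y) \<in> ideal_gen (quot P \<nu> G) X" by (meson ideal_gen.join)
    moreover have "(a, the (Join P Y)) \<in> le (quot P \<nu> G)"
      using Y(2) Y'(2) Suc.prems(1) by (simp add: value_rel_def)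
    ultimately show ?thesis by (rule ideal_gen.down)
  qed
qed

lemma val_Id_down:
  assumes G: "prime_filter G" and X: "X \<in> nefs (carr P)" and U: "U \<in> nefs (carr P)"
    and xy: "x \<in> carr P" "y \<in> carr P" "\<nu> x y \<in> G"
  shows "val_Id P \<nu> n X U y \<in> G \<Longrightarrow> val_Id P \<nu> n X U x \<in> G"
proof (induction n)
  case 0
  then obtain z where "z \<in> X" "\<nu> y z \<in> G"
    using X by (auto simp: prime_filter_Sup_fin[OF G] nefs_def)
  moreover from this have "\<nu> x z \<in> G" using value_trans[OF G xy(1,2) _ xy(3)] X by (auto simp: nefs_def)
  ultimately show ?case using X by (auto simp: prime_filter_Sup_fin[OF G] nefs_def)
next
  case (Suc n)
  have "val_le_join P \<nu> x Z \<in> G" if yZ: "val_le_join P \<nu> y Z \<in> G" "Z \<noteq> {}" "Z \<subseteq> U" for Z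
  proof -
    have Z: "Z \<in> nefs (carr P)" using yZ U finite_subset[of Z U] by (auto simp: nefs_def)
    obtain Y where Y: "Y \<in> dom (Join P)" "\<nu> y (the (Join P Y)) \<in> G" "val_set_eq \<nu> Z Y \<in> G"
      using yZ(1) val_le_join_mem[OF G xy(2) Z] by blast
    then have "\<nu> x (the (Join P Y)) \<in> G"
      using value_trans[OF G xy(1,2) _ xy(3)] dom_Join_nefs by blast
    with Y show ?thesis using val_le_join_mem[OF G xy(1) Z] by blast
  qed
  with Suc show ?case unfolding val_Id_Suc_mem[OF G xy(1) U] val_Id_Suc_mem[OF G xy(2) U] by blast
qed

text \<open>The condition \<open>Id_vee\<close> fixes \<open>U\<close> and \<open>n\<close> before
  \<open>G\<close> is chosen. Stage \<open>n\<close> is an ideal at every \<open>G\<close>, because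
  one further iteration adds nothing, even with a larger finite parameter.\<close>

lemma val_Id_ideal_gen:
  assumes X: "X \<in> nefs (carr P)"
  obtains U n where "U \<in> nefs (carr P)" "\<And>G a. prime_filter G \<Longrightarrow> a \<in> carr P \<Longrightarrow>
    val_Id P \<nu> n X U a \<in> G \<longleftrightarrow> a \<in> ideal_gen (quot P \<nu> G) X"
proof -
  obtain U n where U: "U \<in> nefs (carr P)" and stable:
    "\<And>a Y. a \<in> carr P \<Longrightarrow> finite Y \<Longrightarrow> U \<subseteq> Y \<Longrightarrow> Y \<subseteq> carr P \<Longrightarrow>
      val_Id P \<nu> n X U a = val_Id P \<nu> (Suc n) X Y a"
    using balanced X unfolding balanced_def Id_vee_def by metis
  have "val_Id P \<nu> n X U a \<in> G \<longleftrightarrow> a \<in> ideal_gen (quot P \<nu> G) X"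
    if G: "prime_filter G" and a: "a \<in> carr P" for G a
  proof
    let ?I = "{a \<in> carr P. val_Id P \<nu> n X U a \<in> G}"
    show "a \<in> ideal_gen (quot P \<nu> G) X" if "val_Id P \<nu> n X U a \<in> G"
      using val_Id_sound[OF G X U a that] .
    have "is_ideal (quot P \<nu> G) ?I" unfolding is_ideal_def
    proof (intro conjI allI impI)
      show "x \<in> ?I" if "y \<in> ?I" "(x, y) \<in> le (quot P \<nu> G)" for x y
        using that val_Id_down[OF G X U] by (auto simp: value_rel_def)
      show "c \<in> ?I" if Z: "Join (quot P \<nu> G) Z = Some c" "Z \<subseteq> ?I" for Z c
      proof -
        have "Z \<in> dom (Join P)" "c = the (Join P Z)" using Z(1) by auto
        then have Z': "Z \<in> nefs (carr P)" "c \<in> carr P" using dom_Join_nefs by auto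
        \<comment> \<open>A join with arguments outside \<open>U\<close> is reached by enlarging the
          parameter to \<open>U \<union> Z\<close>; stability then leads from stage
          \<open>Suc n\<close> back to stage \<open>n\<close> with \<open>U\<close>.\<close>
        have UZ: "U \<union> Z \<in> nefs (carr P)" using U Z'(1) by (auto simp: nefs_def)
        have "\<nu> c c \<in> G" "val_set_eq \<nu> Z Z \<in> G"
          using value_refl[OF G Z'(2)] val_set_eq_refl[OF G Z'(1)] by auto
        then have "val_le_join P \<nu> c Z \<in> G"
          using val_le_join_mem[OF G Z'(2,1)] \<open>Z \<in> dom (Join P)\<close> \<open>c = _\<close> by blast
        moreover have "\<forall>z\<in>Z. val_Id P \<nu> n X (U \<union> Z) z \<in> G"
          using Z(2) val_Id_mono[OF G _ _ UZ, of U] U by (auto simp: nefs_def)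
        ultimately have "val_Id P \<nu> (Suc n) X (U \<union> Z) c \<in> G"
          unfolding val_Id_Suc_mem[OF G Z'(2) UZ] using Z'(1) by (auto simp: nefs_def)
        then show ?thesis using stable[of c "U \<union> Z"] UZ Z'(2) by (simp add: nefs_def)
      qed
    qed simp
    moreover have "X \<subseteq> ?I"
    proof
      fix x assume x: "x \<in> X"
      then have "x \<in> carr P" "val_Id P \<nu> 0 X U x \<in> G"
        using X value_refl[OF G] by (auto simp: nefs_def prime_filter_Sup_fin[OF G])
      moreover from this(2) have "val_Id P \<nu> m X U x \<in> G" for m
        by (induction m) (simp_all add: prime_filter_mem[OF G])
      ultimately show "x \<in> ?I" by blast
    qed
    ultimately show "val_Id P \<nu> n X U a \<in> G" if "a \<in> ideal_gen (quot P \<nu> G) X"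
      using ideal_gen_least[of "quot P \<nu> G" ?I X] that by blast
  qed
  with U show thesis using that by blast
qed

end

text \<open>\<open>A G\<close> is the lower subset of \<open>quot P \<nu> G\<close> generated by all \<open>u\<close> with \<open>(u, e) \<in> S\<close> and
  \<open>e \<in> G\<close>, where the finite set \<open>S\<close> does not depend on \<open>G\<close>.\<close>

definition represents ::
  "'a partial_lat \<Rightarrow> ('a \<Rightarrow> 'a \<Rightarrow> 'e::{distrib_lattice, bounded_lattice_top}) \<Rightarrow>
    ('a \<times> 'e) set \<Rightarrow> ('e set \<Rightarrow> 'a set) \<Rightarrow> bool" where
  "represents P \<nu> S A \<longleftrightarrow> finite S \<and> S \<noteq> {} \<and> fst ` S \<subseteq> carr P \<and>
     (\<forall>G. prime_filter G \<longrightarrow> (\<forall>x\<in>carr P. x \<in> A G \<longleftrightarrow> (\<exists>(u, e)\<in>S. e \<in> G \<and> \<nu> x u \<in> G)))"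

definition representable ::
  "'a partial_lat \<Rightarrow> ('a \<Rightarrow> 'a \<Rightarrow> 'e::{distrib_lattice, bounded_lattice_top}) \<Rightarrow>
    ('e set \<Rightarrow> 'a set) \<Rightarrow> bool" where
  "representable P \<nu> A \<longleftrightarrow> (\<exists>S. represents P \<nu> S A)"

text \<open>Sets of prime filters of the form \<open>{G. e \<in> G}\<close> are the basic open sets
  of the prime spectrum; by \<open>prime_filter_ext\<close> the element \<open>e\<close> is
  unique.\<close>

definition has_value :: "('e::{distrib_lattice, bounded_lattice_top} set \<Rightarrow> bool) \<Rightarrow> bool" where
  "has_value B \<longleftrightarrow> (\<exists>e. \<forall>G. prime_filter G \<longrightarrow> (e \<in> G \<longleftrightarrow> B G))"

lemma has_value_mem: "has_value (\<lambda>G. e \<in> G)"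
  by (auto simp: has_value_def)

lemma has_value_cong:
  "has_value A \<Longrightarrow> (\<And>G. prime_filter G \<Longrightarrow> A G \<longleftrightarrow> B G) \<Longrightarrow> has_value B"
  by (simp add: has_value_def)

lemma has_value_conj:
  assumes "has_value A" "has_value B"
  shows "has_value (\<lambda>G. A G \<and> B G)"
proof -
  obtain a b where "\<forall>G. prime_filter G \<longrightarrow> (a \<in> G \<longleftrightarrow> A G)" "\<forall>G. prime_filter G \<longrightarrow> (b \<in> G \<longleftrightarrow> B G)"
    using assms by (auto simp: has_value_def)
  then show ?thesis
    unfolding has_value_def by (intro exI[of _ "inf a b"]) (simp add: prime_filter_mem)
qed

lemma has_value_disj:
  assumes "has_value A" "has_value B"
  shows "has_value (\<lambda>G. A G \<or> B G)"
proof -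
  obtain a b where "\<forall>G. prime_filter G \<longrightarrow> (a \<in> G \<longleftrightarrow> A G)" "\<forall>G. prime_filter G \<longrightarrow> (b \<in> G \<longleftrightarrow> B G)"
    using assms by (auto simp: has_value_def)
  then show ?thesis
    unfolding has_value_def by (intro exI[of _ "sup a b"]) (simp add: prime_filter_mem)
qed

lemma has_value_ball:
  assumes "finite I" "\<And>i. i \<in> I \<Longrightarrow> has_value (A i)"
  shows "has_value (\<lambda>G. \<forall>i\<in>I. A i G)"
  using assms
proof (induction I rule: finite_induct)
  case empty
  have "has_value (\<lambda>G. top \<in> G)" by (rule has_value_mem)
  then show ?case by (rule has_value_cong) (simp add: prime_filter_mem)
next
  case (insert i I)
  then have "has_value (\<lambda>G. A i G \<and> (\<forall>i\<in>I. A i G))" by (intro has_value_conj) auto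
  then show ?case by simp
qed

text \<open>The index set is nonempty since an empty disjunction has no value: it is false at the
  improper filter, which contains every \<open>e\<close>.\<close>

lemma has_value_bex:
  assumes "finite I" "I \<noteq> {}" "\<And>i. i \<in> I \<Longrightarrow> has_value (A i)"
  shows "has_value (\<lambda>G. \<exists>i\<in>I. A i G)"
  using assms
proof (induction I rule: finite_ne_induct)
  case (insert i I)
  then have "has_value (\<lambda>G. A i G \<or> (\<exists>i\<in>I. A i G))" by (intro has_value_disj) auto
  then show ?case by simp
qed simp

section \<open>Closure properties of representable families\<close>

context
  fixes P :: "'a partial_lat" and \<nu> :: "'a \<Rightarrow> 'a \<Rightarrow> 'e::{distrib_lattice, bounded_lattice_top}"
begin

lemma representable_cong:
  assumes "representable P \<nu> A"
    and "\<And>G x. prime_filter G \<Longrightarrow> x \<in> carr P \<Longrightarrow> x \<in> A G \<longleftrightarrow> x \<in> B G"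
  shows "representable P \<nu> B"
  using assms by (simp add: representable_def represents_def)

lemma representable_down: "u \<in> carr P \<Longrightarrow> representable P \<nu> (\<lambda>G. {x. \<nu> x u \<in> G})"
  unfolding representable_def represents_def
  by (intro exI[of _ "{(u, top)}"]) (auto simp: prime_filter_mem)

lemma representable_restrict:
  assumes "representable P \<nu> A" "has_value B"
  shows "representable P \<nu> (\<lambda>G. {x \<in> A G. B G})"
proof -
  obtain S where S: "represents P \<nu> S A" using assms by (auto simp: representable_def)
  obtain b where b: "\<And>G. prime_filter G \<Longrightarrow> b \<in> G \<longleftrightarrow> B G" using assms by (auto simp: has_value_def)
  \<comment> \<open>Meeting every coefficient with the value of \<open>B\<close> imposes the extra
    condition.\<close>
  have "represents P \<nu> ((\<lambda>(u, e). (u, inf b e)) ` S) (\<lambda>G. {x \<in> A G. B G})"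
    unfolding represents_def
  proof (intro conjI allI impI ballI)
    show "x \<in> {x \<in> A G. B G} \<longleftrightarrow> (\<exists>(u, e)\<in>(\<lambda>(u, e). (u, inf b e)) ` S. e \<in> G \<and> \<nu> x u \<in> G)"
      if "prime_filter G" "x \<in> carr P" for G x
    proof -
      have "x \<in> A G \<longleftrightarrow> (\<exists>(u, e)\<in>S. e \<in> G \<and> \<nu> x u \<in> G)"
        using S that unfolding represents_def by blast
      then show ?thesis using b[OF that(1)] by (auto simp: prime_filter_mem[OF that(1)] split_beta)
    qed
  qed (use S in \<open>auto simp: represents_def\<close>)
  then show ?thesis by (auto simp: representable_def)
qed

lemma representable_UN:
  assumes "finite I" "I \<noteq> {}" "\<And>i. i \<in> I \<Longrightarrow> representable P \<nu> (A i)"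
  shows "representable P \<nu> (\<lambda>G. \<Union>i\<in>I. A i G)"
proof -
  obtain S where S: "\<And>i. i \<in> I \<Longrightarrow> represents P \<nu> (S i) (A i)"
    using assms(3) unfolding representable_def by metis
  have "represents P \<nu> (\<Union>i\<in>I. S i) (\<lambda>G. \<Union>i\<in>I. A i G)"
    unfolding represents_def
  proof (intro conjI allI impI ballI)
    show "finite (\<Union>i\<in>I. S i)" using S assms(1) by (simp add: represents_def)
    show "(\<Union>i\<in>I. S i) \<noteq> {}" using S assms(2) by (auto simp: represents_def)
    show "fst ` (\<Union>i\<in>I. S i) \<subseteq> carr P" using S by (fastforce simp: represents_def)
    show "x \<in> (\<Union>i\<in>I. A i G) \<longleftrightarrow> (\<exists>(u, e)\<in>(\<Union>i\<in>I. S i). e \<in> G \<and> \<nu> x u \<in> G)"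
      if "prime_filter G" "x \<in> carr P" for G x
    proof -
      have "x \<in> A i G \<longleftrightarrow> (\<exists>(u, e)\<in>S i. e \<in> G \<and> \<nu> x u \<in> G)" if "i \<in> I" for i
        using S[OF that] \<open>prime_filter G\<close> \<open>x \<in> carr P\<close> unfolding represents_def by blast
      then show ?thesis by auto
    qed
  qed
  then show ?thesis by (auto simp: representable_def)
qed

lemma representable_has_value:
  assumes "representable P \<nu> A" "x \<in> carr P"
  shows "has_value (\<lambda>G. x \<in> A G)"
proof -
  obtain S where S: "represents P \<nu> S A" using assms by (auto simp: representable_def)
  then have "has_value (\<lambda>G. \<exists>s\<in>S. snd s \<in> G \<and> \<nu> x (fst s) \<in> G)"
    by (intro has_value_bex has_value_conj has_value_mem) (auto simp: represents_def)
  then show ?thesis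
    by (rule has_value_cong) (use S assms(2) in \<open>auto simp: represents_def split_beta\<close>)
qed

lemma representable_Un:
  assumes "representable P \<nu> A" "representable P \<nu> B"
  shows "representable P \<nu> (\<lambda>G. A G \<union> B G)"
proof -
  have "representable P \<nu> (\<lambda>G. \<Union>i\<in>{True, False}. (if i then A else B) G)"
    using assms by (intro representable_UN) auto
  then show ?thesis by simp
qed

end

section \<open>Representing term ideals and evaluating derivability\<close>

context balanced_comeasured
begin

text \<open>By \<open>Id_cap\<close> two principal lower sets meet in a finite union of principal
  ones, whose generators depend neither on \<open>G\<close> nor on \<open>x\<close>. This is applied
  to each pair from the two representing sets.\<close>

lemma representable_Int:
  assumes "representable P \<nu> A" "representable P \<nu> B"
  shows "representable P \<nu> (\<lambda>G. A G \<inter> B G)"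
proof -
  obtain S T where S: "represents P \<nu> S A" and T: "represents P \<nu> T B"
    using assms by (auto simp: representable_def)
  have ST: "fst s \<in> carr P" "fst t \<in> carr P" if "s \<in> S" "t \<in> T" for s t
    using that S T by (auto simp: represents_def)
  define good where "good a b V \<longleftrightarrow> V \<in> nefs (carr P) \<and> (\<forall>x\<in>carr P. inf (\<nu> x a) (\<nu> x b) =
    Sup_fin ((\<lambda>u. inf (\<nu> x u) (inf (\<nu> u a) (\<nu> u b))) ` V))" for a b V
  define U where "U a b = (SOME V. good a b V)" for a b
  have good: "good a b (U a b)" if "a \<in> carr P" "b \<in> carr P" for a b
  proof -
    have "\<exists>V. good a b V" using balanced that unfolding balanced_def Id_cap_def good_def by blast
    then show ?thesis unfolding U_def by (rule someI_ex)
  qed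
  have U: "U a b \<in> nefs (carr P)" if "a \<in> carr P" "b \<in> carr P" for a b
    using good[OF that] by (simp add: good_def)
  have eq: "inf (\<nu> x a) (\<nu> x b) = Sup_fin ((\<lambda>u. inf (\<nu> x u) (inf (\<nu> u a) (\<nu> u b))) ` U a b)"
    if "a \<in> carr P" "b \<in> carr P" "x \<in> carr P" for a b x
    using good[OF that(1,2)] that(3) by (simp add: good_def)
  have mem: "\<nu> x a \<in> G \<and> \<nu> x b \<in> G \<longleftrightarrow> (\<exists>u\<in>U a b. \<nu> x u \<in> G \<and> \<nu> u a \<in> G \<and> \<nu> u b \<in> G)"
    if "prime_filter G" "a \<in> carr P" "b \<in> carr P" "x \<in> carr P" for G a b x
  proof -
    have "\<nu> x a \<in> G \<and> \<nu> x b \<in> G \<longleftrightarrow> inf (\<nu> x a) (\<nu> x b) \<in> G"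
      by (simp add: prime_filter_mem[OF that(1)])
    also have "\<dots> \<longleftrightarrow> (\<exists>u\<in>U a b. \<nu> x u \<in> G \<and> \<nu> u a \<in> G \<and> \<nu> u b \<in> G)"
      using U[OF that(2,3)] unfolding eq[OF that(2-4)]
      by (simp add: nefs_def prime_filter_Sup_fin[OF that(1)] prime_filter_mem[OF that(1)])
    finally show ?thesis .
  qed
  have UST: "U (fst (fst st)) (fst (snd st)) \<in> nefs (carr P)" if "st \<in> S \<times> T" for st
    using U[OF ST] that by auto
  have "representable P \<nu> (\<lambda>G. \<Union>(s, t)\<in>S \<times> T. \<Union>u\<in>U (fst s) (fst t).
      {x \<in> {x. \<nu> x u \<in> G}. (snd s \<in> G \<and> snd t \<in> G) \<and> \<nu> u (fst s) \<in> G \<and> \<nu> u (fst t) \<in> G})"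
    unfolding split_beta
  proof (intro representable_UN representable_restrict has_value_conj has_value_mem representable_down)
    show "finite (S \<times> T)" "S \<times> T \<noteq> {}" using S T by (auto simp: represents_def)
    show "finite (U (fst (fst st)) (fst (snd st)))" "U (fst (fst st)) (fst (snd st)) \<noteq> {}"
      if "st \<in> S \<times> T" for st
      using UST[OF that] by (auto simp: nefs_def)
    show "u \<in> carr P" if "st \<in> S \<times> T" "u \<in> U (fst (fst st)) (fst (snd st))" for st u
      using UST[OF that(1)] that(2) by (auto simp: nefs_def)
  qed
  then show ?thesis
  proof (rule representable_cong)
    fix G :: "'e set" and x assume G: "prime_filter G" and x: "x \<in> carr P"
    have "x \<in> A G \<longleftrightarrow> (\<exists>s\<in>S. snd s \<in> G \<and> \<nu> x (fst s) \<in> G)"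
      "x \<in> B G \<longleftrightarrow> (\<exists>t\<in>T. snd t \<in> G \<and> \<nu> x (fst t) \<in> G)"
      using S T G x by (auto simp: represents_def split_beta)
    then have "x \<in> A G \<inter> B G \<longleftrightarrow>
        (\<exists>s\<in>S. \<exists>t\<in>T. (snd s \<in> G \<and> snd t \<in> G) \<and> \<nu> x (fst s) \<in> G \<and> \<nu> x (fst t) \<in> G)" by blast
    also have "\<dots> \<longleftrightarrow> (\<exists>s\<in>S. \<exists>t\<in>T. (snd s \<in> G \<and> snd t \<in> G) \<and>
        (\<exists>u\<in>U (fst s) (fst t). \<nu> x u \<in> G \<and> \<nu> u (fst s) \<in> G \<and> \<nu> u (fst t) \<in> G))"
      using mem[OF G _ _ x] ST by simp
    also have "\<dots> \<longleftrightarrow> x \<in> (\<Union>(s, t)\<in>S \<times> T. \<Union>u\<in>U (fst s) (fst t).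
      {x \<in> {x. \<nu> x u \<in> G}. (snd s \<in> G \<and> snd t \<in> G) \<and> \<nu> u (fst s) \<in> G \<and> \<nu> u (fst t) \<in> G})"
      by auto
    finally show "x \<in> (\<Union>(s, t)\<in>S \<times> T. \<Union>u\<in>U (fst s) (fst t).
      {x \<in> {x. \<nu> x u \<in> G}. (snd s \<in> G \<and> snd t \<in> G) \<and> \<nu> u (fst s) \<in> G \<and> \<nu> u (fst t) \<in> G}) \<longleftrightarrow>
      x \<in> A G \<inter> B G" by simp
  qed
qed

text \<open>A join-sample serves as the set of generators, with the values
  \<open>\<parallel>u = \<Or>X\<parallel>\<close> as coefficients.\<close>

lemma representable_val_le_join:
  assumes "X \<in> nefs (carr P)"
  shows "representable P \<nu> (\<lambda>G. {a. val_le_join P \<nu> a X \<in> G})"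
proof -
  obtain U where "is_join_sample P \<nu> X U" and
    U: "\<And>a. val_le_join P \<nu> a X = Sup_fin ((\<lambda>u. inf (\<nu> a u) (val_eq_join P \<nu> u X)) ` U)"
    using val_le_join_sample[OF assms] by metis
  then have U': "finite U" "U \<noteq> {}" "U \<subseteq> carr P" by (auto simp: is_join_sample_def nefs_def)
  have "representable P \<nu> (\<lambda>G. \<Union>u\<in>U. {x \<in> {x. \<nu> x u \<in> G}. val_eq_join P \<nu> u X \<in> G})"
    using U' by (intro representable_UN representable_restrict representable_down has_value_mem) auto
  then show ?thesis
    by (rule representable_cong)
      (simp add: U prime_filter_Sup_fin[OF _ finite_imageI[OF U'(1)]] U'(2) prime_filter_mem)
qed

lemma representable_val_Id:
  assumes X: "X \<in> nefs (carr P)" and U: "U \<in> nefs (carr P)"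
  shows "representable P \<nu> (\<lambda>G. {a. val_Id P \<nu> n X U a \<in> G})"
proof (induction n)
  case 0
  have "representable P \<nu> (\<lambda>G. \<Union>x\<in>X. {a. \<nu> a x \<in> G})"
    using X by (intro representable_UN representable_down) (auto simp: nefs_def)
  then show ?case
    using X by (rule_tac representable_cong) (auto simp: nefs_def prime_filter_Sup_fin)
next
  case (Suc n)
  let ?Z = "{Z. Z \<noteq> {} \<and> Z \<subseteq> U}"
  have Z: "Z \<in> nefs (carr P)" if "Z \<in> ?Z" for Z
    using that U finite_subset[of Z U] by (auto simp: nefs_def)
  have "representable P \<nu> (\<lambda>G. {a. val_Id P \<nu> n X U a \<in> G} \<union>
      (\<Union>Z\<in>?Z. {a \<in> {a. val_le_join P \<nu> a Z \<in> G}. \<forall>z\<in>Z. val_Id P \<nu> n X U z \<in> G}))"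
  proof (intro representable_Un representable_UN representable_restrict has_value_ball has_value_mem
      representable_val_le_join Suc.IH)
    show "finite ?Z" "?Z \<noteq> {}" using U by (auto simp: nefs_def)
    show "Z \<in> nefs (carr P)" "finite Z" if "Z \<in> ?Z" for Z using Z[OF that] by (auto simp: nefs_def)
  qed
  then show ?case
  proof (rule representable_cong)
    fix G :: "'e set" and a assume "prime_filter G" "a \<in> carr P"
    show "a \<in> {a. val_Id P \<nu> n X U a \<in> G} \<union>
      (\<Union>Z\<in>?Z. {a \<in> {a. val_le_join P \<nu> a Z \<in> G}. \<forall>z\<in>Z. val_Id P \<nu> n X U z \<in> G}) \<longleftrightarrow>
      a \<in> {a. val_Id P \<nu> (Suc n) X U a \<in> G}"
      unfolding mem_Collect_eq val_Id_Suc_mem[OF \<open>prime_filter G\<close> \<open>a \<in> carr P\<close> U] by auto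
  qed
qed

lemma representable_ideal_gen:
  assumes "X \<in> nefs (carr P)"
  shows "representable P \<nu> (\<lambda>G. ideal_gen (quot P \<nu> G) X)"
proof -
  obtain U n where U: "U \<in> nefs (carr P)" "\<And>G a. prime_filter G \<Longrightarrow> a \<in> carr P \<Longrightarrow>
    val_Id P \<nu> n X U a \<in> G \<longleftrightarrow> a \<in> ideal_gen (quot P \<nu> G) X"
    using val_Id_ideal_gen[OF assms] by metis
  show ?thesis
    using representable_val_Id[OF assms U(1), of n] by (rule representable_cong) (simp add: U(2))
qed

text \<open>The generating set varies with \<open>G\<close>, but only through which of the finitely
  many coefficients lie in \<open>G\<close>. Hence the ideal is a union over the nonempty
  \<open>T \<subseteq> S\<close>, each restricted to those \<open>G\<close> that contain all
  coefficients of \<open>T\<close>.\<close>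

lemma representable_ideal_gen_family:
  assumes "representable P \<nu> A"
    and sub: "\<And>G. prime_filter G \<Longrightarrow> A G \<subseteq> carr P"
  shows "representable P \<nu> (\<lambda>G. ideal_gen (quot P \<nu> G) (A G))"
proof -
  obtain S where S: "represents P \<nu> S A" using assms(1) by (auto simp: representable_def)
  then have fin: "finite S" "S \<noteq> {}" "fst ` S \<subseteq> carr P"
    and A: "\<And>G x. prime_filter G \<Longrightarrow> x \<in> carr P \<Longrightarrow> x \<in> A G \<longleftrightarrow> (\<exists>s\<in>S. snd s \<in> G \<and> \<nu> x (fst s) \<in> G)"
    by (auto simp: represents_def split_beta)
  let ?T = "{T. T \<noteq> {} \<and> T \<subseteq> S}"
  have "representable P \<nu> (\<lambda>G. \<Union>T\<in>?T. {x \<in> ideal_gen (quot P \<nu> G) (fst ` T). \<forall>s\<in>T. snd s \<in> G})"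
  proof (intro representable_UN representable_restrict representable_ideal_gen has_value_ball has_value_mem)
    show "finite ?T" "?T \<noteq> {}" using fin by auto
    show "fst ` T \<in> nefs (carr P)" "finite T" if "T \<in> ?T" for T
      using that fin finite_subset[of T S] by (auto simp: nefs_def)
  qed
  then show ?thesis
  proof (rule representable_cong)
    fix G :: "'e set" and x assume G: "prime_filter G" and x: "x \<in> carr P"
    have A_ideal: "ideal_gen (quot P \<nu> G) (A G) \<subseteq> carr P"
      using is_ideal_ideal_gen[OF prelattice_quot[OF G]] sub[OF G] by (simp add: is_ideal_def)
    show "x \<in> (\<Union>T\<in>?T. {x \<in> ideal_gen (quot P \<nu> G) (fst ` T). \<forall>s\<in>T. snd s \<in> G}) \<longleftrightarrow>
      x \<in> ideal_gen (quot P \<nu> G) (A G)"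
    proof
      assume "x \<in> (\<Union>T\<in>?T. {x \<in> ideal_gen (quot P \<nu> G) (fst ` T). \<forall>s\<in>T. snd s \<in> G})"
      then obtain T where T: "T \<subseteq> S" "x \<in> ideal_gen (quot P \<nu> G) (fst ` T)" "\<forall>s\<in>T. snd s \<in> G"
        by blast
      have "fst ` T \<subseteq> A G"
      proof
        fix u assume "u \<in> fst ` T"
        then obtain s where "s \<in> T" "u = fst s" by blast
        moreover from this have "u \<in> carr P" using T(1) fin(3) by blast
        ultimately show "u \<in> A G" using T A[OF G, of u] value_refl[OF G, of u] by blast
      qed
      then have "fst ` T \<subseteq> ideal_gen (quot P \<nu> G) (A G)" by (rule order.trans) (rule subset_ideal_gen)
      moreover have "is_ideal (quot P \<nu> G) (ideal_gen (quot P \<nu> G) (A G))"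
        using sub[OF G] by (intro is_ideal_ideal_gen prelattice_quot[OF G]) simp
      ultimately show "x \<in> ideal_gen (quot P \<nu> G) (A G)" 
        using T(2) ideal_gen_least subsetD by metis
    next
      assume xA: "x \<in> ideal_gen (quot P \<nu> G) (A G)"
      \<comment> \<open>The largest subset of \<open>S\<close> that is active at \<open>G\<close>;
        its generators already generate all of \<open>A G\<close>.\<close>
      define T where "T = {s \<in> S. snd s \<in> G}"
      have "fst ` T \<subseteq> carr P" using fin(3) by (auto simp: T_def)
      then have I: "is_ideal (quot P \<nu> G) (ideal_gen (quot P \<nu> G) (fst ` T))"
        by (intro is_ideal_ideal_gen prelattice_quot[OF G]) simp
      have "A G \<subseteq> ideal_gen (quot P \<nu> G) (fst ` T)"
      proof
        fix y assume y: "y \<in> A G"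
        then have yc: "y \<in> carr P" using sub[OF G] by blast
        then obtain s where s: "s \<in> T" "\<nu> y (fst s) \<in> G" using A[OF G] y by (auto simp: T_def)
        then have "(y, fst s) \<in> le (quot P \<nu> G)"
          using yc \<open>fst ` T \<subseteq> carr P\<close> by (auto simp: value_rel_def)
        moreover have "fst s \<in> ideal_gen (quot P \<nu> G) (fst ` T)" using s(1) by (intro ideal_gen.base) blast
        ultimately show "y \<in> ideal_gen (quot P \<nu> G) (fst ` T)" by (rule ideal_gen.down[rotated])
      qed
      then have xT: "x \<in> ideal_gen (quot P \<nu> G) (fst ` T)" using xA ideal_gen_least[OF I] by blast
      \<comment> \<open>No generators give the empty ideal, as joins have nonempty arguments,
        whereas \<open>x\<close> is in the ideal.\<close>
      moreover have "T \<noteq> {}"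
      proof
        assume "T = {}"
        have "is_ideal (quot P \<nu> G) {}"
          using partial_prelattice_Join(1)[OF prelattice_quot[OF G]] by (auto simp: is_ideal_def)
        then show False using ideal_gen_least[of "quot P \<nu> G" "{}" "{}"] xT \<open>T = {}\<close> by auto
      qed
      moreover have "T \<subseteq> S" "\<forall>s\<in>T. snd s \<in> G" by (auto simp: T_def)
      ultimately show "x \<in> (\<Union>T\<in>?T. {x \<in> ideal_gen (quot P \<nu> G) (fst ` T). \<forall>s\<in>T. snd s \<in> G})"
        by blast
    qed
  qed
qed

lemma term_ideal_quot_subset: "prime_filter G \<Longrightarrow> term_ideal (quot P \<nu> G) t \<subseteq> carr P"
  using is_ideal_term_ideal[OF prelattice_quot] by (simp add: is_ideal_def)

text \<open>Principal lower sets are representable, joins are handled through \<open>Id_vee\<close>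
  and meets through \<open>Id_cap\<close>.\<close>

lemma representable_term_ideal:
  "t \<in> lterms P \<Longrightarrow> representable P \<nu> (\<lambda>G. term_ideal (quot P \<nu> G) t)"
proof (induction t)
  case (Gen y)
  then have "representable P \<nu> (\<lambda>G. {x. \<nu> x y \<in> G})" by (simp add: representable_down)
  then show ?case by (rule representable_cong) (use Gen in \<open>simp add: value_rel_def\<close>)
next
  case (TJoin s t)
  then show ?case
    using representable_ideal_gen_family[OF representable_Un] term_ideal_quot_subset by simp
next
  case (TMeet s t)
  then show ?case using representable_Int by simp
qed

lemma has_value_term_ideal:
  "t \<in> lterms P \<Longrightarrow> x \<in> carr P \<Longrightarrow> has_value (\<lambda>G. x \<in> term_ideal (quot P \<nu> G) t)"
  using representable_has_value[OF representable_term_ideal] .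

lemma term_filter_eq_flip:
  "term_filter (quot P \<nu> G) t = term_ideal (quot (flip_pl P) (\<lambda>x y. \<nu> y x) G) (flip_lterm t)"
  by (simp add: quot_flip_pl term_ideal_flip)

lemma flip_lterm_lterms: "t \<in> lterms P \<Longrightarrow> flip_lterm t \<in> lterms (flip_pl P)"
  by (simp add: lterms_def)

lemma has_value_term_filter:
  assumes "t \<in> lterms P" "x \<in> carr P"
  shows "has_value (\<lambda>G. x \<in> term_filter (quot P \<nu> G) t)"
  unfolding term_filter_eq_flip
  using balanced_comeasured.has_value_term_ideal[OF flip flip_lterm_lterms[OF assms(1)], of x] assms(2) by simp

text \<open>An interpolant can be raised to one of the finitely many generators representing the
  ideal of \<open>t\<close>, since the filter of \<open>s\<close> is closed upwards. The search over
  all of \<open>P\<close> thus becomes a finite disjunction.\<close>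

lemma has_value_interpolant:
  assumes "s \<in> lterms P" "t \<in> lterms P"
  shows "has_value (\<lambda>G. \<exists>z. z \<in> term_filter (quot P \<nu> G) s \<and> z \<in> term_ideal (quot P \<nu> G) t)"
proof -
  obtain S where S: "represents P \<nu> S (\<lambda>G. term_ideal (quot P \<nu> G) t)"
    using representable_term_ideal[OF assms(2)] by (auto simp: representable_def)
  then have "has_value (\<lambda>G. \<exists>p\<in>S. snd p \<in> G \<and> fst p \<in> term_filter (quot P \<nu> G) s)"
    by (intro has_value_bex has_value_conj has_value_mem has_value_term_filter assms)
      (auto simp: represents_def)
  then show ?thesis
  proof (rule has_value_cong)
    fix G :: "'e set" assume G: "prime_filter G"
    have I: "x \<in> term_ideal (quot P \<nu> G) t \<longleftrightarrow> (\<exists>p\<in>S. snd p \<in> G \<and> \<nu> x (fst p) \<in> G)"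
      if "x \<in> carr P" for x using S G that by (auto simp: represents_def split_beta)
    have S': "fst p \<in> carr P" if "p \<in> S" for p using S that by (auto simp: represents_def)
    show "(\<exists>p\<in>S. snd p \<in> G \<and> fst p \<in> term_filter (quot P \<nu> G) s) \<longleftrightarrow>
      (\<exists>z. z \<in> term_filter (quot P \<nu> G) s \<and> z \<in> term_ideal (quot P \<nu> G) t)"
    proof
      assume "\<exists>p\<in>S. snd p \<in> G \<and> fst p \<in> term_filter (quot P \<nu> G) s"
      then obtain p where p: "p \<in> S" "snd p \<in> G" "fst p \<in> term_filter (quot P \<nu> G) s" by blast
      then have "fst p \<in> term_ideal (quot P \<nu> G) t"
        using I[of "fst p"] S' value_refl[OF G, of "fst p"] by blast
      with p show "\<exists>z. z \<in> term_filter (quot P \<nu> G) s \<and> z \<in> term_ideal (quot P \<nu> G) t" by blast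
    next
      assume "\<exists>z. z \<in> term_filter (quot P \<nu> G) s \<and> z \<in> term_ideal (quot P \<nu> G) t"
      then obtain z where z: "z \<in> term_filter (quot P \<nu> G) s" "z \<in> term_ideal (quot P \<nu> G) t" by blast
      then have zc: "z \<in> carr P" using term_ideal_quot_subset[OF G] by blast
      then obtain p where p: "p \<in> S" "snd p \<in> G" "\<nu> z (fst p) \<in> G" using I z(2) by blast
      have "is_ideal (flip_pl (quot P \<nu> G)) (term_filter (quot P \<nu> G) s)"
        using is_ideal_term_ideal[of "flip_pl (quot P \<nu> G)" "flip_lterm s"] prelattice_quot[OF G]
        by (simp add: term_ideal_flip)
      moreover have "(fst p, z) \<in> le (flip_pl (quot P \<nu> G))"
        using p S' zc by (simp add: value_rel_def)
      ultimately have "fst p \<in> term_filter (quot P \<nu> G) s"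
        using z(1) unfolding is_ideal_def by blast
      with p show "\<exists>p\<in>S. snd p \<in> G \<and> fst p \<in> term_filter (quot P \<nu> G) s" by blast
    qed
  qed
qed

text \<open>For each pair of shapes derivability is equivalent, at every \<open>G\<close> alike, to
  a finite combination of derivability for smaller terms and of ideal, filter and interpolant
  conditions, all of which have values.\<close>

lemma has_value_whitman_le:
  "s \<in> lterms P \<Longrightarrow> t \<in> lterms P \<Longrightarrow> has_value (\<lambda>G. whitman_le (quot P \<nu> G) s t)"
proof (induction "size s + size t" arbitrary: s t rule: less_induct)
  case less
  note s = less.prems(1) and t = less.prems(2) and IH = less.hyps
  note Q = prelattice_quot
  \<comment> \<open>The cases overlap but are exhaustive: without a generator, a join on the left or
    a meet on the right, only a meet below a join is left.\<close>
  consider (gen_left) x where "s = Gen x" | (gen_right) x where "t = Gen x"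
    | (join_left) s1 s2 where "s = TJoin s1 s2" | (meet_right) t1 t2 where "t = TMeet t1 t2"
    | (meet_join) s1 s2 t1 t2 where "s = TMeet s1 s2" "t = TJoin t1 t2"
    by (cases s; cases t) auto
  then show ?case
  proof cases
    case gen_left
    show ?thesis
      by (rule has_value_cong[OF has_value_term_ideal[OF t, of x]])
        (use s gen_left in \<open>simp_all add: whitman_le_Gen_left[OF Q]\<close>)
  next
    case gen_right
    show ?thesis
      by (rule has_value_cong[OF has_value_term_filter[OF s, of x]])
        (use t gen_right in \<open>simp_all add: whitman_le_Gen_right[OF Q]\<close>)
  next
    case join_left
    have "has_value (\<lambda>G. whitman_le (quot P \<nu> G) s1 t \<and> whitman_le (quot P \<nu> G) s2 t)"
      using s t join_left by (intro has_value_conj IH) auto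
    then show ?thesis
      by (rule has_value_cong) (use s join_left in \<open>simp add: whitman_le_join_left[OF Q]\<close>)
  next
    case meet_right
    have "has_value (\<lambda>G. whitman_le (quot P \<nu> G) s t1 \<and> whitman_le (quot P \<nu> G) s t2)"
      using s t meet_right by (intro has_value_conj IH) auto
    then show ?thesis
      by (rule has_value_cong) (use t meet_right in \<open>simp add: whitman_le_meet_right[OF Q]\<close>)
  next
    case meet_join
    show ?thesis
      unfolding meet_join whitman_le_meet_join
      by (intro has_value_disj IH has_value_interpolant) (use s t meet_join in auto)
  qed
qed

end

section \<open>Extending the measure to the free lattice\<close>

context
  fixes P :: "'a partial_lat"
    and \<phi> :: "('a \<times> 'a) set \<Rightarrow> 'd::{distrib_lattice, bounded_lattice_bot}"
  assumes P: "partial_prelattice P" and \<phi>: "Con_c_hom P \<phi>"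
begin

lemma Con_c_hom_join: "\<alpha> \<in> Con_c P \<Longrightarrow> \<beta> \<in> Con_c P \<Longrightarrow> \<phi> (cong_join P \<alpha> \<beta>) = sup (\<phi> \<alpha>) (\<phi> \<beta>)"
  using \<phi> unfolding Con_c_hom_def by blast

lemma Con_c_hom_mono:
  assumes "\<alpha> \<in> Con_c P" "\<beta> \<in> Con_c P" "\<alpha> \<subseteq> \<beta>"
  shows "\<phi> \<alpha> \<le> \<phi> \<beta>"
proof -
  have "\<alpha> \<union> \<beta> = \<beta>" using assms(3) by blast
  then have "cong_join P \<alpha> \<beta> = \<beta>"
    using assms(2) by (simp add: cong_join_def cong_gen_congruence[OF P] Con_c_def)
  then have "\<phi> \<beta> = sup (\<phi> \<alpha>) (\<phi> \<beta>)" using Con_c_hom_join[OF assms(1,2)] by simp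
  then show ?thesis by (metis sup_ge1)
qed

text \<open>A union of generators becomes a join in \<open>D\<close>, that is, a meet in the dual
  lattice, under which \<open>G\<close> is closed.\<close>

lemma comeasure_generators:
  assumes "prime_filter G" "finite R" "R \<subseteq> carr P \<times> carr P" "\<forall>(x, y)\<in>R. comeasure P \<phi> x y \<in> G"
  shows "dual (\<phi> (cong_gen P R)) \<in> G"
  using assms(2-4)
proof (induction R rule: finite_induct)
  case empty
  then show ?case
    using \<phi> prime_filter_mem(1)[OF assms(1)] unfolding cong_gen_empty[OF P] Con_c_hom_def by simp
next
  case (insert p R)
  have "cong_gen P {p} \<in> Con_c P" "cong_gen P R \<in> Con_c P"
    using insert by (auto intro!: cong_gen_in_Con_c[OF P])
  then have "\<phi> (cong_gen P (insert p R)) = sup (\<phi> (cong_gen P {p})) (\<phi> (cong_gen P R))"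
    using cong_gen_Un[OF P, of "{p}" R] insert.prems(1) Con_c_hom_join by simp
  moreover have "dual (\<phi> (cong_gen P {p})) \<in> G"
    using insert.prems(2) by (cases p) (simp add: comeasure_def Theta_plus_def)
  ultimately show ?case
    using insert by (simp add: prime_filter_mem[OF assms(1)])
qed

text \<open>One direction needs only finitely many generators; the other is monotonicity of
  \<open>\<phi>\<close>, which duality reverses. The measure is thus recovered from the congruences
  attached to prime filters.\<close>

lemma comeasure_mem_iff:
  assumes G: "prime_filter G" and \<alpha>: "\<alpha> \<in> Con_c P"
  shows "dual (\<phi> \<alpha>) \<in> G \<longleftrightarrow> (\<forall>(x, y)\<in>\<alpha>. comeasure P \<phi> x y \<in> G)"
proof
  obtain R where R: "finite R" "R \<subseteq> \<alpha>" "\<alpha> = cong_gen P R"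
    using Con_c_finitely_generated[OF P \<alpha>] .
  have cong: "congruence P \<alpha>" using \<alpha> by (simp add: Con_c_def)
  have sub: "\<alpha> \<subseteq> carr P \<times> carr P" using congruence_subset[OF P cong] .
  show "dual (\<phi> \<alpha>) \<in> G" if "\<forall>(x, y)\<in>\<alpha>. comeasure P \<phi> x y \<in> G"
    using comeasure_generators[OF G R(1)] R(2,3) sub that by blast
  show "\<forall>(x, y)\<in>\<alpha>. comeasure P \<phi> x y \<in> G" if "dual (\<phi> \<alpha>) \<in> G"
  proof clarify
    fix x y assume xy: "(x, y) \<in> \<alpha>"
    then have "Theta_plus P x y \<subseteq> \<alpha>"
      unfolding Theta_plus_def by (intro cong_gen_least[OF P cong]) simp
    moreover have "Theta_plus P x y \<in> Con_c P"
      unfolding Theta_plus_def using xy sub by (intro cong_gen_in_Con_c[OF P]) auto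
    ultimately have "\<phi> (Theta_plus P x y) \<le> \<phi> \<alpha>" using Con_c_hom_mono \<alpha> by blast
    then have "dual (\<phi> \<alpha>) \<le> comeasure P \<phi> x y" by (simp add: comeasure_def)
    with that show "comeasure P \<phi> x y \<in> G" using prime_filter_mono[OF G] by blast
  qed
qed

lemma comeasure_cong_gen:
  assumes G: "prime_filter G" and R: "finite R" "R \<subseteq> value_rel P (comeasure P \<phi>) G"
  shows "cong_gen P R \<subseteq> value_rel P (comeasure P \<phi>) G"
proof -
  have sub: "R \<subseteq> carr P \<times> carr P" using R(2) by (auto simp: value_rel_def)
  have "dual (\<phi> (cong_gen P R)) \<in> G"
    using comeasure_generators[OF G R(1) sub] R(2) by (auto simp: value_rel_def)
  then have "\<forall>(x, y)\<in>cong_gen P R. comeasure P \<phi> x y \<in> G"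
    using comeasure_mem_iff[OF G cong_gen_in_Con_c[OF P R(1) sub]] by blast
  moreover have "cong_gen P R \<subseteq> carr P \<times> carr P"
    by (rule congruence_subset[OF P congruence_cong_gen[OF P sub]])
  ultimately show ?thesis by (auto simp: value_rel_def)
qed

text \<open>Every closure condition has finitely many premises, so its conclusion already lies in a
  finitely generated congruence, and \<open>comeasure_cong_gen\<close> keeps that inside the
  relation.\<close>

lemma congruence_value_rel_comeasure:
  assumes G: "prime_filter G"
  shows "congruence P (value_rel P (comeasure P \<phi>) G)" (is "congruence P ?r")
proof -
  note gen = comeasure_cong_gen[OF G]
  have sub: "?r \<subseteq> carr P \<times> carr P" by (auto simp: value_rel_def)
  have cong: "congruence P (cong_gen P R)" if "R \<subseteq> ?r" for R
    using that sub by (intro congruence_cong_gen[OF P]) blast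
  have "le P \<subseteq> ?r" using gen[of "{}"] by (simp add: cong_gen_empty[OF P])
  moreover have "trans ?r"
  proof (rule transI)
    fix x y z assume *: "(x, y) \<in> ?r" "(y, z) \<in> ?r"
    let ?R = "{(x, y), (y, z)}"
    have "(x, z) \<in> cong_gen P ?R"
      using congruenceD(3)[OF P cong, of ?R x y z] * subset_cong_gen[OF P, of ?R] by simp
    with * show "(x, z) \<in> ?r" using gen[of ?R] by auto
  qed
  moreover have "(a, b) \<in> ?r"
    if X: "Join P X = Some a" "b \<in> carr P" "\<forall>x\<in>X. (x, b) \<in> ?r" for X a b
  proof -
    let ?R = "(\<lambda>x. (x, b)) ` X"
    have R: "?R \<subseteq> ?r" "finite ?R"
      using X partial_prelattice_Join(2)[OF P X(1)] by auto
    have "(a, b) \<in> cong_gen P ?R"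
      using congruenceD(4)[OF P cong[OF R(1)] X(1,2)] subset_cong_gen[OF P, of ?R] by auto
    with R show ?thesis using gen[of ?R] by auto
  qed
  moreover have "(b, a) \<in> ?r"
    if X: "Meet P X = Some a" "b \<in> carr P" "\<forall>x\<in>X. (b, x) \<in> ?r" for X a b
  proof -
    let ?R = "(\<lambda>x. (b, x)) ` X"
    have R: "?R \<subseteq> ?r" "finite ?R"
      using X partial_prelattice_Join(2)[of "flip_pl P" X a] P by auto
    have "(b, a) \<in> cong_gen P ?R"
      using congruenceD(5)[OF P cong[OF R(1)] X(1,2)] subset_cong_gen[OF P, of ?R] by auto
    with R show ?thesis using gen[of ?R] by auto
  qed
  ultimately show ?thesis using sub unfolding congruence_iff[OF P] by blast
qed

end

section \<open>Transport of congruences along a homomorphism\<close>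

lemma congruence_vimage:
  assumes P: "partial_prelattice P" and Q: "partial_prelattice Q" and f: "pl_hom P Q f"
    and r: "congruence Q r"
  shows "congruence P {(x, y). x \<in> carr P \<and> y \<in> carr P \<and> (f x, f y) \<in> r}" (is "congruence P ?r")
proof -
  note rD = congruenceD[OF Q r]
  have f': "\<And>x. x \<in> carr P \<Longrightarrow> f x \<in> carr Q" "\<And>x y. (x, y) \<in> le P \<Longrightarrow> (f x, f y) \<in> le Q"
    "\<And>X a. Join P X = Some a \<Longrightarrow> Join Q (f ` X) = Some (f a)"
    "\<And>X a. Meet P X = Some a \<Longrightarrow> Meet Q (f ` X) = Some (f a)"
    using f by (auto simp: pl_hom_def)
  have "le P \<subseteq> ?r" using partial_prelatticeD(1)[OF P] f'(2) rD(1) by auto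
  moreover have "?r \<subseteq> carr P \<times> carr P" by auto
  moreover have "trans ?r" using rD(3) by (intro transI) blast
  moreover have "(a, b) \<in> ?r"
    if "Join P X = Some a" "b \<in> carr P" "\<forall>x\<in>X. (x, b) \<in> ?r" for X a b
    using that partial_prelattice_Join(4)[OF P that(1)] rD(4)[OF f'(3)[OF that(1)] f'(1)[OF that(2)]]
    by simp
  moreover have "(b, a) \<in> ?r"
    if "Meet P X = Some a" "b \<in> carr P" "\<forall>x\<in>X. (b, x) \<in> ?r" for X a b
    using that partial_prelattice_Join(4)[of "flip_pl P" X a] P
      rD(5)[OF f'(4)[OF that(1)] f'(1)[OF that(2)]]
    by simp
  ultimately show ?thesis unfolding congruence_iff[OF P] by blast
qed

text \<open>The pairs whose images lie in the congruence on the right form a congruence containing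
  \<open>R\<close>. Finite generation is thereby preserved by \<open>Con_c_map\<close>.\<close>

lemma Con_c_map_cong_gen:
  assumes P: "partial_prelattice P" and Q: "partial_prelattice Q" and f: "pl_hom P Q f"
    and R: "R \<subseteq> carr P \<times> carr P"
  shows "Con_c_map P Q f (cong_gen P R) = cong_gen Q (map_prod f f ` R)"
proof
  have cong: "congruence Q (cong_gen Q (map_prod f f ` R))"
    using f R by (intro congruence_cong_gen[OF Q]) (auto simp: pl_hom_def)
  have "R \<subseteq> {(x, y). x \<in> carr P \<and> y \<in> carr P \<and> (f x, f y) \<in> cong_gen Q (map_prod f f ` R)}"
    using R subset_cong_gen[OF Q, of "map_prod f f ` R"] by force
  then have "cong_gen P R \<subseteq>
      {(x, y). x \<in> carr P \<and> y \<in> carr P \<and> (f x, f y) \<in> cong_gen Q (map_prod f f ` R)}"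
    by (rule cong_gen_least[OF P congruence_vimage[OF P Q f cong]])
  then show "Con_c_map P Q f (cong_gen P R) \<subseteq> cong_gen Q (map_prod f f ` R)"
    unfolding Con_c_map_def by (intro cong_gen_least[OF Q cong]) auto
  show "cong_gen Q (map_prod f f ` R) \<subseteq> Con_c_map P Q f (cong_gen P R)"
    unfolding Con_c_map_def using subset_cong_gen[OF P, of R] by (intro cong_gen_mono[OF Q]) auto
qed

section \<open>Congruences of the free lattice attached to prime filters\<close>

definition free_lat_rel ::
  "'a partial_lat \<Rightarrow> ('a \<Rightarrow> 'a \<Rightarrow> 'e) \<Rightarrow> 'e set \<Rightarrow> ('a lterm set \<times> 'a lterm set) set" where
  "free_lat_rel P \<nu> G = {(term_class P s, term_class P t) | s t.
     s \<in> lterms P \<and> t \<in> lterms P \<and> whitman_le (quot P \<nu> G) s t}"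

lemma whitman_le_big_join:
  assumes "xs \<noteq> []" "\<forall>s\<in>set xs. whitman_le Q s u"
  shows "whitman_le Q (big TJoin xs) u"
  using assms
proof (induction xs rule: list_nonempty_induct)
  case (cons x xs)
  then obtain y ys where "xs = y # ys" by (cases xs) auto
  with cons show ?case by (simp add: whitman_le.join_left)
qed simp

lemma whitman_le_big_meet:
  assumes "xs \<noteq> []" "\<forall>s\<in>set xs. whitman_le Q u s"
  shows "whitman_le Q u (big TMeet xs)"
  using assms
proof (induction xs rule: list_nonempty_induct)
  case (cons x xs)
  then obtain y ys where "xs = y # ys" by (cases xs) auto
  with cons show ?case by (simp add: whitman_le.meet_right)
qed simp

lemma partial_prelattice_free_lat: "partial_lattice P \<Longrightarrow> partial_prelattice (free_lat P)"
  using is_lattice_free_lat[of P] by (simp add: is_lattice_def partial_lattice_def)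

locale balanced_comeasured_lattice = balanced_comeasured +
  assumes partial_lattice: "partial_lattice P"
begin

context
  fixes G :: "'b set"
  assumes G: "prime_filter G"
begin

lemma term_le_whitman_le_quot: "term_le P s t \<Longrightarrow> whitman_le (quot P \<nu> G) s t"
  using term_le_whitman_le[OF prelattice_quot[OF G] congruence_value_rel[OF G]]
  by (simp add: quot_def)

text \<open>Independence of representatives: terms equal in the free lattice on \<open>P\<close> are
  derivable from each other over \<open>quot P \<nu> G\<close>, and cuts replace one by the
  other.\<close>

lemma free_lat_rel_iff:
  assumes s: "s \<in> lterms P" and t: "t \<in> lterms P"
  shows "(term_class P s, term_class P t) \<in> free_lat_rel P \<nu> G \<longleftrightarrow> whitman_le (quot P \<nu> G) s t"
proof
  assume "(term_class P s, term_class P t) \<in> free_lat_rel P \<nu> G"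
  then obtain s' t' where "term_class P s = term_class P s'" "term_class P t = term_class P t'"
    and le: "whitman_le (quot P \<nu> G) s' t'" by (auto simp: free_lat_rel_def)
  then have "whitman_le (quot P \<nu> G) s s'" "whitman_le (quot P \<nu> G) t' t"
    using s t by (auto simp: term_class_eq_iff[OF partial_lattice] intro: term_le_whitman_le_quot)
  with le show "whitman_le (quot P \<nu> G) s t"
    using whitman_le_trans[OF prelattice_quot[OF G]] by blast
qed (use s t in \<open>auto simp: free_lat_rel_def\<close>)

text \<open>Joins and meets in the free lattice are classes of iterated \<open>TJoin\<close> and
  \<open>TMeet\<close> terms, for which leastness and greatestness are iterated
  \<open>join_left\<close> and \<open>meet_right\<close>.\<close>

lemma congruence_free_lat_rel: "congruence (free_lat P) (free_lat_rel P \<nu> G)"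
proof -
  note simps = free_lat_simps[OF partial_lattice] and Q = prelattice_quot[OF G]
  let ?r = "free_lat_rel P \<nu> G"
  have "le (free_lat P) \<subseteq> ?r"
    using term_le_lterms[OF partial_lattice] term_le_whitman_le_quot
    by (fastforce simp: simps free_lat_le_def free_lat_rel_def)
  moreover have "?r \<subseteq> carr (free_lat P) \<times> carr (free_lat P)"
    by (auto simp: simps free_lat_rel_def free_lat_carr_def)
  moreover have "trans ?r"
  proof (rule transI)
    fix A B C assume "(A, B) \<in> ?r" "(B, C) \<in> ?r"
    then obtain s t u where st: "A = term_class P s" "B = term_class P t" "s \<in> lterms P" "t \<in> lterms P"
      "whitman_le (quot P \<nu> G) s t" and u: "C = term_class P u" "u \<in> lterms P"
      unfolding free_lat_rel_def by blast
    then have "whitman_le (quot P \<nu> G) t u" using \<open>(B, C) \<in> ?r\<close> free_lat_rel_iff by simp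
    then have "whitman_le (quot P \<nu> G) s u" using st(5) whitman_le_trans[OF Q] by blast
    with st u show "(A, C) \<in> ?r" by (simp add: free_lat_rel_iff)
  qed
  moreover have "(C, B) \<in> ?r"
    if X: "Join (free_lat P) X = Some C" "B \<in> carr (free_lat P)" "\<forall>A\<in>X. (A, B) \<in> ?r" for X B C
  proof -
    have nefs: "X \<in> nefs (free_lat_carr P)" using X(1) simps(3) by blast
    then obtain xs where xs: "xs \<noteq> []" "set xs \<subseteq> lterms P" "X = term_class P ` set xs"
      by (rule nefs_list[OF partial_lattice])
    obtain u where u: "B = term_class P u" "u \<in> lterms P"
      using X(2) by (auto simp: simps free_lat_carr_def)
    have "is_sup (free_lat_carr P) (free_lat_le P) X C"
      using X(1) free_lat_Join[OF partial_lattice nefs] by simp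
    then have "C = term_class P (big TJoin xs)"
      using is_sup_big[OF partial_lattice xs(1,2)] unfolding xs(3)
      by (rule is_sup_unique[OF partial_order_free_lat(2)[OF partial_lattice]])
    moreover have "\<forall>s\<in>set xs. whitman_le (quot P \<nu> G) s u"
      using X(3) xs(2,3) u free_lat_rel_iff by blast
    ultimately show ?thesis
      using whitman_le_big_join[OF xs(1)] big_join[OF partial_lattice xs(1,2)] u free_lat_rel_iff by simp
  qed
  moreover have "(B, C) \<in> ?r"
    if X: "Meet (free_lat P) X = Some C" "B \<in> carr (free_lat P)" "\<forall>A\<in>X. (B, A) \<in> ?r" for X B C
  proof -
    have nefs: "X \<in> nefs (free_lat_carr P)" using X(1) simps(4) by blast
    then obtain xs where xs: "xs \<noteq> []" "set xs \<subseteq> lterms P" "X = term_class P ` set xs"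
      by (rule nefs_list[OF partial_lattice])
    obtain u where u: "B = term_class P u" "u \<in> lterms P"
      using X(2) by (auto simp: simps free_lat_carr_def)
    have "is_inf (free_lat_carr P) (free_lat_le P) X C"
      using X(1) free_lat_Meet[OF partial_lattice nefs] by simp
    then have "C = term_class P (big TMeet xs)"
      using is_inf_big[OF partial_lattice xs(1,2)] unfolding xs(3)
      by (rule is_inf_unique[OF partial_order_free_lat(2)[OF partial_lattice]])
    moreover have "\<forall>s\<in>set xs. whitman_le (quot P \<nu> G) u s"
      using X(3) xs(2,3) u free_lat_rel_iff by blast
    ultimately show ?thesis
      using whitman_le_big_meet[OF xs(1)] big_meet[OF partial_lattice xs(1,2)] u free_lat_rel_iff by simp
  qed
  ultimately show ?thesis unfolding congruence_iff[OF partial_prelattice_free_lat[OF partial_lattice]] by blast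
qed

text \<open>The payoff of cut elimination: between generators only the ordering of
  \<open>quot P \<nu> G\<close> is derivable, so the extension does not change the given
  values.\<close>

lemma free_lat_rel_map:
  assumes "x \<in> carr P" "y \<in> carr P"
  shows "(free_lat_map P x, free_lat_map P y) \<in> free_lat_rel P \<nu> G \<longleftrightarrow> \<nu> x y \<in> G"
  using assms
  by (simp add: free_lat_map_def free_lat_rel_iff whitman_le_Gen_left[OF prelattice_quot[OF G]]
      value_rel_def)

end

text \<open>A compact congruence has finitely many generating pairs, so containment is a finite
  conjunction of term inequalities.\<close>

lemma has_value_Con_c:
  assumes "\<gamma> \<in> Con_c (free_lat P)"
  shows "has_value (\<lambda>G. \<gamma> \<subseteq> free_lat_rel P \<nu> G)"
proof -
  note pre = partial_prelattice_free_lat[OF partial_lattice]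
  obtain R where R: "finite R" "R \<subseteq> \<gamma>" "\<gamma> = cong_gen (free_lat P) R"
    using Con_c_finitely_generated[OF pre assms] .
  have carr: "R \<subseteq> free_lat_carr P \<times> free_lat_carr P"
    using R(2) assms congruence_subset[OF pre, of \<gamma>]
    by (auto simp: Con_c_def free_lat_simps[OF partial_lattice])
  have "has_value (\<lambda>G. p \<in> free_lat_rel P \<nu> G)" if "p \<in> R" for p
  proof -
    obtain s t where p: "p = (term_class P s, term_class P t)" and st: "s \<in> lterms P" "t \<in> lterms P"
      using carr \<open>p \<in> R\<close> unfolding free_lat_carr_def by blast
    show ?thesis
      using has_value_whitman_le[OF st] by (rule has_value_cong) (simp add: p free_lat_rel_iff st)
  qed
  then have "has_value (\<lambda>G. \<forall>p\<in>R. p \<in> free_lat_rel P \<nu> G)" by (rule has_value_ball[OF R(1)])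
  then show ?thesis
    by (rule has_value_cong)
      (use cong_gen_subset_iff[OF pre congruence_free_lat_rel] R(3) in \<open>auto simp: subset_iff\<close>)
qed

end

theorem theoremA:
  fixes P :: "'a partial_lat"
    and \<phi> :: "('a \<times> 'a) set \<Rightarrow> 'd::{distrib_lattice, bounded_lattice_bot}"
  assumes "balanced_measured P \<phi>"
  shows "\<exists>\<psi> :: ('a lterm set \<times> 'a lterm set) set \<Rightarrow> 'd.
    Con_c_hom (free_lat P) \<psi> \<and>
    (\<forall>\<alpha>\<in>Con_c P. \<psi> (Con_c_map P (free_lat P) (free_lat_map P) \<alpha>) = \<phi> \<alpha>)"
proof -
  have P: "partial_lattice P" "partial_prelattice P" and \<phi>: "Con_c_hom P \<phi>"
    and bal: "balanced P (comeasure P \<phi>)"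
    using assms by (auto simp: balanced_measured_def measured_partial_lattice_def partial_lattice_def)
  interpret balanced_comeasured_lattice P "comeasure P \<phi>"
    using P bal congruence_value_rel_comeasure[OF P(2) \<phi>] by unfold_locales
  let ?M = "free_lat P" and ?r = "free_lat_rel P (comeasure P \<phi>)"
  note M = partial_prelattice_free_lat[OF P(1)]
  \<comment> \<open>The choice is meaningful for compact \<open>\<gamma>\<close>, where such an
    \<open>e\<close> exists; other arguments get an arbitrary value.\<close>
  define \<psi> where "\<psi> \<gamma> = undual (SOME e. \<forall>G. prime_filter G \<longrightarrow> (e \<in> G \<longleftrightarrow> \<gamma> \<subseteq> ?r G))" for \<gamma>
  have \<psi>: "dual (\<psi> \<gamma>) \<in> G \<longleftrightarrow> \<gamma> \<subseteq> ?r G" if "\<gamma> \<in> Con_c ?M" "prime_filter G" for \<gamma> G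
  proof -
    have "\<exists>e. \<forall>G. prime_filter G \<longrightarrow> (e \<in> G \<longleftrightarrow> \<gamma> \<subseteq> ?r G)"
      using has_value_Con_c[OF that(1)] by (simp add: has_value_def)
    from someI_ex[OF this] that(2) show ?thesis by (simp add: \<psi>_def)
  qed
  have \<psi>_eqI: "\<psi> \<gamma> = d"
    if "\<gamma> \<in> Con_c ?M" "\<And>G. prime_filter G \<Longrightarrow> \<gamma> \<subseteq> ?r G \<longleftrightarrow> dual d \<in> G" for \<gamma> d
  proof -
    have "dual (\<psi> \<gamma>) = dual d"
      by (rule prime_filter_ext) (simp add: \<psi>[OF that(1)] that(2))
    then show ?thesis by (simp add: dual_eq_iff)
  qed
  have "\<psi> (le ?M) = bot"
  proof (rule \<psi>_eqI)
    \<comment> \<open>The zero congruence is compact, being generated by the empty set.\<close>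
    show "le ?M \<in> Con_c ?M" using cong_gen_in_Con_c[OF M, of "{}"] by (simp add: cong_gen_empty[OF M])
    show "le ?M \<subseteq> ?r G \<longleftrightarrow> dual bot \<in> G" if "prime_filter G" for G
      using that congruence_free_lat_rel by (simp add: congruence_def prime_filter_mem)
  qed
  moreover have "\<psi> (cong_join ?M \<alpha> \<beta>) = sup (\<psi> \<alpha>) (\<psi> \<beta>)"
    if \<alpha>: "\<alpha> \<in> Con_c ?M" and \<beta>: "\<beta> \<in> Con_c ?M" for \<alpha> \<beta>
  proof (rule \<psi>_eqI)
    show "cong_join ?M \<alpha> \<beta> \<in> Con_c ?M" using cong_join_in_Con_c[OF M \<alpha> \<beta>] .
    show "cong_join ?M \<alpha> \<beta> \<subseteq> ?r G \<longleftrightarrow> dual (sup (\<psi> \<alpha>) (\<psi> \<beta>)) \<in> G" if G: "prime_filter G" for G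
      by (simp add: cong_join_def cong_gen_subset_iff[OF M congruence_free_lat_rel[OF G]]
          \<psi>[OF \<alpha> G] \<psi>[OF \<beta> G] prime_filter_mem[OF G])
  qed
  moreover have "\<psi> (Con_c_map P ?M (free_lat_map P) \<alpha>) = \<phi> \<alpha>" if \<alpha>: "\<alpha> \<in> Con_c P" for \<alpha>
  proof (rule \<psi>_eqI)
    obtain R where R: "finite R" "R \<subseteq> \<alpha>" "\<alpha> = cong_gen P R"
      using Con_c_finitely_generated[OF P(2) \<alpha>] .
    have sub: "\<alpha> \<subseteq> carr P \<times> carr P"
      using \<alpha> congruence_subset[OF P(2)] by (simp add: Con_c_def)
    have f: "pl_hom P ?M (free_lat_map P)" by (rule pl_hom_free_lat_map[OF P(1)])
    have "map_prod (free_lat_map P) (free_lat_map P) ` R \<subseteq> carr ?M \<times> carr ?M"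
      using R(2) sub f by (auto simp: pl_hom_def)
    then show "Con_c_map P ?M (free_lat_map P) \<alpha> \<in> Con_c ?M"
      using Con_c_map_cong_gen[OF P(2) M f order.trans[OF R(2) sub]] R(1,3)
      by (auto intro: cong_gen_in_Con_c[OF M])
    show "Con_c_map P ?M (free_lat_map P) \<alpha> \<subseteq> ?r G \<longleftrightarrow> dual (\<phi> \<alpha>) \<in> G"
      if G: "prime_filter G" for G
    proof -
      \<comment> \<open>As \<open>?r G\<close> is a congruence, it suffices to test the generating
        pairs, which are images of pairs from \<open>P\<close>.\<close>
      have "{(free_lat_map P x, free_lat_map P y) | x y. (x, y) \<in> \<alpha>} \<subseteq> ?r G \<longleftrightarrow>
          (\<forall>(x, y)\<in>\<alpha>. (free_lat_map P x, free_lat_map P y) \<in> ?r G)" by blast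
      also have "\<dots> \<longleftrightarrow> (\<forall>(x, y)\<in>\<alpha>. comeasure P \<phi> x y \<in> G)"
        using sub free_lat_rel_map[OF G] by fastforce
      finally show ?thesis
        by (simp only: Con_c_map_def cong_gen_subset_iff[OF M congruence_free_lat_rel[OF G]]
            comeasure_mem_iff[OF P(2) \<phi> G \<alpha>])
    qed
  qed
  ultimately show ?thesis by (auto simp: Con_c_hom_def)
qed

end
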